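(* Let $\mathcal X=[0,1]^d$. (i) Let $(\mu,\nu)\in\mathcal P^2_{\chi^2}(\mathcal X)$ be such that $f_{\chi^2}=2\big(\frac{d\mu}{d\nu}-1\big)\in\mathsf C(\mathcal X)$, let $\phi\in\{\phi_{\mathsf S},\phi_{\mathsf R}\}$ and $0<\rho<1$. For any sequence $(k_n)_{n\in\mathbb N}$ with $k_n\to\infty$ and $k_n=O(n^{(1-\rho)/5})$, with $\mathcal G_n=\mathcal G^*_{k_n}(\phi)$, $$\hat\chi^2_{\mathcal G_n}(X^n,Y^n)\xrightarrow[n\to\infty]{}\chi^2(\mu\|\nu)\quad\mathbb P\text{-a.s.}$$ (ii) For every $M\ge0$ there is a constant $C_M$ depending only on $M$ such that, with $m_k=\log k$ and $\mathcal G_k=\mathcal G_k^{\mathsf R}(m_k)$, for all $k,n\in\mathbb N$, $$\sup_{(\mu,\nu)\in\mathcal P^2_{\chi^2}(M,\mathcal X)}\mathbb E\Big[\big|\hat\chi^2_{\mathcal G_k}(X^n,Y^n)-\chi^2(\mu\|\nu)\big|\Big]\le C_M\Big(d\,k^{-1/2}+d^{3/2}(\log k)^2n^{-1/2}\Big).$$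
   Context: $\chi^2(\mu\|\nu)=\mathbb E_\nu[(\frac{d\mu}{d\nu}-1)^2]$ if $\mu\ll\nu$ and $\infty$ otherwise. $\mathcal P^2_{\chi^2}(\mathcal X)$ is the set of pairs of Borel probability measures on $\mathcal X$ with $\mu\ll\nu$ and $\chi^2(\mu\|\nu)<\infty$. $\mathcal P^2_{\chi^2}(M,\mathcal X)$ is the set of $(\mu,\nu)\in\mathcal P^2_{\chi^2}(\mathcal X)$ with $c^\star_{\mathsf{KB}}(f_{\chi^2},\mathcal X)\vee\chi^2(\mu\|\nu)\le M$ (pointwise conditions on $f_{\chi^2}$ refer to a suitable version of the density). $\mathsf C(\mathcal X)$: continuous real functions on $\mathcal X$. Klusowski–Barron coefficient: $\|\mathcal X\|:=\sup_{x\in\mathcal X}\|x\|_\infty$. For $\tilde f:\mathbb R^d\to\mathbb R$ with a Fourier representation $\tilde f(x)=\int_{\mathbb R^d}e^{i\omega\cdot x}F(d\omega)$, $F$ a complex Borel measure with magnitude $|F|$, let $S_m(\tilde f)=\int_{\mathbb R^d}\|\omega\|_1^m|F|(d\omega)$. For $f:\mathcal X\to\mathbb R$, $c^\star_{\mathsf{KB}}(f,\mathcal X)$ is the infimum of $c\ge0$ such that some such $\tilde f$ satisfies $\tilde f|_{\mathcal X}=f$, $\|\mathcal X\|S_2(\tilde f)\le c$, $|\tilde f(0)|\le c$ and $\|\nabla\tilde f(0)\|_1\le c$. Neural networks: $\mathcal G_k(a_1,a_2,a_3,a_4,\phi)$ is the set of $g(x)=\sum_{i=1}^k\beta_i\phi(w_i\cdot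 x+b_i)+w_0\cdot x+b_0$ on $\mathbb R^d$ with $\|w_i\|_1\vee|b_i|\le a_1$, $|\beta_i|\le a_2$ ($1\le i\le k$), $|b_0|\le a_3$, $\|w_0\|_1\le a_4$. $\phi_{\mathsf S}(z)=(1+e^{-z})^{-1}$, $\phi_{\mathsf R}(z)=\max\{z,0\}$, $\mathcal G_k^{\mathsf R}(a)=\mathcal G_k(1,2k^{-1}a,a,a,\phi_{\mathsf R})$, $\mathcal G_k^*(\phi)=\mathcal G_k(1,1,1,0,\phi)$. Estimator: $\hat\chi^2_{\mathcal G}(X^n,Y^n)=\sup_{g\in\mathcal G}\frac1n\sum_{i=1}^n\big[g(X_i)-g(Y_i)-\tfrac14g(Y_i)^2\big]$, where $(X_i)$ are i.i.d. from $\mu$ and $(Y_i)$ i.i.d. from $\nu$ (independent samples). *)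

theory Defs
  imports "HOL-Probability.Probability" "HOL-Library.Landau_Symbols"
begin

text \<open>
  The constant in the risk bound has to be uniform in the dimension \<open>d\<close>, so \<open>d\<close> is a natural number
  and not a type.  As in \<^const>\<open>Euclidean_space\<close>, the space \<open>R^d\<close> is the set of sequences
  \<open>nat \<Rightarrow> real\<close> vanishing at all indices \<open>\<ge> d\<close>; its topology is the one induced by
  the topology of \<open>nat \<Rightarrow> real\<close>.
\<close>

type_synonym point = "nat \<Rightarrow> real"

abbreviation Rd :: "nat \<Rightarrow> point set" where
  "Rd d \<equiv> topspace (Euclidean_space d)"

definition cube :: "nat \<Rightarrow> point set" where
  "cube d = {x \<in> Rd d. \<forall>i<d. 0 \<le> x i \<and> x i \<le> 1}"

abbreviation borel_on :: "point set \<Rightarrow> point measure" where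
  "borel_on S \<equiv> restrict_space borel S"

definition dot :: "nat \<Rightarrow> point \<Rightarrow> point \<Rightarrow> real" where
  "dot d x y = (\<Sum>i<d. x i * y i)"

definition l1_norm :: "nat \<Rightarrow> point \<Rightarrow> real" where
  "l1_norm d x = (\<Sum>i<d. \<bar>x i\<bar>)"

definition linf_norm :: "nat \<Rightarrow> point \<Rightarrow> ennreal" where
  "linf_norm d x = (SUP i\<in>{..<d}. ennreal \<bar>x i\<bar>)"

definition set_linf_norm :: "nat \<Rightarrow> point set \<Rightarrow> ennreal" where
  "set_linf_norm d S = (SUP x\<in>S. linf_norm d x)"


text \<open>A complex measure is a set function on the measurable sets of \<open>N\<close>; the measure carried
  by \<open>N\<close> itself is irrelevant.  Countable additivity forces \<open>F {} = 0\<close>.\<close>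

definition complex_measure :: "'a measure \<Rightarrow> ('a set \<Rightarrow> complex) \<Rightarrow> bool" where
  "complex_measure N F \<longleftrightarrow>
     (\<forall>A :: nat \<Rightarrow> 'a set. range A \<subseteq> sets N \<longrightarrow> disjoint_family A \<longrightarrow>
        (\<lambda>i. F (A i)) sums F (\<Union>i. A i))"

definition magnitude :: "'a measure \<Rightarrow> ('a set \<Rightarrow> complex) \<Rightarrow> 'a measure" where
  "magnitude N F = measure_of (space N) (sets N)
     (\<lambda>A. SUP B\<in>{B :: nat \<Rightarrow> 'a set. range B \<subseteq> sets N \<and> disjoint_family B \<and> (\<Union>i. B i) = A}.
        \<Sum>i. ennreal (cmod (F (B i))))"

text \<open>Integration against \<open>F\<close> goes through the polar representation \<open>dF = h d|F|\<close>, \<open>|h| = 1\<close>,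
  which exists for every complex measure and determines \<open>h\<close> up to \<open>|F|\<close>-null sets.\<close>

definition polar_density :: "'a measure \<Rightarrow> ('a set \<Rightarrow> complex) \<Rightarrow> ('a \<Rightarrow> complex) \<Rightarrow> bool" where
  "polar_density N F h \<longleftrightarrow>
     h \<in> borel_measurable N \<and> (\<forall>\<omega>\<in>space N. cmod (h \<omega>) = 1) \<and>
     (\<forall>A\<in>sets N. F A = set_lebesgue_integral (magnitude N F) A h)"

definition has_complex_integral ::
    "'a measure \<Rightarrow> ('a set \<Rightarrow> complex) \<Rightarrow> ('a \<Rightarrow> complex) \<Rightarrow> complex \<Rightarrow> bool" where
  "has_complex_integral N F u I \<longleftrightarrow>
     (\<exists>h. polar_density N F h \<and> integrable (magnitude N F) (\<lambda>\<omega>. u \<omega> * h \<omega>) \<and>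
          I = (\<integral>\<omega>. u \<omega> * h \<omega> \<partial>magnitude N F))"


definition fourier_rep :: "nat \<Rightarrow> (point set \<Rightarrow> complex) \<Rightarrow> (point \<Rightarrow> real) \<Rightarrow> bool" where
  "fourier_rep d F ft \<longleftrightarrow>
     complex_measure (borel_on (Rd d)) F \<and>
     (\<forall>x\<in>Rd d. has_complex_integral (borel_on (Rd d)) F
        (\<lambda>\<omega>. exp (\<i> * complex_of_real (dot d \<omega> x))) (complex_of_real (ft x)))"

text \<open>The functional \<open>S_m\<close>, written in terms of the representing measure (which is uniquely
  determined by the represented function).\<close>

definition fourier_moment :: "nat \<Rightarrow> nat \<Rightarrow> (point set \<Rightarrow> complex) \<Rightarrow> ennreal" where
  "fourier_moment d m F =
     (\<integral>\<^sup>+ \<omega>. ennreal (l1_norm d \<omega> ^ m) \<partial>magnitude (borel_on (Rd d)) F)"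

definition has_gradient_at :: "nat \<Rightarrow> (point \<Rightarrow> real) \<Rightarrow> point \<Rightarrow> point \<Rightarrow> bool" where
  "has_gradient_at d f g x \<longleftrightarrow>
     g \<in> Rd d \<and> (\<forall>i<d. ((\<lambda>t. f (x(i := t))) has_real_derivative g i) (at (x i)))"

text \<open>The infimum of the empty set is \<open>\<infinity>\<close>.\<close>

definition kb_coeff :: "nat \<Rightarrow> (point \<Rightarrow> real) \<Rightarrow> point set \<Rightarrow> ennreal" where
  "kb_coeff d f S = Inf {ennreal c | c. 0 \<le> c \<and>
     (\<exists>ft F g. fourier_rep d F ft \<and> (\<forall>x\<in>S. ft x = f x) \<and>
        set_linf_norm d S * fourier_moment d 2 F \<le> ennreal c \<and>
        \<bar>ft (\<lambda>_. 0)\<bar> \<le> c \<and>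
        has_gradient_at d ft g (\<lambda>_. 0) \<and> l1_norm d g \<le> c)}"


text \<open>Pitfall: \<open>absolutely_continuous \<nu> \<mu>\<close> is \<open>\<mu> \<lless> \<nu>\<close>, and \<open>RN_deriv \<nu> \<mu>\<close> is \<open>d\<mu>/d\<nu>\<close>.\<close>

definition chi2 :: "'a measure \<Rightarrow> 'a measure \<Rightarrow> ennreal" where
  "chi2 \<mu> \<nu> = (if absolutely_continuous \<nu> \<mu>
     then \<integral>\<^sup>+ x. ennreal ((enn2real (RN_deriv \<nu> \<mu> x) - 1)\<^sup>2) \<partial>\<nu> else \<infinity>)"

definition borel_prob_on :: "point set \<Rightarrow> point measure \<Rightarrow> bool" where
  "borel_prob_on S \<mu> \<longleftrightarrow> prob_space \<mu> \<and> sets \<mu> = sets (borel_on S)"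

definition chi2_pairs :: "point set \<Rightarrow> (point measure \<times> point measure) set" where
  "chi2_pairs S = {(\<mu>, \<nu>). borel_prob_on S \<mu> \<and> borel_prob_on S \<nu> \<and>
     absolutely_continuous \<nu> \<mu> \<and> chi2 \<mu> \<nu> < \<infinity>}"

text \<open>\<open>f\<close> is a version of the function \<open>2 (d\<mu>/d\<nu> - 1)\<close>, which is only determined
  \<open>\<nu>\<close>-almost everywhere.\<close>

definition chi2_opt :: "point measure \<Rightarrow> point measure \<Rightarrow> (point \<Rightarrow> real) \<Rightarrow> bool" where
  "chi2_opt \<mu> \<nu> f \<longleftrightarrow>
     f \<in> borel_measurable \<nu> \<and> (AE x in \<nu>. f x = 2 * (enn2real (RN_deriv \<nu> \<mu> x) - 1))"

definition chi2_pairs_bd :: "nat \<Rightarrow> real \<Rightarrow> point set \<Rightarrow> (point measure \<times> point measure) set" where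
  "chi2_pairs_bd d M S = {(\<mu>, \<nu>) \<in> chi2_pairs S.
     \<exists>f. chi2_opt \<mu> \<nu> f \<and> max (kb_coeff d f S) (chi2 \<mu> \<nu>) \<le> ennreal M}"


text \<open>\<open>w 0\<close> and \<open>b 0\<close> are the parameters of the affine part.\<close>

definition nn_class ::
    "nat \<Rightarrow> nat \<Rightarrow> real \<Rightarrow> real \<Rightarrow> real \<Rightarrow> real \<Rightarrow> (real \<Rightarrow> real) \<Rightarrow> (point \<Rightarrow> real) set" where
  "nn_class d k a1 a2 a3 a4 \<phi> =
     {(\<lambda>x. (\<Sum>i=1..k. \<beta> i * \<phi> (dot d (w i) x + b i)) + dot d (w 0) x + b 0) | \<beta> w b.
        (\<forall>i\<in>{1..k}. max (l1_norm d (w i)) \<bar>b i\<bar> \<le> a1 \<and> \<bar>\<beta> i\<bar> \<le> a2) \<and>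
        \<bar>b 0\<bar> \<le> a3 \<and> l1_norm d (w 0) \<le> a4}"

definition sigmoid_act :: "real \<Rightarrow> real" where
  "sigmoid_act z = inverse (1 + exp (- z))"

definition relu :: "real \<Rightarrow> real" where
  "relu z = max z 0"

definition nn_relu :: "nat \<Rightarrow> nat \<Rightarrow> real \<Rightarrow> (point \<Rightarrow> real) set" where
  "nn_relu d k a = nn_class d k 1 (2 * a / real k) a a relu"

definition nn_star :: "nat \<Rightarrow> nat \<Rightarrow> (real \<Rightarrow> real) \<Rightarrow> (point \<Rightarrow> real) set" where
  "nn_star d k \<phi> = nn_class d k 1 1 1 0 \<phi>"

text \<open>Samples are indexed from \<open>0\<close>.  For the (compactly parametrised) classes above the set
  of values is bounded, so that the supremum is a proper real supremum.\<close>

definition chi2_est ::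
    "('a \<Rightarrow> real) set \<Rightarrow> nat \<Rightarrow> (nat \<Rightarrow> 'a) \<Rightarrow> (nat \<Rightarrow> 'a) \<Rightarrow> real" where
  "chi2_est G n x y =
     (SUP g\<in>G. 1 / real n * (\<Sum>i<n. g (x i) - g (y i) - 1 / 4 * (g (y i))\<^sup>2))"

definition iid_samples :: "'w measure \<Rightarrow> 'a measure \<Rightarrow> 'a measure \<Rightarrow>
    (nat \<Rightarrow> 'w \<Rightarrow> 'a) \<Rightarrow> (nat \<Rightarrow> 'w \<Rightarrow> 'a) \<Rightarrow> bool" where
  "iid_samples P \<mu> \<nu> X Y \<longleftrightarrow>
     prob_space P \<and>
     prob_space.indep_vars P (case_sum (\<lambda>_. \<mu>) (\<lambda>_. \<nu>)) (case_sum X Y) (UNIV :: (nat + nat) set) \<and>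
     (\<forall>i. distr P \<mu> (X i) = \<mu>) \<and> (\<forall>i. distr P \<nu> (Y i) = \<nu>)"

text \<open>The joint law of the first \<open>n\<close> terms of independent i.i.d. sequences from \<open>\<mu>\<close> and \<open>\<nu>\<close>.\<close>

definition sample_law :: "nat \<Rightarrow> 'a measure \<Rightarrow> 'a measure \<Rightarrow> ((nat \<Rightarrow> 'a) \<times> (nat \<Rightarrow> 'a)) measure" where
  "sample_law n \<mu> \<nu> = (\<Pi>\<^sub>M i\<in>{..<n}. \<mu>) \<Otimes>\<^sub>M (\<Pi>\<^sub>M i\<in>{..<n}. \<nu>)"

end

theory Submission
  imports Defs "HOL-Real_Asymp.Real_Asymp"
begin

text \<open>Write \<open>f = 2 (d\<mu>/d\<nu> - 1)\<close>.  Completing the square shows that the population objective of a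
bounded function \<open>g\<close> is \<open>E_\<mu> g - E_\<nu> g - E_\<nu> g\<^sup>2 / 4 = chi2 - E_\<nu> (f - g)\<^sup>2 / 4\<close>
(\<open>chi2_variational\<close>).  It never exceeds chi-square, and it falls short by a quarter of the squared
\<open>L\<^sup>2(\<nu>)\<close> distance of \<open>g\<close> from \<open>f\<close>.  Hence the error of the estimator is at most the
largest deviation of the sample objective from the population objective over the network class, plus
a quarter of the squared distance from \<open>f\<close> to any one network of the class
(\<open>estimator_error\<close>).

Deviation.  Every network is a linear combination of ridge functions \<open>\<phi> (w \<bullet> x + b)\<close>
with \<open>|w|_1, |b| \<le> 1\<close> and coefficients of total weight \<open>L\<close>; its square is then a
combination of products of two ridge functions, of total weight \<open>L\<^sup>2\<close>.  The deviation is
linear in the test function, so it is at most a constant times \<open>(L + L\<^sup>2) W\<close>, where \<open>W\<close>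
is the largest deviation over products of two ridge functions
(\<open>deviation_of_product_of_ridge_sums\<close>).  The number of neurons enters only through \<open>L\<close>.
The products form a bounded Lipschitz family with \<open>2 d + 2\<close> parameters.  Chaining along dyadic grids,
with Hoeffding's lemma at every link, gives \<open>E W = O(d^(3/2) n^(-1/2))\<close>
(\<open>uniform_deviation\<close>); one grid of mesh \<open>1/n\<close> together with Hoeffding's inequality and the
Borel--Cantelli lemma gives \<open>W = O(n^(-9/20))\<close> almost surely
(\<open>ridge_deviation_eventually\<close>).

Approximation for the risk bound.  Only the squared \<open>L\<^sup>2\<close> distance matters, so a rate of
\<open>1/k\<close> from Maurey's argument is more than enough.  Taylor's formula with integral remainder writes
\<open>exp (i \<omega> \<bullet> x)\<close>, minus its affine part at 0, as an average of rectified linear ridge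
functions (\<open>taylor_kink\<close>).  Integrating against the Fourier measure makes \<open>f\<close>, up to an affine
function, an average of ridge functions of size at most twice the second moment
(\<open>barron_representation\<close>), and an average is approximated by \<open>k\<close> well-chosen samples
(\<open>maurey\<close>, \<open>kb_approximation\<close>).  Once \<open>log k\<close> exceeds the bound on the coefficient,
these samples form a network of the class; the remaining values of \<open>k\<close> are bounded in terms of
\<open>M\<close>, and there the trivial bound on the estimator suffices.

Approximation for consistency.  It is enough that ridge sums are dense in the continuous functions for the
\<open>L\<^sup>2(\<nu>)\<close> norm, since a fixed ridge sum belongs to all sufficiently large networks of the
class.  For the sigmoid, difference quotients in the weights produce all monomials, and the
Stone--Weierstrass theorem applies; rectified linear units approximate sigmoidal ridge functions by
Taylor's formula and Maurey's argument.  As \<open>L = O(n^(1/5))\<close>, the deviation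
\<open>L\<^sup>2 n^(-9/20)\<close> vanishes.\<close>

section \<open>Deviation of sample means from expectations\<close>

definition sampling_error :: "'a measure \<Rightarrow> nat \<Rightarrow> ('a \<Rightarrow> real) \<Rightarrow> (nat \<Rightarrow> 'a) \<Rightarrow> real" where
  "sampling_error \<mu> n h x = (\<Sum>i<n. h (x i)) / real n - (\<integral>z. h z \<partial>\<mu>)"

lemma integrable_bounded:
  fixes h :: "'a \<Rightarrow> real"
  assumes "finite_measure \<mu>" "h \<in> borel_measurable \<mu>" "\<And>x. x \<in> space \<mu> \<Longrightarrow> \<bar>h x\<bar> \<le> c"
  shows "integrable \<mu> h"
  using assms by (intro finite_measure.integrable_const_bound[where B=c]) auto

lemma sampling_error_diff:
  assumes "integrable \<mu> f" "integrable \<mu> g"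
  shows "sampling_error \<mu> n (\<lambda>x. f x - g x) x = sampling_error \<mu> n f x - sampling_error \<mu> n g x"
  using assms by (simp add: sampling_error_def sum_subtractf diff_divide_distrib)

lemma sampling_error_bounded:
  assumes "prob_space \<mu>" "h \<in> borel_measurable \<mu>" "\<And>x. x \<in> space \<mu> \<Longrightarrow> \<bar>h x\<bar> \<le> c"
    and "\<And>i. i < n \<Longrightarrow> x i \<in> space \<mu>"
  shows "\<bar>sampling_error \<mu> n h x\<bar> \<le> 2 * c"
proof -
  interpret prob_space \<mu> by fact
  have c: "c \<ge> 0" using not_empty assms(3) by fastforce
  have "\<bar>\<Sum>i<n. h (x i)\<bar> \<le> (\<Sum>i<n. c)"
    using assms by (intro order.trans[OF sum_abs] sum_mono) auto
  hence "\<bar>(\<Sum>i<n. h (x i)) / real n\<bar> \<le> c"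
    using c by (cases "n = 0") (auto simp: field_simps)
  moreover have "\<bar>\<integral>z. h z \<partial>\<mu>\<bar> \<le> c"
  proof -
    have i: "integrable \<mu> h" using assms(2,3) by (intro integrable_bounded[of _ _ c]) unfold_locales
    have "\<integral>z. h z \<partial>\<mu> \<le> c" "\<integral>z. h z \<partial>\<mu> \<ge> -c"
      using assms(3) i by (auto intro!: integral_le_const integral_ge_const AE_I2 simp: abs_le_iff minus_le_iff)
    thus ?thesis by linarith
  qed
  ultimately show ?thesis unfolding sampling_error_def by linarith
qed

locale iid_sample = prob_space M for M :: "'w measure" +
  fixes \<mu> :: "'a measure" and X :: "nat \<Rightarrow> 'w \<Rightarrow> 'a" and n :: nat
  assumes indep: "indep_vars (\<lambda>_. \<mu>) X {..<n}"
    and distr: "\<And>i. i < n \<Longrightarrow> distr M \<mu> (X i) = \<mu>"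
    and n_pos: "n > 0"
begin

lemma X_measurable: "i < n \<Longrightarrow> X i \<in> measurable M \<mu>"
  using indep by (auto simp: indep_vars_def)

lemma prob_space_law: "prob_space \<mu>"
  using prob_space_distr[OF X_measurable[OF n_pos]] distr[OF n_pos] by simp

lemma X_in_space: "\<omega> \<in> space M \<Longrightarrow> i < n \<Longrightarrow> X i \<omega> \<in> space \<mu>"
  using X_measurable by (auto dest: measurable_space)

lemma expectation_sample:
  fixes h :: "'a \<Rightarrow> real"
  assumes "h \<in> borel_measurable \<mu>" "i < n"
  shows "expectation (\<lambda>\<omega>. h (X i \<omega>)) = (\<integral>x. h x \<partial>\<mu>)"
  using integral_distr[OF X_measurable[OF assms(2)] assms(1)] distr[OF assms(2)] by simp

lemma sampling_error_measurable:
  assumes "h \<in> borel_measurable \<mu>"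
  shows "(\<lambda>\<omega>. sampling_error \<mu> n h (\<lambda>i. X i \<omega>)) \<in> borel_measurable M"
  unfolding sampling_error_def
  using assms X_measurable by (auto intro!: borel_measurable_diff borel_measurable_divide borel_measurable_sum
      measurable_compose[OF X_measurable assms])

lemma sampling_error_eq_sum:
  assumes "h \<in> borel_measurable \<mu>"
  shows "sampling_error \<mu> n h x = (\<Sum>i<n. h (x i) / n - expectation (\<lambda>\<omega>. h (X i \<omega>) / n))"
  using n_pos expectation_sample[OF assms]
  by (simp add: sampling_error_def sum_subtractf sum_divide_distrib)

lemma scaled_sample:
  assumes h: "h \<in> borel_measurable \<mu>" and c: "\<And>x. x \<in> space \<mu> \<Longrightarrow> \<bar>h x\<bar> \<le> c"
  shows "indep_interval_bounded_random_variables M {..<n} (\<lambda>i \<omega>. h (X i \<omega>) / n)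
           (\<lambda>_. - (c / n)) (\<lambda>_. c / n)"
proof unfold_locales
  show "indep_vars (\<lambda>_. borel) (\<lambda>i \<omega>. h (X i \<omega>) / real n) {..<n}"
    using h by (intro indep_vars_compose2[OF indep, where Y="\<lambda>i x. h x / n"]) auto
  fix i assume "i \<in> {..<n}"
  thus "AE \<omega> in M. h (X i \<omega>) / real n \<in> {- (c / real n)..c / real n}"
    using c X_in_space n_pos
    by (intro AE_I2) (auto simp: abs_le_iff minus_divide_left simp del: minus_divide_left[symmetric]
       intro!: divide_right_mono, force)
qed auto

text \<open>Hoeffding's lemma for sample means: independence turns the moment generating function of the
sum into a product, each factor of which is that of a centred variable ranging over an interval of length
\<open>2 c / n\<close>.\<close>

lemma mgf_sampling_error:
  assumes h: "h \<in> borel_measurable \<mu>" and c: "\<And>x. x \<in> space \<mu> \<Longrightarrow> \<bar>h x\<bar> \<le> c" and l: "l > 0"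
  shows "expectation (\<lambda>\<omega>. exp (l * sampling_error \<mu> n h (\<lambda>i. X i \<omega>))) \<le> exp (l\<^sup>2 * c\<^sup>2 / (2 * n))"
proof -
  interpret indep_interval_bounded_random_variables M "{..<n}" "\<lambda>i \<omega>. h (X i \<omega>) / n"
      "\<lambda>_. - (c / n)" "\<lambda>_. c / n"
    by (rule scaled_sample[OF h c])
  let ?Y = "\<lambda>i \<omega>. h (X i \<omega>) / n"
  have "(\<integral>\<^sup>+\<omega>. ennreal (exp (l * sampling_error \<mu> n h (\<lambda>i. X i \<omega>))) \<partial>M)
      = (\<integral>\<^sup>+\<omega>. (\<Prod>i<n. ennreal (exp (l * (?Y i \<omega> - expectation (?Y i))))) \<partial>M)"
    by (intro nn_integral_cong)
       (simp add: sampling_error_eq_sum[OF h] sum_distrib_left exp_sum prod_ennreal)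
  also have "\<dots> = (\<Prod>i<n. \<integral>\<^sup>+\<omega>. ennreal (exp (l * (?Y i \<omega> - expectation (?Y i)))) \<partial>M)"
    by (intro indep_vars_nn_integral fin indep_vars_compose2[OF indep_interval_bounded_random_variables.indep[OF scaled_sample[OF h c]]]) auto
  also have "\<dots> \<le> (\<Prod>i<n. ennreal (exp (l\<^sup>2 * (c / n - (- (c / n)))\<^sup>2 / 8)))"
  proof (intro prod_mono_ennreal)
    fix i assume i: "i \<in> {..<n}"
    from i interpret interval_bounded_random_variable M "?Y i" "- (c / n)" "c / n" ..
    show "(\<integral>\<^sup>+\<omega>. ennreal (exp (l * (?Y i \<omega> - expectation (?Y i)))) \<partial>M)
        \<le> ennreal (exp (l\<^sup>2 * (c / n - (- (c / n)))\<^sup>2 / 8))"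
      by (rule Hoeffdings_lemma_nn_integral) fact+
  qed
  also have "\<dots> = ennreal (exp (n * (l\<^sup>2 * (c / n - (- (c / n)))\<^sup>2 / 8)))"
    by (simp add: ennreal_power flip: exp_of_nat_mult)
  also have "n * (l\<^sup>2 * (c / n - (- (c / n)))\<^sup>2 / 8) = l\<^sup>2 * c\<^sup>2 / (2 * n)"
    using n_pos by (simp add: field_simps power2_eq_square)
  finally have "(\<integral>\<^sup>+\<omega>. ennreal (exp (l * sampling_error \<mu> n h (\<lambda>i. X i \<omega>))) \<partial>M)
      \<le> ennreal (exp (l\<^sup>2 * c\<^sup>2 / (2 * n)))" .
  thus ?thesis
    using sampling_error_measurable[OF h]
    by (subst integral_eq_nn_integral) (auto intro: enn2real_leI)
qed

lemma hoeffding_sampling_error: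
  fixes t c :: real
  assumes h: "h \<in> borel_measurable \<mu>" and c: "\<And>x. x \<in> space \<mu> \<Longrightarrow> \<bar>h x\<bar> \<le> c"
    and "c > 0" "t \<ge> 0"
  shows "prob {\<omega>\<in>space M. \<bar>sampling_error \<mu> n h (\<lambda>i. X i \<omega>)\<bar> \<ge> t} \<le> 2 * exp (- (n * t\<^sup>2 / (2 * c\<^sup>2)))"
proof -
  let ?Y = "\<lambda>i \<omega>. h (X i \<omega>) / n"
  interpret Hoeffding_ineq M "{..<n}" ?Y "\<lambda>_. - (c / n)" "\<lambda>_. c / n" "\<Sum>i<n. expectation (?Y i)"
    unfolding Hoeffding_ineq_def using scaled_sample[OF h c] by simp
  have "prob {\<omega>\<in>space M. \<bar>(\<Sum>i<n. ?Y i \<omega>) - (\<Sum>i<n. expectation (?Y i))\<bar> \<ge> t}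
     \<le> 2 * exp (- 2 * t\<^sup>2 / (\<Sum>i<n. (c / n - (- (c / n)))\<^sup>2))"
    by (rule Hoeffding_ineq_abs_ge) (use assms n_pos in auto)
  also have "- 2 * t\<^sup>2 / (\<Sum>i<n. (c / n - (- (c / n)))\<^sup>2) = - (n * t\<^sup>2 / (2 * c\<^sup>2))"
    using n_pos \<open>c > 0\<close> by (simp add: field_simps power2_eq_square)
  also have "(\<lambda>\<omega>. (\<Sum>i<n. ?Y i \<omega>) - (\<Sum>i<n. expectation (?Y i)))
     = (\<lambda>\<omega>. sampling_error \<mu> n h (\<lambda>i. X i \<omega>))"
    by (simp add: sampling_error_eq_sum[OF h] sum_subtractf)
  finally show ?thesis .
qed

text \<open>The maximum of finitely many sub-Gaussian variables grows only like the square root of the logarithm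
of their number: \<open>exp (l Z)\<close> is at most the sum of the exponentials of all deviations and
of their negatives, and this sum has expectation at most \<open>K\<close>.  The expectation leaves the exponential
through the tangent inequality \<open>ln (y / K) \<le> y / K - 1\<close>.\<close>

lemma expectation_Max_sampling_error:
  assumes I: "finite I" "I \<noteq> {}"
    and h: "\<And>i. i \<in> I \<Longrightarrow> h i \<in> borel_measurable \<mu>"
    and c: "\<And>i x. i \<in> I \<Longrightarrow> x \<in> space \<mu> \<Longrightarrow> \<bar>h i x\<bar> \<le> c" and "c > 0"
  defines "Z \<equiv> (\<lambda>\<omega>. Max ((\<lambda>i. \<bar>sampling_error \<mu> n (h i) (\<lambda>j. X j \<omega>)\<bar>) ` I))"
  shows "integrable M Z" "expectation Z \<le> c * sqrt (2 * ln (2 * card I) / n)"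
proof -
  let ?e = "\<lambda>i \<omega>. sampling_error \<mu> n (h i) (\<lambda>j. X j \<omega>)"
  have e_meas: "?e i \<in> borel_measurable M" if "i \<in> I" for i
    by (rule sampling_error_measurable[OF h[OF that]])
  have e_bd: "\<bar>?e i \<omega>\<bar> \<le> 2 * c" if "i \<in> I" "\<omega> \<in> space M" for i \<omega>
    using that by (intro sampling_error_bounded prob_space_law h c X_in_space)
  have Zmem: "Z \<omega> \<in> (\<lambda>i. \<bar>?e i \<omega>\<bar>) ` I" for \<omega>
    unfolding Z_def using I by (intro Max_in) auto
  have Zm: "Z \<in> borel_measurable M"
    unfolding Z_def using I e_meas by (intro borel_measurable_Max borel_measurable_abs) auto
  have "\<bar>Z \<omega>\<bar> \<le> 2 * c" if "\<omega> \<in> space M" for \<omega>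
    using Zmem[of \<omega>] e_bd[OF _ that] by auto
  thus Zint: "integrable M Z"
    by (intro integrable_bounded[OF finite_measure_axioms Zm])
  define N where "N = real (card I)"
  have N: "N \<ge> 1" using I by (simp add: N_def Suc_leI card_gt_0_iff)
  \<comment> \<open>This value balances the two terms \<open>ln (2 N) / l\<close> and \<open>l c\<^sup>2 / (2 n)\<close>.\<close>
  define l where "l = sqrt (2 * n * ln (2 * N)) / c"
  have ln_pos: "ln (2 * N) > 0" using N by simp
  have l: "l > 0" using N \<open>c > 0\<close> n_pos by (simp add: l_def)
  define K where "K = 2 * N * exp (l\<^sup>2 * c\<^sup>2 / (2 * n))"
  have K: "K > 0" using N by (simp add: K_def)
  define T where "T = (\<lambda>\<omega>. \<Sum>i\<in>I. exp (l * ?e i \<omega>) + exp (l * sampling_error \<mu> n (\<lambda>x. - h i x) (\<lambda>j. X j \<omega>)))"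
  have neg: "sampling_error \<mu> n (\<lambda>x. - h i x) x = - sampling_error \<mu> n (h i) x" for i x
    by (simp add: sampling_error_def sum_negf)
  have exp_int: "integrable M (\<lambda>\<omega>. exp (l * ?e i \<omega>))" "integrable M (\<lambda>\<omega>. exp (l * - ?e i \<omega>))" if i: "i \<in> I" for i
  proof -
    show "integrable M (\<lambda>\<omega>. exp (l * ?e i \<omega>))"
      by (rule integrable_bounded[where c="exp (l * (2 * c))"])
         (use e_meas[OF i] e_bd[OF i] l in \<open>auto intro!: finite_measure_axioms simp: abs_le_iff\<close>)
    have "l * - ?e i \<omega> \<le> l * (2 * c)" if "\<omega> \<in> space M" for \<omega>
      using e_bd[OF i that] l by (intro mult_left_mono) auto
    thus "integrable M (\<lambda>\<omega>. exp (l * - ?e i \<omega>))"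
      by (intro integrable_bounded[where c="exp (l * (2 * c))"])
         (use e_meas[OF i] l in \<open>auto intro!: finite_measure_axioms simp del: mult_minus_right\<close>)
  qed
  have Tint: "integrable M T" unfolding T_def neg using exp_int by auto
  have "expectation T = (\<Sum>i\<in>I. expectation (\<lambda>\<omega>. exp (l * ?e i \<omega>))
         + expectation (\<lambda>\<omega>. exp (l * sampling_error \<mu> n (\<lambda>x. - h i x) (\<lambda>j. X j \<omega>))))"
    unfolding T_def neg using exp_int by (subst Bochner_Integration.integral_sum) (auto intro!: sum.cong)
  also have "\<dots> \<le> (\<Sum>i\<in>I. exp (l\<^sup>2 * c\<^sup>2 / (2 * n)) + exp (l\<^sup>2 * c\<^sup>2 / (2 * n)))"
    using h c l by (intro sum_mono add_mono mgf_sampling_error) auto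
  also have "\<dots> = K" by (simp add: K_def N_def)
  finally have ET: "expectation T \<le> K" .
  have pt: "l * Z \<omega> \<le> T \<omega> / K - 1 + ln K" if "\<omega> \<in> space M" for \<omega>
  proof -
    from Zmem obtain i where i: "i \<in> I" "Z \<omega> = \<bar>?e i \<omega>\<bar>" by auto
    have "ln (exp (l * Z \<omega>) / K) \<le> exp (l * Z \<omega>) / K - 1"
      using K by (intro ln_le_minus_one) auto
    hence "l * Z \<omega> \<le> exp (l * Z \<omega>) / K - 1 + ln K" using K by (simp add: ln_div)
    moreover have "exp (l * Z \<omega>) \<le> exp (l * ?e i \<omega>) + exp (l * sampling_error \<mu> n (\<lambda>x. - h i x) (\<lambda>j. X j \<omega>))"
      unfolding i neg by (cases "?e i \<omega> \<ge> 0") (auto intro: add_increasing add_increasing2)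
    moreover have "\<dots> \<le> T \<omega>" unfolding T_def using i(1) I by (intro member_le_sum) (auto intro!: add_nonneg_nonneg)
    ultimately show ?thesis using K by (smt (verit) divide_right_mono)
  qed
  have "l * expectation Z = expectation (\<lambda>\<omega>. l * Z \<omega>)" by simp
  also have "\<dots> \<le> expectation (\<lambda>\<omega>. T \<omega> / K - 1 + ln K)"
    using Zint Tint pt by (intro integral_mono) auto
  also have "\<dots> = expectation T / K - 1 + ln K" using Tint by (simp add: prob_space)
  also have "\<dots> \<le> ln K" using ET K by (simp add: field_simps)
  also have "ln K = ln (2 * N) + l\<^sup>2 * c\<^sup>2 / (2 * n)" using N by (simp add: K_def ln_mult)
  also have "l\<^sup>2 * c\<^sup>2 / (2 * n) = ln (2 * N)"
    using \<open>c > 0\<close> n_pos ln_pos by (simp add: l_def field_simps power_divide)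
  finally have "expectation Z \<le> 2 * ln (2 * N) / l" using l by (simp add: field_simps)
  also have "\<dots> = c * sqrt (2 * ln (2 * N) / n)"
    using \<open>c > 0\<close> n_pos ln_pos
    by (simp add: l_def real_sqrt_mult real_sqrt_divide field_simps)
  finally show "expectation Z \<le> c * sqrt (2 * ln (2 * card I) / n)" by (simp add: N_def)
qed

end

section \<open>Uniform deviation over a Lipschitz family\<close>

text \<open>Parameters are rounded down coordinatewise to multiples of \<open>1/m\<close>.  The restriction to
the first \<open>D\<close> coordinates makes the set of rounded parameters finite.\<close>

definition snap :: "nat \<Rightarrow> nat \<Rightarrow> (nat \<Rightarrow> real) \<Rightarrow> nat \<Rightarrow> real" where
  "snap D m p = restrict (\<lambda>i. real_of_int \<lfloor>real m * p i\<rfloor> / real m) {..<D}"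

definition grid :: "nat \<Rightarrow> nat \<Rightarrow> (nat \<Rightarrow> real) set" where
  "grid D m = PiE {..<D} (\<lambda>_. (\<lambda>z::int. real_of_int z / real m) ` {- int m..int m})"

lemma finite_grid: "finite (grid D m)"
  unfolding grid_def by (intro finite_PiE) auto

lemma card_grid_le: "real (card (grid D m)) \<le> (2 * real m + 1) ^ D"
proof -
  have "card ((\<lambda>z::int. real_of_int z / real m) ` {- int m..int m}) \<le> 2 * m + 1"
    by (rule order.trans[OF card_image_le]) auto
  hence "card (grid D m) \<le> (2 * m + 1) ^ D"
    unfolding grid_def by (subst card_PiE) (auto intro: power_mono)
  hence "real (card (grid D m)) \<le> real ((2 * m + 1) ^ D)" by linarith
  thus ?thesis by (simp add: add.commute)
qed

lemma snap_in_grid: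
  assumes "m > 0" "\<And>i. i < D \<Longrightarrow> \<bar>p i\<bar> \<le> 1"
  shows "snap D m p \<in> grid D m"
proof -
  have "\<lfloor>real m * p i\<rfloor> \<in> {- int m..int m}" if "i < D" for i
  proof -
    have "- 1 \<le> p i" "p i \<le> 1" using assms(2)[OF that] by (auto simp: abs_le_iff)
    hence "real m * p i \<le> real m * 1" "real m * (-1) \<le> real m * p i"
      by (intro mult_left_mono; simp)+
    thus ?thesis by (simp add: floor_le_iff le_floor_iff)
  qed
  thus ?thesis unfolding snap_def grid_def by auto
qed

lemma snap_error:
  assumes "m > 0" "i < D"
  shows "\<bar>p i - snap D m p i\<bar> \<le> 1 / real m"
proof -
  have "\<bar>real m * p i - real_of_int \<lfloor>real m * p i\<rfloor>\<bar> \<le> 1"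
    by linarith
  moreover have "p i - snap D m p i = (real m * p i - real_of_int \<lfloor>real m * p i\<rfloor>) / real m"
    using assms by (simp add: snap_def diff_divide_distrib)
  ultimately show ?thesis using assms by (simp add: divide_right_mono)
qed

lemma floor_half_floor: "\<lfloor>real_of_int \<lfloor>2 * x\<rfloor> / 2\<rfloor> = \<lfloor>x :: real\<rfloor>"
proof -
  have "2 * \<lfloor>x\<rfloor> \<le> \<lfloor>2 * x\<rfloor>" by (simp add: le_floor_iff)
  moreover have "\<lfloor>2 * x\<rfloor> < 2 * \<lfloor>x\<rfloor> + 2" unfolding floor_less_iff by simp linarith
  ultimately show ?thesis by (intro floor_unique) linarith+
qed

text \<open>Rounding down is compatible with halving the mesh, so a rounded parameter determines all its coarser
roundings.  Therefore the number of links between two consecutive levels of the chain is the number of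
points of the finer grid.\<close>

lemma snap_snap:
  assumes "m > 0"
  shows "snap D m (snap D (2 * m) p) = snap D m p"
proof -
  have "real m * (real_of_int \<lfloor>2 * real m * p i\<rfloor> / (2 * real m))
      = real_of_int \<lfloor>2 * (real m * p i)\<rfloor> / 2" for i
    using assms by (simp add: field_simps mult.assoc)
  thus ?thesis unfolding snap_def
    using floor_half_floor[of "real m * p _"] by (auto simp: fun_eq_iff restrict_def)
qed

text \<open>The Lipschitz condition involves only the first \<open>D\<close> coordinates of a parameter, so in
particular the functions depend on nothing else.\<close>

locale lipschitz_family = iid_sample +
  fixes \<psi> :: "(nat \<Rightarrow> real) \<Rightarrow> 'b \<Rightarrow> real" and D :: nat and B b :: real
  assumes psi_measurable: "\<psi> p \<in> borel_measurable \<mu>"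
    and psi_bound: "x \<in> space \<mu> \<Longrightarrow> \<bar>\<psi> p x\<bar> \<le> b"
    and psi_lipschitz: "x \<in> space \<mu> \<Longrightarrow> \<bar>\<psi> p x - \<psi> q x\<bar> \<le> B * (\<Sum>i<D. \<bar>p i - q i\<bar>)"
    and B_pos: "B > 0" and b_pos: "b > 0" and D_pos: "D > 0"
begin

abbreviation dev :: "(nat \<Rightarrow> real) \<Rightarrow> 'a \<Rightarrow> real" where
  "dev p \<omega> \<equiv> sampling_error \<mu> n (\<psi> p) (\<lambda>i. X i \<omega>)"

lemma psi_integrable: "integrable \<mu> (\<psi> p)"
  using prob_space_law by (intro integrable_bounded[OF _ psi_measurable psi_bound])
     (auto simp: prob_space_def)

lemma psi_snap:
  assumes "m > 0" "x \<in> space \<mu>"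
  shows "\<bar>\<psi> p x - \<psi> (snap D m p) x\<bar> \<le> B * D / m"
proof -
  have "\<bar>\<psi> p x - \<psi> (snap D m p) x\<bar> \<le> B * (\<Sum>i<D. \<bar>p i - snap D m p i\<bar>)"
    by (rule psi_lipschitz[OF assms(2)])
  also have "\<dots> \<le> B * (\<Sum>i<D. 1 / m)"
    using B_pos assms(1) snap_error by (intro mult_left_mono sum_mono) auto
  finally show ?thesis by simp
qed

lemma dev_snap:
  assumes "m > 0" "\<omega> \<in> space M"
  shows "\<bar>dev p \<omega> - dev (snap D m p) \<omega>\<bar> \<le> 2 * (B * D / m)"
proof -
  have "\<bar>sampling_error \<mu> n (\<lambda>x. \<psi> p x - \<psi> (snap D m p) x) (\<lambda>i. X i \<omega>)\<bar> \<le> 2 * (B * D / m)"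
    by (intro sampling_error_bounded prob_space_law borel_measurable_diff psi_measurable psi_snap
        X_in_space assms)
  thus ?thesis by (simp add: sampling_error_diff psi_integrable)
qed

definition net_max :: "nat \<Rightarrow> 'a \<Rightarrow> real" where
  "net_max m \<omega> = Max ((\<lambda>q. \<bar>dev q \<omega>\<bar>) ` grid D m)"

definition link_max :: "nat \<Rightarrow> 'a \<Rightarrow> real" where
  "link_max m \<omega> = Max ((\<lambda>q. \<bar>sampling_error \<mu> n (\<lambda>x. \<psi> q x - \<psi> (snap D m q) x) (\<lambda>i. X i \<omega>)\<bar>) ` grid D (2 * m))"

lemma grid_nonempty: "m > 0 \<Longrightarrow> grid D m \<noteq> {}"
  using snap_in_grid[of m D "\<lambda>_. 0"] by auto

text \<open>One-level discretisation, used for almost sure convergence with a mesh that shrinks with the sample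
size.\<close>

lemma dev_le_net_max:
  assumes "m > 0" "\<omega> \<in> space M" "\<And>i. i < D \<Longrightarrow> \<bar>p i\<bar> \<le> 1"
  shows "\<bar>dev p \<omega>\<bar> \<le> net_max m \<omega> + 2 * (B * D / m)"
proof -
  have "\<bar>dev (snap D m p) \<omega>\<bar> \<le> net_max m \<omega>"
    unfolding net_max_def using snap_in_grid[OF assms(1,3)] finite_grid by (intro Max_ge) auto
  thus ?thesis using dev_snap[OF assms(1,2), of p] by linarith
qed

lemma prob_net_max:
  fixes t :: real
  assumes "m > 0" "t \<ge> 0"
  shows "prob {\<omega> \<in> space M. net_max m \<omega> \<ge> t} \<le> (2 * real m + 1) ^ D * (2 * exp (- (n * t\<^sup>2 / (2 * b\<^sup>2))))"
    and "{\<omega> \<in> space M. net_max m \<omega> \<ge> t} \<in> sets M"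
proof -
  have eq: "{\<omega> \<in> space M. net_max m \<omega> \<ge> t} = (\<Union>q\<in>grid D m. {\<omega> \<in> space M. \<bar>dev q \<omega>\<bar> \<ge> t})"
    unfolding net_max_def using finite_grid grid_nonempty[OF assms(1)] by (auto simp: Max_ge_iff)
  have sets: "{\<omega> \<in> space M. \<bar>dev q \<omega>\<bar> \<ge> t} \<in> sets M" for q
    using sampling_error_measurable[OF psi_measurable] by measurable
  show "{\<omega> \<in> space M. net_max m \<omega> \<ge> t} \<in> sets M"
    unfolding eq using finite_grid sets by (intro sets.finite_UN) auto
  have "prob {\<omega> \<in> space M. net_max m \<omega> \<ge> t} \<le> (\<Sum>q\<in>grid D m. prob {\<omega> \<in> space M. \<bar>dev q \<omega>\<bar> \<ge> t})"
    unfolding eq using finite_grid sets by (intro finite_measure_subadditive_finite) auto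
  also have "\<dots> \<le> (\<Sum>q\<in>grid D m. 2 * exp (- (n * t\<^sup>2 / (2 * b\<^sup>2))))"
    using psi_measurable psi_bound b_pos assms by (intro sum_mono hoeffding_sampling_error) auto
  also have "\<dots> \<le> (2 * real m + 1) ^ D * (2 * exp (- (n * t\<^sup>2 / (2 * b\<^sup>2))))"
    using card_grid_le[of D m] by (simp add: mult_right_mono)
  finally show "prob {\<omega> \<in> space M. net_max m \<omega> \<ge> t} \<le> (2 * real m + 1) ^ D * (2 * exp (- (n * t\<^sup>2 / (2 * b\<^sup>2))))" .
qed

text \<open>The grid of mesh \<open>2^(-j)\<close> has at most \<open>2^((j + 2) D)\<close> points, so its entropy
grows only linearly in \<open>j\<close>, while the links of the chain shrink geometrically.\<close>

lemma entropy_bound: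
  assumes c: "c > 0"
  shows "c * sqrt (2 * ln (2 * card (grid D (2 ^ j))) / n) \<le> c * ((real j + 3) * sqrt D / sqrt n)"
proof -
  have "real (card (grid D (2 ^ j))) \<le> (2 * 2 ^ j + 1) ^ D"
    using card_grid_le[of D "2 ^ j"] by simp
  also have "(2 * 2 ^ j + 1 :: real) ^ D \<le> (2 ^ (j + 2)) ^ D"
  proof (rule power_mono)
    show "(2 * 2 ^ j + 1 :: real) \<le> 2 ^ (j + 2)" using one_le_power[of "2::real" "Suc j"] by simp
  qed simp
  finally have "2 * real (card (grid D (2 ^ j))) \<le> 2 * (2 ^ (j + 2)) ^ D" by simp
  also have "\<dots> = (2::real) ^ (1 + (j + 2) * D)" by (simp only: power_add power_mult power_one_right)
  finally have "2 * real (card (grid D (2 ^ j))) \<le> (2::real) ^ (1 + (j + 2) * D)" .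
  moreover have cp: "card (grid D (2 ^ j)) > 0" using grid_nonempty finite_grid by (simp add: card_gt_0_iff)
  ultimately have "ln (2 * card (grid D (2 ^ j))) \<le> ln ((2::real) ^ (1 + (j + 2) * D))"
    by (subst ln_le_cancel_iff) auto
  also have "\<dots> = real (1 + (j + 2) * D) * ln 2" by (subst ln_realpow) auto
  also have "\<dots> \<le> real (1 + (j + 2) * D) * 1" using ln_2_less_1 by (intro mult_left_mono) auto
  also have "\<dots> \<le> real ((j + 3) * D)" unfolding mult_1_right using D_pos by (subst of_nat_le_iff) (auto simp: algebra_simps)
  finally have "2 * ln (2 * card (grid D (2 ^ j))) \<le> 2 * real ((j + 3) * D)" by simp
  also have "\<dots> \<le> (real (j + 3))\<^sup>2 * D"
  proof -
    have "2 * real (j + 3) \<le> (real (j + 3))\<^sup>2" unfolding power2_eq_square by (intro mult_right_mono) auto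
    thus ?thesis using mult_right_mono[of "2 * real (j + 3)" "(real (j + 3))\<^sup>2" "real D"] by (simp add: algebra_simps)
  qed
  finally have "sqrt (2 * ln (2 * card (grid D (2 ^ j))) / n) \<le> sqrt ((real (j + 3))\<^sup>2 * D / n)"
    by (intro real_sqrt_le_mono divide_right_mono) auto
  also have "\<dots> = (real j + 3) * sqrt D / sqrt n" by (simp add: real_sqrt_mult real_sqrt_divide)
  finally show ?thesis using c by (intro mult_left_mono) auto
qed

lemma expectation_net_max:
  "integrable M (net_max 1)" "expectation (net_max 1) \<le> b * (3 * sqrt D / sqrt n)"
proof -
  note * = expectation_Max_sampling_error[where I="grid D 1" and h=\<psi>,
      OF finite_grid grid_nonempty psi_measurable psi_bound b_pos]
  show "integrable M (net_max 1)" using *(1) by (simp add: net_max_def[abs_def])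
  show "expectation (net_max 1) \<le> b * (3 * sqrt D / sqrt n)"
    using *(2) entropy_bound[OF b_pos, of 0] by (simp add: net_max_def[abs_def])
qed

lemma expectation_link_max:
  "integrable M (link_max (2 ^ j))"
  "expectation (link_max (2 ^ j)) \<le> B * D / 2 ^ j * ((real j + 4) * sqrt D / sqrt n)"
proof -
  have c: "B * D / 2 ^ j > 0" using B_pos D_pos by simp
  have bd: "\<bar>\<psi> q x - \<psi> (snap D (2 ^ j) q) x\<bar> \<le> B * D / 2 ^ j" if "x \<in> space \<mu>" for q x
    using psi_snap[of "2 ^ j" x q] that by simp
  note * = expectation_Max_sampling_error[where I="grid D (2 * 2 ^ j)" and h="\<lambda>q x. \<psi> q x - \<psi> (snap D (2 ^ j) q) x",
      OF finite_grid grid_nonempty borel_measurable_diff[OF psi_measurable psi_measurable] bd c]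
  show "integrable M (link_max (2 ^ j))" using *(1) by (simp add: link_max_def[abs_def])
  have "expectation (link_max (2 ^ j)) \<le> B * D / 2 ^ j * sqrt (2 * ln (2 * card (grid D (2 * 2 ^ j))) / n)"
    using *(2) by (simp add: link_max_def[abs_def])
  also have "\<dots> \<le> B * D / 2 ^ j * ((real j + 4) * sqrt D / sqrt n)"
    using entropy_bound[OF c, of "Suc j"] by (simp add: algebra_simps)
  finally show "expectation (link_max (2 ^ j)) \<le> B * D / 2 ^ j * ((real j + 4) * sqrt D / sqrt n)" .
qed

text \<open>The telescoping sum of the chain: each refinement of the grid changes the deviation by that of one
link.\<close>

lemma dev_le_chain:
  assumes "\<omega> \<in> space M" and p: "\<And>i. i < D \<Longrightarrow> \<bar>p i\<bar> \<le> 1"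
  shows "\<bar>dev (snap D (2 ^ J) p) \<omega>\<bar> \<le> net_max 1 \<omega> + (\<Sum>j<J. link_max (2 ^ j) \<omega>)"
proof (induction J)
  case 0
  show ?case
    unfolding net_max_def using snap_in_grid[OF _ p, of 1] finite_grid by (auto intro!: Max_ge)
next
  case (Suc J)
  let ?q = "snap D (2 * 2 ^ J) p"
  have "dev ?q \<omega> - dev (snap D (2 ^ J) p) \<omega>
      = sampling_error \<mu> n (\<lambda>x. \<psi> ?q x - \<psi> (snap D (2 ^ J) ?q) x) (\<lambda>i. X i \<omega>)"
    by (simp add: sampling_error_diff psi_integrable snap_snap)
  also have "\<bar>\<dots>\<bar> \<le> link_max (2 ^ J) \<omega>"
    unfolding link_max_def using snap_in_grid[OF _ p, of "2 * 2 ^ J"] finite_grid by (intro Max_ge) auto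
  finally show ?case using Suc by simp
qed

lemma geometric_entropy_sum: "(\<Sum>j<J. (real j + 4) / 2 ^ j) \<le> 10"
proof -
  have "(\<Sum>j<J. (real j + 4) / 2 ^ j) = 10 - (2 * real J + 10) / 2 ^ J"
  proof (induction J)
    case (Suc J)
    have "(\<Sum>j<Suc J. (real j + 4) / 2 ^ j) = 10 - (2 * real J + 10) / 2 ^ J + (real J + 4) / 2 ^ J"
      using Suc by simp
    also have "\<dots> = 10 - (2 * real (Suc J) + 10) / 2 ^ Suc J" by (simp add: field_simps)
    finally show ?case .
  qed simp
  thus ?thesis by simp
qed

text \<open>The chain is cut after \<open>n\<close> levels: the remaining rounding error, of order
\<open>2^(-n)\<close>, is dominated by \<open>n^(-1/2)\<close>.  Summing the link bounds costs no logarithmic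
factor in \<open>n\<close>, which a single grid would.\<close>

theorem uniform_deviation:
  "\<exists>W. integrable M W \<and> expectation W \<le> (3 * b + 12 * B) * (D * sqrt D) / sqrt n \<and>
     (\<forall>\<omega>\<in>space M. \<forall>p. (\<forall>i<D. \<bar>p i\<bar> \<le> 1) \<longrightarrow> \<bar>dev p \<omega>\<bar> \<le> W \<omega>)"
proof -
  define W where "W = (\<lambda>\<omega>. net_max 1 \<omega> + (\<Sum>j<n. link_max (2 ^ j) \<omega>) + 2 * (B * D / 2 ^ n))"
  have int: "integrable M W"
    unfolding W_def using expectation_net_max expectation_link_max by auto
  have "expectation W = expectation (net_max 1) + (\<Sum>j<n. expectation (link_max (2 ^ j))) + 2 * (B * D / 2 ^ n)"
    unfolding W_def using expectation_net_max expectation_link_max by (simp add: prob_space)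
  also have "\<dots> \<le> b * (3 * sqrt D / sqrt n) + (\<Sum>j<n. B * D / 2 ^ j * ((real j + 4) * sqrt D / sqrt n))
       + 2 * (B * (D * sqrt D) / sqrt n)"
  proof (intro add_mono sum_mono mult_left_mono)
    have "real n \<le> (2 ^ n)\<^sup>2"
      by (rule order.trans[OF less_imp_le[OF of_nat_less_two_power] self_le_power]) auto
    hence "sqrt n \<le> 2 ^ n" by (intro real_le_lsqrt) auto
    hence "B * D / 2 ^ n \<le> B * D / sqrt n" using n_pos B_pos by (intro divide_left_mono) auto
    also have "\<dots> \<le> B * (D * sqrt D) / sqrt n"
      using D_pos B_pos by (intro divide_right_mono mult_left_mono) (auto simp: mult_le_cancel_left1)
    finally show "B * D / 2 ^ n \<le> B * (D * sqrt D) / sqrt n" .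
  qed (use expectation_net_max expectation_link_max in auto)
  also have "(\<Sum>j<n. B * D / 2 ^ j * ((real j + 4) * sqrt D / sqrt n))
      = B * (D * sqrt D) / sqrt n * (\<Sum>j<n. (real j + 4) / 2 ^ j)"
    unfolding sum_distrib_left by (intro sum.cong) (simp_all add: mult_ac)
  also have "\<dots> \<le> B * (D * sqrt D) / sqrt n * 10"
    using B_pos by (intro mult_left_mono geometric_entropy_sum) auto
  also have "b * (3 * sqrt D / sqrt n) \<le> b * (3 * (D * sqrt D) / sqrt n)"
    using b_pos D_pos by (intro mult_left_mono divide_right_mono) (auto simp: mult_le_cancel_right1)
  finally have "expectation W \<le> (3 * b + 12 * B) * (D * sqrt D) / sqrt n"
    by (simp add: add_divide_distrib distrib_left distrib_right mult_ac)
  moreover have "\<bar>dev p \<omega>\<bar> \<le> W \<omega>" if "\<omega> \<in> space M" "\<forall>i<D. \<bar>p i\<bar> \<le> 1" for p \<omega>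
    using dev_le_chain[of \<omega> p n] dev_snap[of "2 ^ n" \<omega> p] that by (simp add: W_def)
  ultimately show ?thesis using int by blast
qed

end

section \<open>The variational formula for chi-square\<close>

lemma coordinate_measurable [measurable]: "(\<lambda>x. x i) \<in> borel_measurable (borel :: point measure)"
  by (intro borel_measurable_continuous_onI continuous_on_product_coordinates)

lemma dot_measurable [measurable]: "(\<lambda>x. dot d w x) \<in> borel_measurable (borel :: point measure)"
  unfolding dot_def by measurable

lemma borel_prob_onD:
  assumes "borel_prob_on S \<mu>"
  shows "prob_space \<mu>" "space \<mu> = S" "f \<in> borel_measurable borel \<Longrightarrow> f \<in> borel_measurable \<mu>"
proof -
  have s: "sets \<mu> = sets (borel_on S)" and p: "prob_space \<mu>" using assms by (auto simp: borel_prob_on_def)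
  show "prob_space \<mu>" by fact
  show "space \<mu> = S" using sets_eq_imp_space_eq[OF s] by (simp add: space_restrict_space)
  assume "f \<in> borel_measurable borel"
  hence "f \<in> borel_measurable (borel_on S)" by (rule measurable_restrict_space1)
  thus "f \<in> borel_measurable \<mu>" using measurable_cong_sets[OF s refl] by blast
qed

lemma dot_le_l1_norm:
  assumes "x \<in> cube d"
  shows "\<bar>dot d w x\<bar> \<le> l1_norm d w"
proof -
  have "\<bar>dot d w x\<bar> \<le> (\<Sum>i<d. \<bar>w i * x i\<bar>)" unfolding dot_def by (rule sum_abs)
  also have "\<dots> \<le> (\<Sum>i<d. \<bar>w i\<bar> * 1)"
    using assms by (intro sum_mono) (auto simp: abs_mult cube_def intro!: mult_left_le)
  finally show ?thesis by (simp add: l1_norm_def)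
qed

lemma l1_norm_nonneg: "l1_norm d w \<ge> 0"
  by (simp add: l1_norm_def sum_nonneg)

lemma square_integrable_imp_integrable:
  fixes f :: "'a \<Rightarrow> real"
  assumes "finite_measure \<nu>" "f \<in> borel_measurable \<nu>" "integrable \<nu> (\<lambda>x. (f x)\<^sup>2)"
  shows "integrable \<nu> f"
proof -
  interpret finite_measure \<nu> by fact
  have "integrable \<nu> (\<lambda>x. 1 + (f x)\<^sup>2)" using assms by simp
  moreover have "AE x in \<nu>. norm (f x) \<le> norm (1 + (f x)\<^sup>2)"
  proof (rule AE_I2)
    fix x
    show "norm (f x) \<le> norm (1 + (f x)\<^sup>2)"
    proof -
    have "0 \<le> (1 - \<bar>f x\<bar>)\<^sup>2 + \<bar>f x\<bar>" by simp
    thus ?thesis by (simp add: power2_eq_square algebra_simps)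
  qed
  qed
  ultimately show ?thesis by (intro Bochner_Integration.integrable_bound[OF _ assms(2)])
qed

text \<open>Since \<open>d\<mu>/d\<nu> = 1 + f / 2\<close>, the objective equals
\<open>E_\<nu> (f g / 2 - g\<^sup>2 / 4)\<close>; complete the square and use
\<open>chi2 = E_\<nu> f\<^sup>2 / 4\<close>.\<close>

lemma chi2_variational:
  assumes pair: "(\<mu>, \<nu>) \<in> chi2_pairs S" and f: "chi2_opt \<mu> \<nu> f"
    and g: "g \<in> borel_measurable \<nu>" "\<And>x. x \<in> S \<Longrightarrow> \<bar>g x\<bar> \<le> c"
  shows "(\<integral>x. g x \<partial>\<mu>) - (\<integral>x. g x \<partial>\<nu>) - 1/4 * (\<integral>x. (g x)\<^sup>2 \<partial>\<nu>)
       = enn2real (chi2 \<mu> \<nu>) - 1/4 * (\<integral>x. (f x - g x)\<^sup>2 \<partial>\<nu>)" (is ?eq)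
    and "integrable \<nu> (\<lambda>x. (f x)\<^sup>2)" (is ?int)
proof -
  have bp: "borel_prob_on S \<mu>" "borel_prob_on S \<nu>" and ac: "absolutely_continuous \<nu> \<mu>"
    and fin: "chi2 \<mu> \<nu> < \<infinity>" using pair by (auto simp: chi2_pairs_def)
  interpret \<mu>: prob_space \<mu> using bp borel_prob_onD by blast
  interpret \<nu>: prob_space \<nu> using bp borel_prob_onD by blast
  have sets: "sets \<mu> = sets \<nu>" using bp by (simp add: borel_prob_on_def)
  have sp: "space \<nu> = S" using bp borel_prob_onD by blast
  have fm [measurable]: "f \<in> borel_measurable \<nu>" using f by (simp add: chi2_opt_def)
  have fae: "AE x in \<nu>. f x = 2 * (enn2real (RN_deriv \<nu> \<mu> x) - 1)" using f by (simp add: chi2_opt_def)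
  note [measurable] = g(1)
  have "chi2 \<mu> \<nu> = (\<integral>\<^sup>+x. ennreal ((enn2real (RN_deriv \<nu> \<mu> x) - 1)\<^sup>2) \<partial>\<nu>)"
    using ac by (simp add: chi2_def)
  also have "\<dots> = (\<integral>\<^sup>+x. ennreal (1/4 * (f x)\<^sup>2) \<partial>\<nu>)"
  proof (intro nn_integral_cong_AE)
    show "AE x in \<nu>. ennreal ((enn2real (RN_deriv \<nu> \<mu> x) - 1)\<^sup>2) = ennreal (1/4 * (f x)\<^sup>2)"
      using fae
    proof eventually_elim
      case (elim x)
      show ?case unfolding elim by (simp add: power2_eq_square algebra_simps)
    qed
  qed
  finally have chi: "chi2 \<mu> \<nu> = (\<integral>\<^sup>+x. ennreal (1/4 * (f x)\<^sup>2) \<partial>\<nu>)" .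
  have "integrable \<nu> (\<lambda>x. 1/4 * (f x)\<^sup>2)"
    using fin unfolding chi by (intro integrableI_nonneg) auto
  from integrable_mult_right[of 4, OF this]
  have f2: "integrable \<nu> (\<lambda>x. (f x)\<^sup>2)" by simp
  show ?int by fact
  have f1: "integrable \<nu> f"
    by (rule square_integrable_imp_integrable[OF _ fm f2]) unfold_locales
  have chi': "enn2real (chi2 \<mu> \<nu>) = 1/4 * (\<integral>x. (f x)\<^sup>2 \<partial>\<nu>)"
    unfolding chi by (subst integral_eq_nn_integral[symmetric]) auto
  have g1: "integrable \<nu> g" by (rule integrable_bounded[where c=c]) (use g sp in \<open>auto intro: \<nu>.finite_measure_axioms\<close>)
  have g2: "integrable \<nu> (\<lambda>x. (g x)\<^sup>2)"
  proof (rule integrable_bounded[where c="c\<^sup>2"])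
    fix x assume "x \<in> space \<nu>"
    hence "\<bar>g x\<bar> \<le> \<bar>c\<bar>" using g(2)[of x] sp by simp
    thus "\<bar>(g x)\<^sup>2\<bar> \<le> c\<^sup>2" by (simp add: abs_le_square_iff)
  qed (use \<nu>.finite_measure_axioms in auto)
  have fg: "integrable \<nu> (\<lambda>x. f x * g x)"
  proof (rule Bochner_Integration.integrable_bound)
    show "integrable \<nu> (\<lambda>x. \<bar>c\<bar> * f x)" using f1 by simp
    show "AE x in \<nu>. norm (f x * g x) \<le> norm (\<bar>c\<bar> * f x)"
    proof (rule AE_I2)
      fix x assume "x \<in> space \<nu>"
      hence "\<bar>g x\<bar> \<le> \<bar>c\<bar>" using g(2)[of x] sp by simp
      thus "norm (f x * g x) \<le> norm (\<bar>c\<bar> * f x)"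
        unfolding real_norm_def abs_mult abs_abs mult.commute[of "\<bar>f x\<bar>"] by (rule mult_right_mono) simp
    qed
  qed auto
  have "(\<integral>x. g x \<partial>\<mu>) = (\<integral>x. enn2real (RN_deriv \<nu> \<mu> x) * g x \<partial>\<nu>)"
    by (rule \<nu>.RN_deriv_integral[OF _ ac sets]) (use \<mu>.sigma_finite_measure_axioms in auto)
  also have "\<dots> = (\<integral>x. g x + 1/2 * (f x * g x) \<partial>\<nu>)"
  proof (rule integral_cong_AE)
    show "AE x in \<nu>. enn2real (RN_deriv \<nu> \<mu> x) * g x = g x + 1/2 * (f x * g x)"
      using fae
    proof eventually_elim
      case (elim x)
      show ?case unfolding elim by (simp add: algebra_simps)
    qed
  qed auto
  also have "\<dots> = (\<integral>x. g x \<partial>\<nu>) + 1/2 * (\<integral>x. f x * g x \<partial>\<nu>)" using g1 fg by simp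
  finally have "(\<integral>x. g x \<partial>\<mu>) = (\<integral>x. g x \<partial>\<nu>) + 1/2 * (\<integral>x. f x * g x \<partial>\<nu>)" .
  moreover have "(\<integral>x. (f x - g x)\<^sup>2 \<partial>\<nu>) = (\<integral>x. ((f x)\<^sup>2 + (g x)\<^sup>2) - 2 * (f x * g x) \<partial>\<nu>)"
    by (intro Bochner_Integration.integral_cong) (auto simp: power2_eq_square algebra_simps)
  moreover have "\<dots> = (\<integral>x. (f x)\<^sup>2 \<partial>\<nu>) + (\<integral>x. (g x)\<^sup>2 \<partial>\<nu>) - 2 * (\<integral>x. f x * g x \<partial>\<nu>)"
    using f2 g2 fg by simp
  ultimately show ?eq unfolding chi' by linarith
qed

section \<open>Ridge functions and their weighted sums\<close>

text \<open>The last condition says that the constant 1 is a small multiple of a ridge function, so that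
constants and linear deviations need no separate treatment.\<close>

locale activation =
  fixes \<phi> :: "real \<Rightarrow> real"
  assumes lipschitz: "\<bar>\<phi> u - \<phi> v\<bar> \<le> \<bar>u - v\<bar>"
    and bound: "\<bar>z\<bar> \<le> 2 \<Longrightarrow> \<bar>\<phi> z\<bar> \<le> 2"
    and unit: "\<exists>s \<kappa>. \<bar>s\<bar> \<le> 1 \<and> \<bar>\<kappa>\<bar> \<le> 2 \<and> \<kappa> * \<phi> s = 1"
begin

lemma measurable [measurable]: "\<phi> \<in> borel_measurable borel"
proof (intro borel_measurable_continuous_onI continuous_onI)
  fix x e :: real assume "e > 0"
  thus "\<exists>\<delta>>0. \<forall>x'\<in>UNIV. dist x' x < \<delta> \<longrightarrow> dist (\<phi> x') (\<phi> x) \<le> e"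
    using lipschitz by (intro exI[of _ e]) (auto simp: dist_real_def, smt (verit))
qed

lemma unit_weight_bound:
  assumes "l1_norm d w \<le> 1" "\<bar>b\<bar> \<le> 1" "x \<in> cube d"
  shows "\<bar>dot d w x + b\<bar> \<le> 2"
  using dot_le_l1_norm[OF assms(3), of w] assms by linarith

end

text \<open>On the cube, unit weights keep the argument of the activation within \<open>[-2, 2]\<close>, but
rounding the weights to a grid need not preserve their \<open>l_1\<close> norm.  Clipping the argument keeps the
family bounded independently of the dimension for all parameters.\<close>

definition clip :: "real \<Rightarrow> real" where
  "clip z = max (-2) (min 2 z)"

text \<open>Coordinate \<open>d\<close> of the parameter is the bias.\<close>

definition ridge :: "nat \<Rightarrow> (real \<Rightarrow> real) \<Rightarrow> (nat \<Rightarrow> real) \<Rightarrow> point \<Rightarrow> real" where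
  "ridge d \<phi> p x = \<phi> (clip (dot d p x + p d))"

definition ridge_product :: "nat \<Rightarrow> (real \<Rightarrow> real) \<Rightarrow> (nat \<Rightarrow> real) \<Rightarrow> point \<Rightarrow> real" where
  "ridge_product d \<phi> p x = ridge d \<phi> p x * ridge d \<phi> (\<lambda>i. p (d + 1 + i)) x"

context activation begin

lemma ridge_bound: "\<bar>ridge d \<phi> p x\<bar> \<le> 2"
  unfolding ridge_def by (intro bound) (auto simp: clip_def)

lemma ridge_lipschitz:
  assumes "x \<in> cube d"
  shows "\<bar>ridge d \<phi> p x - ridge d \<phi> q x\<bar> \<le> (\<Sum>i<Suc d. \<bar>p i - q i\<bar>)"
proof -
  have "\<bar>ridge d \<phi> p x - ridge d \<phi> q x\<bar> \<le> \<bar>clip (dot d p x + p d) - clip (dot d q x + q d)\<bar>"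
    unfolding ridge_def by (rule lipschitz)
  also have "\<dots> \<le> \<bar>dot d (\<lambda>i. p i - q i) x + (p d - q d)\<bar>"
    by (auto simp: clip_def dot_def left_diff_distrib sum_subtractf)
  also have "\<dots> \<le> l1_norm d (\<lambda>i. p i - q i) + \<bar>p d - q d\<bar>"
    using dot_le_l1_norm[OF assms, of "\<lambda>i. p i - q i"] by linarith
  finally show ?thesis by (simp add: l1_norm_def)
qed

lemma ridge_measurable [measurable]: "ridge d \<phi> p \<in> borel_measurable borel"
  unfolding ridge_def[abs_def] clip_def by measurable

lemma sum_lessThan_add:
  fixes f :: "nat \<Rightarrow> real"
  shows "(\<Sum>i<m + k. f i) = (\<Sum>i<m. f i) + (\<Sum>i<k. f (m + i))"
  by (induction k) auto

lemma ridge_product_lipschitz: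
  assumes "x \<in> cube d"
  shows "\<bar>ridge_product d \<phi> p x - ridge_product d \<phi> q x\<bar> \<le> 2 * (\<Sum>i<2 * d + 2. \<bar>p i - q i\<bar>)"
proof -
  let ?a = "ridge d \<phi> p x" and ?a' = "ridge d \<phi> q x"
  let ?b = "ridge d \<phi> (\<lambda>i. p (d + 1 + i)) x" and ?b' = "ridge d \<phi> (\<lambda>i. q (d + 1 + i)) x"
  have "\<bar>?a * ?b - ?a' * ?b'\<bar> = \<bar>?a * (?b - ?b') + ?b' * (?a - ?a')\<bar>" by (simp add: algebra_simps)
  also have "\<dots> \<le> \<bar>?a\<bar> * \<bar>?b - ?b'\<bar> + \<bar>?b'\<bar> * \<bar>?a - ?a'\<bar>" by (metis abs_mult abs_triangle_ineq)
  also have "\<dots> \<le> 2 * (\<Sum>i<Suc d. \<bar>p (d + 1 + i) - q (d + 1 + i)\<bar>) + 2 * (\<Sum>i<Suc d. \<bar>p i - q i\<bar>)"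
    by (intro add_mono mult_mono ridge_bound order.trans[OF ridge_lipschitz[OF assms]]) (auto intro!: sum_nonneg)
  also have "\<dots> = 2 * (\<Sum>i<(d + 1) + (d + 1). \<bar>p i - q i\<bar>)"
    unfolding sum_lessThan_add Suc_eq_plus1 by (simp only: distrib_left add.commute)
  also have "(d + 1) + (d + 1) = 2 * d + 2" by simp
  finally show ?thesis unfolding ridge_product_def .
qed

lemma lipschitz_family_ridge_product:
  assumes "iid_sample M \<mu> X n" "borel_prob_on (cube d) \<mu>"
  shows "lipschitz_family M \<mu> X n (ridge_product d \<phi>) (2 * d + 2) 2 4"
proof -
  interpret iid_sample M \<mu> X n by fact
  show ?thesis
  proof unfold_locales
    show "ridge_product d \<phi> p \<in> borel_measurable \<mu>" for p
      unfolding ridge_product_def[abs_def] by (intro borel_prob_onD(3)[OF assms(2)]) measurable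
    show "\<bar>ridge_product d \<phi> p x\<bar> \<le> 4" for p x
      using mult_mono[OF ridge_bound[of d p x] ridge_bound[of d "\<lambda>i. p (d+1+i)" x]]
      by (simp add: ridge_product_def abs_mult)
  qed (use ridge_product_lipschitz borel_prob_onD(2)[OF assms(2)] in auto)
qed

end

text \<open>Networks with total output weight \<open>L\<close>.  The inductive form reduces statements that are
linear in the network to a single ridge function by rule induction.\<close>

inductive ridge_sum :: "nat \<Rightarrow> (real \<Rightarrow> real) \<Rightarrow> real \<Rightarrow> (point \<Rightarrow> real) \<Rightarrow> bool" for d \<phi> where
  zero: "ridge_sum d \<phi> 0 (\<lambda>x. 0)"
| add_ridge: "ridge_sum d \<phi> L g \<Longrightarrow> l1_norm d w \<le> 1 \<Longrightarrow> \<bar>b\<bar> \<le> 1 \<Longrightarrow>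
    ridge_sum d \<phi> (L + \<bar>c\<bar>) (\<lambda>x. g x + c * \<phi> (dot d w x + b))"

lemma ridge_sum_atom:
  assumes "l1_norm d w \<le> 1" "\<bar>b\<bar> \<le> 1"
  shows "ridge_sum d \<phi> \<bar>c\<bar> (\<lambda>x. c * \<phi> (dot d w x + b))"
  using add_ridge[OF zero assms, of \<phi> c] by simp

lemma ridge_sum_plus:
  assumes "ridge_sum d \<phi> L' h" "ridge_sum d \<phi> L g"
  shows "ridge_sum d \<phi> (L + L') (\<lambda>x. g x + h x)"
  using assms
proof (induction rule: ridge_sum.induct)
  case (add_ridge L' h w b c)
  thus ?case using ridge_sum.add_ridge[of d \<phi> "L + L'" "\<lambda>x. g x + h x" w b c] by (simp add: add.assoc)
qed simp

lemma ridge_sum_sum: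
  assumes "finite I" "\<And>i. i \<in> I \<Longrightarrow> l1_norm d (w i) \<le> 1 \<and> \<bar>b i\<bar> \<le> 1"
  shows "ridge_sum d \<phi> (\<Sum>i\<in>I. \<bar>c i\<bar>) (\<lambda>x. \<Sum>i\<in>I. c i * \<phi> (dot d (w i) x + b i))"
  using assms
proof (induction I rule: finite_induct)
  case (insert i I)
  thus ?case
    using add_ridge[of d \<phi> "\<Sum>i\<in>I. \<bar>c i\<bar>" "\<lambda>x. \<Sum>i\<in>I. c i * \<phi> (dot d (w i) x + b i)" "w i" "b i" "c i"]
    by (simp add: add.commute)
qed (simp add: zero)

context activation begin

lemma ridge_sum_bounded:
  assumes "ridge_sum d \<phi> L g" "x \<in> cube d"
  shows "\<bar>g x\<bar> \<le> 2 * L"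
  using assms(1)
proof induction
  case (add_ridge L g w b c)
  have "\<bar>c * \<phi> (dot d w x + b)\<bar> \<le> \<bar>c\<bar> * 2"
    unfolding abs_mult using unit_weight_bound[OF add_ridge.hyps(2,3) assms(2)]
    by (intro mult_left_mono bound) auto
  hence "\<bar>g x\<bar> + \<bar>c * \<phi> (dot d w x + b)\<bar> \<le> 2 * L + \<bar>c\<bar> * 2"
    using add_ridge.IH by (rule add_mono[rotated])
  thus ?case
    using abs_triangle_ineq[of "g x" "c * \<phi> (dot d w x + b)"] by simp
qed simp

lemma ridge_sum_nonneg: "ridge_sum d \<phi> L g \<Longrightarrow> L \<ge> 0"
  by (induction rule: ridge_sum.induct) auto

lemma ridge_sum_measurable: "ridge_sum d \<phi> L g \<Longrightarrow> g \<in> borel_measurable borel"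
  by (induction rule: ridge_sum.induct) auto

lemma unit_ridge_sum: "\<exists>L\<le>2. ridge_sum d \<phi> L (\<lambda>_. 1)"
proof -
  from unit obtain s \<kappa> where "\<bar>s\<bar> \<le> 1" "\<bar>\<kappa>\<bar> \<le> 2" "\<kappa> * \<phi> s = 1" by auto
  thus ?thesis using ridge_sum_atom[of d "\<lambda>_. 0" s \<phi> \<kappa>] by (auto simp: dot_def l1_norm_def)
qed

definition ridge_deviation_bound :: "nat \<Rightarrow> point measure \<Rightarrow> nat \<Rightarrow> (nat \<Rightarrow> point) \<Rightarrow> real \<Rightarrow> bool" where
  "ridge_deviation_bound d \<mu> n x W \<longleftrightarrow>
     (\<forall>p. (\<forall>i<2 * d + 2. \<bar>p i\<bar> \<le> 1) \<longrightarrow> \<bar>sampling_error \<mu> n (ridge_product d \<phi> p) x\<bar> \<le> W)"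

lemma sampling_error_cong:
  assumes "borel_prob_on (cube d) \<mu>" "\<And>i. i < n \<Longrightarrow> x i \<in> cube d" "\<And>z. z \<in> cube d \<Longrightarrow> f z = g z"
  shows "sampling_error \<mu> n f x = sampling_error \<mu> n g x"
  using assms borel_prob_onD(2)[OF assms(1)] unfolding sampling_error_def
  by (auto intro!: arg_cong2[where f="(-)"] arg_cong2[where f="(/)"] sum.cong Bochner_Integration.integral_cong)

lemma sampling_error_add_mult:
  assumes "integrable \<mu> f" "integrable \<mu> g"
  shows "sampling_error \<mu> n (\<lambda>x. f x + c * g x) x = sampling_error \<mu> n f x + c * sampling_error \<mu> n g x"
  using assms by (simp add: sampling_error_def sum.distrib sum_distrib_left[symmetric] add_divide_distrib algebra_simps)

text \<open>Two nested rule inductions expand the product of two sums; the deviation is linear in each factor.\<close>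

lemma deviation_of_product_of_ridge_sums:
  assumes \<mu>: "borel_prob_on (cube d) \<mu>" and x: "\<And>i. i < n \<Longrightarrow> x i \<in> cube d"
    and W: "ridge_deviation_bound d \<mu> n x W"
    and g: "ridge_sum d \<phi> L g" and h: "ridge_sum d \<phi> L' h"
  shows "\<bar>sampling_error \<mu> n (\<lambda>z. g z * h z) x\<bar> \<le> L * L' * W"
proof -
  interpret prob_space \<mu> by (rule borel_prob_onD[OF \<mu>])
  have bint: "integrable \<mu> f" if "f \<in> borel_measurable borel" "\<And>z. z \<in> cube d \<Longrightarrow> \<bar>f z\<bar> \<le> c" for f :: "point \<Rightarrow> real" and c
    by (rule integrable_bounded[where c=c])
       (use that borel_prob_onD[OF \<mu>] in \<open>auto intro: finite_measure_axioms\<close>)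
  have intp: "integrable \<mu> (\<lambda>z. f z * g z)" if "ridge_sum d \<phi> L f" "ridge_sum d \<phi> L' g" for f g L L'
    by (intro bint[of _ "(2 * L) * (2 * L')"] borel_measurable_times ridge_sum_measurable[OF that(1)]
        ridge_sum_measurable[OF that(2)])
       (unfold abs_mult, intro mult_mono ridge_sum_bounded[OF that(1)] ridge_sum_bounded[OF that(2)];
        use ridge_sum_nonneg[OF that(1)] in simp)
  have atoms: "\<bar>sampling_error \<mu> n (\<lambda>z. \<phi> (dot d w z + b) * \<phi> (dot d w' z + b')) x\<bar> \<le> W"
    if "l1_norm d w \<le> 1" "\<bar>b\<bar> \<le> 1" "l1_norm d w' \<le> 1" "\<bar>b'\<bar> \<le> 1" for w b w' b'
  proof -
    define p where "p i = (if i < d then w i else if i = d then b else if i < 2 * d + 1 then w' (i - (d + 1)) else b')" for i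
    have coord: "\<bar>v i\<bar> \<le> 1" if "l1_norm d v \<le> 1" "i < d" for v i
      using member_le_sum[of i "{..<d}" "\<lambda>i. \<bar>v i\<bar>"] that by (auto simp: l1_norm_def)
    have p1: "\<forall>i<2 * d + 2. \<bar>p i\<bar> \<le> 1"
      using that coord by (auto simp: p_def)
    have "dot d p z = dot d w z" "dot d (\<lambda>i. p (d + 1 + i)) z = dot d w' z" for z
      by (auto simp: dot_def p_def intro!: sum.cong)
    hence "ridge_product d \<phi> p z = \<phi> (dot d w z + b) * \<phi> (dot d w' z + b')" if "z \<in> cube d" for z
      using unit_weight_bound[OF \<open>l1_norm d w \<le> 1\<close> \<open>\<bar>b\<bar> \<le> 1\<close> that] unit_weight_bound[OF \<open>l1_norm d w' \<le> 1\<close> \<open>\<bar>b'\<bar> \<le> 1\<close> that]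
      by (simp add: ridge_product_def ridge_def clip_def p_def abs_le_iff)
    hence "sampling_error \<mu> n (\<lambda>z. \<phi> (dot d w z + b) * \<phi> (dot d w' z + b')) x = sampling_error \<mu> n (ridge_product d \<phi> p) x"
      by (intro sampling_error_cong[OF \<mu> x]) auto
    thus ?thesis using W p1 by (simp add: ridge_deviation_bound_def)
  qed
  have one: "\<bar>sampling_error \<mu> n (\<lambda>z. \<phi> (dot d w z + b) * h z) x\<bar> \<le> L' * W"
    if wb: "l1_norm d w \<le> 1" "\<bar>b\<bar> \<le> 1" for w b
    using h
  proof induction
    case zero thus ?case by (simp add: sampling_error_def)
  next
    case (add_ridge L h w' b' c)
    have a: "ridge_sum d \<phi> 1 (\<lambda>x. \<phi> (dot d v x + a))" if "l1_norm d v \<le> 1" "\<bar>a\<bar> \<le> 1" for v a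
      using ridge_sum_atom[OF that, of \<phi> 1] by simp
    have "sampling_error \<mu> n (\<lambda>z. \<phi> (dot d w z + b) * h z + c * (\<phi> (dot d w z + b) * \<phi> (dot d w' z + b'))) x
      = sampling_error \<mu> n (\<lambda>z. \<phi> (dot d w z + b) * h z) x
        + c * sampling_error \<mu> n (\<lambda>z. \<phi> (dot d w z + b) * \<phi> (dot d w' z + b')) x"
      by (intro sampling_error_add_mult intp[OF a[OF wb] add_ridge.hyps(1)] intp[OF a[OF wb] a[OF add_ridge.hyps(2,3)]])
    moreover have "\<bar>c * sampling_error \<mu> n (\<lambda>z. \<phi> (dot d w z + b) * \<phi> (dot d w' z + b')) x\<bar> \<le> \<bar>c\<bar> * W"
      unfolding abs_mult by (intro mult_left_mono atoms wb add_ridge.hyps) auto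
    ultimately show ?case using add_ridge.IH by (simp add: algebra_simps)
  qed
  show ?thesis using g
  proof induction
    case zero thus ?case by (simp add: sampling_error_def)
  next
    case (add_ridge L g w b c)
    have a: "ridge_sum d \<phi> 1 (\<lambda>x. \<phi> (dot d w x + b))"
      using ridge_sum_atom[OF add_ridge.hyps(2,3), of \<phi> 1] by simp
    have "sampling_error \<mu> n (\<lambda>z. g z * h z + c * (\<phi> (dot d w z + b) * h z)) x
      = sampling_error \<mu> n (\<lambda>z. g z * h z) x + c * sampling_error \<mu> n (\<lambda>z. \<phi> (dot d w z + b) * h z) x"
      by (intro sampling_error_add_mult intp[OF add_ridge.hyps(1) h] intp[OF a h])
    moreover have "\<bar>c * sampling_error \<mu> n (\<lambda>z. \<phi> (dot d w z + b) * h z) x\<bar> \<le> \<bar>c\<bar> * (L' * W)"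
      unfolding abs_mult by (intro mult_left_mono one add_ridge.hyps) auto
    ultimately show ?case using add_ridge.IH by (simp add: algebra_simps)
  qed
qed

end

section \<open>Taylor remainders as averages of kinks, and sampling\<close>

definition symmetric_uniform :: "real measure" where
  "symmetric_uniform = uniform_measure lborel {-1..1}"

lemma prob_symmetric_uniform: "prob_space symmetric_uniform"
  unfolding symmetric_uniform_def by (intro prob_space_uniform_measure) auto

lemma sets_symmetric_uniform [simp, measurable_cong]: "sets symmetric_uniform = sets borel"
  by (simp add: symmetric_uniform_def)

lemma space_symmetric_uniform [simp]: "space symmetric_uniform = UNIV"
  by (simp add: symmetric_uniform_def)

lemma integral_symmetric_uniform:
  fixes f :: "real \<Rightarrow> real"
  assumes [measurable]: "f \<in> borel_measurable borel"
  shows "(\<integral>t. f t \<partial>symmetric_uniform) = (\<integral>t. indicator {-1..1} t * f t \<partial>lborel) / 2"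
proof -
  have U: "symmetric_uniform = density lborel (\<lambda>t. ennreal (indicator {-1..1} t / 2))"
    unfolding symmetric_uniform_def uniform_measure_def
    by (intro density_cong AE_I2) (auto split: split_indicator simp: divide_ennreal[symmetric] ennreal_1[symmetric] simp del: ennreal_1)
  have "(\<integral>t. f t \<partial>symmetric_uniform) = (\<integral>t. (indicator {-1..1} t / 2) *\<^sub>R f t \<partial>lborel)"
    unfolding U by (intro integral_density) auto
  also have "\<dots> = (\<integral>t. indicator {-1..1} t * f t / 2 \<partial>lborel)"
    by (intro Bochner_Integration.integral_cong) auto
  also have "\<dots> = (\<integral>t. indicator {-1..1} t * f t \<partial>lborel) / 2" by (rule integral_divide_zero)
  finally show ?thesis .
qed

text \<open>For \<open>t\<close> in \<open>[-1, 1]\<close> this is the rectified linear function of \<open>s\<close> with slope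
\<open>sgn t\<close> that starts at \<open>t\<close> and points away from 0.  The minimum keeps the bias
admissible for every real \<open>t\<close>, because sampling selects \<open>t\<close> from the whole line.\<close>

definition kink :: "real \<Rightarrow> real \<Rightarrow> real" where
  "kink t s = relu (sgn t * s - min \<bar>t\<bar> 1)"

lemma relu_measurable [measurable]: "relu \<in> borel_measurable borel"
  unfolding relu_def[abs_def] by measurable

lemma kink_measurable [measurable]: "(\<lambda>z. kink (fst z) (snd z)) \<in> borel_measurable (borel \<Otimes>\<^sub>M borel)"
proof -
  have "sgn \<in> borel_measurable (borel :: real measure)"
    unfolding sgn_if[abs_def] by measurable
  note [measurable] = this
  show ?thesis unfolding kink_def by measurable
qed

lemma kink_measurable' [measurable (raw)]:
  assumes "f \<in> borel_measurable M" "g \<in> borel_measurable M"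
  shows "(\<lambda>z. kink (f z) (g z)) \<in> borel_measurable M"
  using measurable_compose[OF measurable_Pair[OF assms] kink_measurable] by simp

lemma kink_bounds:
  assumes "\<bar>s\<bar> \<le> 1"
  shows "0 \<le> kink t s" "kink t s \<le> 1"
  using assms unfolding kink_def relu_def by (auto simp: sgn_if abs_le_iff)

text \<open>Taylor's formula with integral remainder.  For \<open>s \<ge> 0\<close> only \<open>t\<close> between
0 and \<open>s\<close> contributes, with \<open>r t * (s - t)\<close>; the case \<open>s < 0\<close> is symmetric.
The factor 2 compensates the density \<open>1/2\<close> of the uniform distribution.\<close>

lemma taylor_kink:
  fixes p p' r :: "real \<Rightarrow> real"
  assumes p: "\<And>t. (p has_real_derivative p' t) (at t)" and p': "\<And>t. (p' has_real_derivative r t) (at t)"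
    and r: "continuous_on UNIV r" and s: "\<bar>s\<bar> \<le> 1"
  shows "(\<integral>t. 2 * r t * kink t s \<partial>symmetric_uniform) = p s - p 0 - p' 0 * s"
proof -
  have rc: "continuous_on A r" for A using r continuous_on_subset by blast
  have [measurable]: "r \<in> borel_measurable borel" using r by (rule borel_measurable_continuous_onI)
  have "(\<integral>t. 2 * r t * kink t s \<partial>symmetric_uniform) = (\<integral>t. indicator {-1..1} t * (2 * r t * kink t s) \<partial>lborel) / 2"
    by (rule integral_symmetric_uniform) measurable
  also have "\<dots> = (\<integral>t. indicator {-1..1} t * (2 * r t * kink t s) / 2 \<partial>lborel)"
    by (rule integral_divide_zero[symmetric])
  also have "\<dots> = p s - p 0 - p' 0 * s"
  proof (cases "s \<ge> 0")
    case True
    have "(\<integral>t. indicator {-1..1} t * (2 * r t * kink t s) / 2 \<partial>lborel)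
        = (\<integral>t. indicator {0..s} t *\<^sub>R (r t * (s - t)) \<partial>lborel)"
    proof (rule integral_cong_AE)
      show "AE t in lborel. indicator {-1..1} t * (2 * r t * kink t s) / 2 = indicator {0..s} t *\<^sub>R (r t * (s - t))"
        using AE_lborel_singleton[of 0]
        by eventually_elim (use s True in \<open>auto simp: kink_def relu_def sgn_if split: split_indicator\<close>)
    qed auto
    also have "\<dots> = (p' s * (s - s) + p s) - (p' 0 * (s - 0) + p 0)"
    proof (rule integral_FTC_Icc)
      fix t
      show "((\<lambda>t. p' t * (s - t) + p t) has_vector_derivative r t * (s - t)) (at t within {0..s})"
        unfolding has_real_derivative_iff_has_vector_derivative[symmetric]
        by (rule DERIV_subset[OF _ subset_UNIV]) (auto intro!: derivative_eq_intros p p')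
    qed (use True in \<open>auto intro!: continuous_intros rc\<close>)
    finally show ?thesis by simp
  next
    case False
    have "(\<integral>t. indicator {-1..1} t * (2 * r t * kink t s) / 2 \<partial>lborel)
        = (\<integral>t. indicator {s..0} t *\<^sub>R (r t * (t - s)) \<partial>lborel)"
    proof (rule integral_cong_AE)
      show "AE t in lborel. indicator {-1..1} t * (2 * r t * kink t s) / 2 = indicator {s..0} t *\<^sub>R (r t * (t - s))"
        using AE_lborel_singleton[of 0]
        by eventually_elim (use s False in \<open>auto simp: kink_def relu_def sgn_if split: split_indicator\<close>)
    qed auto
    also have "\<dots> = (p' 0 * (0 - s) - p 0) - (p' s * (s - s) - p s)"
    proof (rule integral_FTC_Icc)
      fix t
      show "((\<lambda>t. p' t * (t - s) - p t) has_vector_derivative r t * (t - s)) (at t within {s..0})"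
        unfolding has_real_derivative_iff_has_vector_derivative[symmetric]
        by (rule DERIV_subset[OF _ subset_UNIV]) (auto intro!: derivative_eq_intros p p')
    qed (use False in \<open>auto intro!: continuous_intros rc\<close>)
    finally show ?thesis by simp
  qed
  finally show ?thesis .
qed

text \<open>An average \<open>T\<close> of functions bounded by \<open>V\<close> lies within squared distance
\<open>V\<^sup>2 / k\<close> of a mean of \<open>k\<close> of them.  The functions are selected one at a time:
the increment \<open>a \<theta> - T\<close> has mean 0 over \<open>\<theta>\<close>, so it is orthogonal on average to the
accumulated error \<open>S\<close>, and some \<open>\<theta>\<close> raises the squared error by at most
\<open>V\<^sup>2\<close>.  This avoids product measures on the set of samples.\<close>

theorem maurey:
  fixes a :: "'t \<Rightarrow> 'x \<Rightarrow> real"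
  assumes "prob_space Q" "prob_space \<nu>"
    and a_meas: "(\<lambda>(\<theta>, x). a \<theta> x) \<in> borel_measurable (Q \<Otimes>\<^sub>M \<nu>)"
    and a_bound: "\<And>\<theta> x. \<theta> \<in> space Q \<Longrightarrow> x \<in> space \<nu> \<Longrightarrow> \<bar>a \<theta> x\<bar> \<le> V"
  defines "T \<equiv> (\<lambda>x. \<integral>\<theta>. a \<theta> x \<partial>Q)"
  shows "\<exists>\<theta>. (\<forall>i<k. \<theta> i \<in> space Q) \<and> (\<integral>x. ((\<Sum>i<k. a (\<theta> i) x) - real k * T x)\<^sup>2 \<partial>\<nu>) \<le> real k * V\<^sup>2"
proof -
  interpret Q: prob_space Q by fact
  interpret \<nu>: prob_space \<nu> by fact
  interpret pair_prob_space Q \<nu> ..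
  interpret sw: pair_sigma_finite \<nu> Q ..
  note [measurable] = a_meas
  have sect_x [measurable]: "a \<theta> \<in> borel_measurable \<nu>" if "\<theta> \<in> space Q" for \<theta>
    using measurable_compose[OF measurable_Pair1'[OF that] a_meas] by simp
  have sect_t [measurable]: "(\<lambda>\<theta>. a \<theta> x) \<in> borel_measurable Q" if "x \<in> space \<nu>" for x
    using measurable_compose[OF measurable_Pair2'[OF that] a_meas] by simp
  have swap: "(\<lambda>(x, \<theta>). a \<theta> x) \<in> borel_measurable (\<nu> \<Otimes>\<^sub>M Q)"
    using measurable_pair_swap[OF a_meas] by (simp add: case_prod_unfold)
  have T_meas [measurable]: "T \<in> borel_measurable \<nu>"
    unfolding T_def using swap by (intro Q.borel_measurable_lebesgue_integral) simp
  have a_int: "integrable Q (\<lambda>\<theta>. a \<theta> x)" if "x \<in> space \<nu>" for x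
    by (rule integrable_bounded[OF Q.finite_measure_axioms sect_t[OF that]]) (use a_bound that in auto)
  have T_bound: "\<bar>T x\<bar> \<le> V" if "x \<in> space \<nu>" for x
    using Q.integral_le_const[OF a_int[OF that], of V] Q.integral_ge_const[OF a_int[OF that], of "-V"] a_bound that
    by (auto simp: T_def abs_le_iff AE_I2) (fastforce intro!: AE_I2 simp: abs_le_iff)+
  show ?thesis
  proof (induction k)
    case 0 show ?case by simp
  next
    case (Suc k)
    then obtain \<theta> where \<theta>: "\<forall>i<k. \<theta> i \<in> space Q"
      and IH: "(\<integral>x. ((\<Sum>i<k. a (\<theta> i) x) - real k * T x)\<^sup>2 \<partial>\<nu>) \<le> real k * V\<^sup>2" by auto
    define S where "S x = (\<Sum>i<k. a (\<theta> i) x) - real k * T x" for x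
    have [measurable]: "S \<in> borel_measurable \<nu>"
      unfolding S_def using \<theta> by (intro borel_measurable_diff borel_measurable_sum borel_measurable_times sect_x T_meas) auto
    have S_bound: "\<bar>S x\<bar> \<le> 2 * k * V" if "x \<in> space \<nu>" for x
    proof -
      have "\<bar>\<Sum>i<k. a (\<theta> i) x\<bar> \<le> (\<Sum>i<k. V)"
        using \<theta> a_bound that by (intro order.trans[OF sum_abs] sum_mono) auto
      moreover have "\<bar>real k * T x\<bar> \<le> real k * V"
        unfolding abs_mult using T_bound[OF that] by (simp add: mult_left_mono)
      ultimately show ?thesis unfolding S_def by simp
    qed
    define e where "e = (\<lambda>\<theta> x. (S x + (a \<theta> x - T x))\<^sup>2)"
    have [measurable]: "(\<lambda>(\<theta>, x). e \<theta> x) \<in> borel_measurable (Q \<Otimes>\<^sub>M \<nu>)"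
      unfolding e_def by measurable
    have e_bound: "\<bar>e \<theta> x\<bar> \<le> ((2 * k + 2) * V)\<^sup>2" if "\<theta> \<in> space Q" "x \<in> space \<nu>" for \<theta> x
    proof -
      have "\<bar>S x + (a \<theta> x - T x)\<bar> \<le> (2 * k + 2) * V"
        using S_bound[OF that(2)] a_bound[OF that] T_bound[OF that(2)] by (simp add: algebra_simps)
      hence "\<bar>S x + (a \<theta> x - T x)\<bar>\<^sup>2 \<le> ((2 * k + 2) * V)\<^sup>2" by (intro power_mono) auto
      thus ?thesis by (simp add: e_def)
    qed
    have e_int: "integrable (Q \<Otimes>\<^sub>M \<nu>) (\<lambda>(\<theta>, x). e \<theta> x)"
      by (rule integrable_bounded[where c="((2 * k + 2) * V)\<^sup>2"])
         (use e_bound in \<open>auto intro: finite_measure_axioms simp: space_pair_measure\<close>)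
    have bound_int: "integrable \<nu> f" if "f \<in> borel_measurable \<nu>" "\<And>x. x \<in> space \<nu> \<Longrightarrow> \<bar>f x\<bar> \<le> c" for f :: "'x \<Rightarrow> real" and c
      by (rule integrable_bounded[OF \<nu>.finite_measure_axioms that])
    have S2_int: "integrable \<nu> (\<lambda>x. (S x)\<^sup>2)"
    proof (rule bound_int)
      show "\<bar>(S x)\<^sup>2\<bar> \<le> (2 * k * V)\<^sup>2" if "x \<in> space \<nu>" for x
        using power_mono[OF S_bound[OF that], of 2] by simp
    qed measurable
    have inner: "(\<integral>\<theta>. e \<theta> x \<partial>Q) \<le> (S x)\<^sup>2 + V\<^sup>2" if x: "x \<in> space \<nu>" for x
    proof -
      note [measurable] = sect_t[OF x]
      have sq: "\<bar>(a \<theta> x)\<^sup>2\<bar> \<le> V\<^sup>2" if "\<theta> \<in> space Q" for \<theta>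
        using power_mono[OF a_bound[OF that x], of 2] by simp
      have a2: "integrable Q (\<lambda>\<theta>. (a \<theta> x)\<^sup>2)"
        by (rule integrable_bounded[OF Q.finite_measure_axioms _ sq]) measurable
      have "(\<integral>\<theta>. e \<theta> x \<partial>Q) = (\<integral>\<theta>. (S x - T x)\<^sup>2 + (2 * (S x - T x)) * a \<theta> x + (a \<theta> x)\<^sup>2 \<partial>Q)"
        unfolding e_def by (intro Bochner_Integration.integral_cong) (auto simp: power2_eq_square algebra_simps)
      also have "\<dots> = (S x - T x)\<^sup>2 + 2 * (S x - T x) * T x + (\<integral>\<theta>. (a \<theta> x)\<^sup>2 \<partial>Q)"
        using a2 a_int[OF x] by (simp add: Q.prob_space T_def)
      also have "\<dots> = (S x)\<^sup>2 - (T x)\<^sup>2 + (\<integral>\<theta>. (a \<theta> x)\<^sup>2 \<partial>Q)"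
        by (simp add: power2_eq_square algebra_simps)
      also have "(\<integral>\<theta>. (a \<theta> x)\<^sup>2 \<partial>Q) \<le> V\<^sup>2"
        using sq by (intro Q.integral_le_const[OF a2] AE_I2) auto
      finally show ?thesis using zero_le_power2[of "T x"] by linarith
    qed
    have "(\<integral>\<theta>. (\<integral>x. e \<theta> x \<partial>\<nu>) \<partial>Q) = (\<integral>x. (\<integral>\<theta>. e \<theta> x \<partial>Q) \<partial>\<nu>)"
      using Fubini_integral[OF e_int] by simp
    also have "\<dots> \<le> (\<integral>x. (S x)\<^sup>2 + V\<^sup>2 \<partial>\<nu>)"
      using S2_int inner integrable_snd[OF e_int] by (intro integral_mono) auto
    also have "\<dots> = (\<integral>x. (S x)\<^sup>2 \<partial>\<nu>) + V\<^sup>2" using S2_int by (simp add: \<nu>.prob_space)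
    also have "\<dots> \<le> real (Suc k) * V\<^sup>2" using IH by (simp add: S_def algebra_simps)
    finally have avg: "(\<integral>\<theta>. (\<integral>x. e \<theta> x \<partial>\<nu>) \<partial>Q) \<le> real (Suc k) * V\<^sup>2" .
    have "\<exists>\<theta>'\<in>space Q. (\<integral>x. e \<theta>' x \<partial>\<nu>) \<le> real (Suc k) * V\<^sup>2"
    proof (rule ccontr)
      assume "\<not> ?thesis"
      hence "\<And>\<theta>'. \<theta>' \<in> space Q \<Longrightarrow> real (Suc k) * V\<^sup>2 < (\<integral>x. e \<theta>' x \<partial>\<nu>)" by (auto simp: not_le)
      hence "(\<integral>\<theta>. real (Suc k) * V\<^sup>2 \<partial>Q) < (\<integral>\<theta>. (\<integral>x. e \<theta> x \<partial>\<nu>) \<partial>Q)"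
        using integrable_fst[OF e_int] Q.emeasure_space_1
        by (intro Q.integral_less_AE_space AE_I2) auto
      thus False using avg by (simp add: Q.prob_space)
    qed
    then obtain \<theta>' where \<theta>': "\<theta>' \<in> space Q" "(\<integral>x. e \<theta>' x \<partial>\<nu>) \<le> real (Suc k) * V\<^sup>2" by blast
    have "((\<Sum>i<Suc k. a ((\<theta>(k := \<theta>')) i) x) - real (Suc k) * T x)\<^sup>2 = e \<theta>' x" for x
    proof -
      have "(\<Sum>i<k. a ((\<theta>(k := \<theta>')) i) x) = (\<Sum>i<k. a (\<theta> i) x)" by (intro sum.cong) auto
      thus ?thesis by (simp add: e_def S_def algebra_simps)
    qed
    thus ?case using \<theta> \<theta>' by (intro exI[of _ "\<theta>(k := \<theta>')"]) (auto simp: less_Suc_eq)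
  qed
qed

section \<open>Functions with a Fourier representation\<close>

text \<open>The representation only provides a polar density for each point separately; two polar densities agree
almost everywhere because they have the same integrals over all measurable sets.  The magnitude is a
finite measure because a function of modulus 1 is integrable with respect to it.\<close>

lemma fourier_rep_density:
  assumes "fourier_rep d F ft"
  obtains m h where "finite_measure m" "sets m = sets (borel_on (Rd d))" "h \<in> borel_measurable m"
    "\<And>\<omega>. \<omega> \<in> space m \<Longrightarrow> cmod (h \<omega>) = 1"
    "\<And>x. x \<in> Rd d \<Longrightarrow> ft x = (\<integral>\<omega>. Re (h \<omega> * iexp (dot d \<omega> x)) \<partial>m)"
    "\<And>j. fourier_moment d j F = (\<integral>\<^sup>+\<omega>. ennreal (l1_norm d \<omega> ^ j) \<partial>m)"
proof -
  let ?N = "borel_on (Rd d)"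
  define m where "m = magnitude ?N F"
  have sets_m: "sets m = sets ?N" and space_m: "space m = space ?N"
    by (auto simp: m_def magnitude_def)
  have ci: "\<exists>h. polar_density ?N F h \<and> integrable m (\<lambda>\<omega>. iexp (dot d \<omega> x) * h \<omega>) \<and>
      complex_of_real (ft x) = (\<integral>\<omega>. iexp (dot d \<omega> x) * h \<omega> \<partial>m)" if "x \<in> Rd d" for x
    using assms that by (auto simp: fourier_rep_def has_complex_integral_def m_def)
  have pd: "h \<in> borel_measurable m" "\<And>\<omega>. \<omega> \<in> space m \<Longrightarrow> cmod (h \<omega>) = 1"
     "\<And>A. A \<in> sets m \<Longrightarrow> F A = (\<integral>\<omega>\<in>A. h \<omega> \<partial>m)" if "polar_density ?N F h" for h
    using that measurable_cong_sets[OF sets_m refl, of borel]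
    by (auto simp: polar_density_def space_m sets_m m_def[symmetric])
  have zero: "(\<lambda>_. 0) \<in> Rd d" by (simp add: topspace_Euclidean_space)
  obtain h where h: "polar_density ?N F h" and h_int0: "integrable m (\<lambda>\<omega>. iexp (dot d \<omega> (\<lambda>_. 0)) * h \<omega>)"
    using ci[OF zero] by blast
  have h_int: "integrable m h" using h_int0 by (simp add: dot_def)
  have "integrable m (\<lambda>\<omega>. 1 :: real)"
    by (rule Bochner_Integration.integrable_bound[OF h_int]) (use pd[OF h] in \<open>auto intro!: AE_I2\<close>)
  hence fin: "finite_measure m"
    by (intro finite_measureI) (auto simp: integrable_iff_bounded)
  have ft: "ft x = (\<integral>\<omega>. Re (h \<omega> * iexp (dot d \<omega> x)) \<partial>m)" if x: "x \<in> Rd d" for x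
  proof -
    obtain h' where h': "polar_density ?N F h'" and i': "integrable m (\<lambda>\<omega>. iexp (dot d \<omega> x) * h' \<omega>)"
      and eq: "complex_of_real (ft x) = (\<integral>\<omega>. iexp (dot d \<omega> x) * h' \<omega> \<partial>m)"
      using ci[OF x] by blast
    have h'_int: "integrable m h'"
      by (rule finite_measure.integrable_const_bound[OF fin, where B=1]) (use pd[OF h'] in auto)
    have part: "AE \<omega> in m. \<pi> (h \<omega>) = \<pi> (h' \<omega>)" if bl: "bounded_linear \<pi>" for \<pi> :: "complex \<Rightarrow> real"
    proof (rule density_unique_real)
      show "integrable m (\<lambda>\<omega>. \<pi> (h \<omega>))" "integrable m (\<lambda>\<omega>. \<pi> (h' \<omega>))"
        using integrable_bounded_linear[OF bl] h_int h'_int by auto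
      fix A assume A: "A \<in> sets m"
      have *: "(\<integral>\<omega>\<in>A. \<pi> (f \<omega>) \<partial>m) = \<pi> (\<integral>\<omega>\<in>A. f \<omega> \<partial>m)" if "integrable m f" for f
      proof -
        have "integrable m (\<lambda>\<omega>. indicator A \<omega> *\<^sub>R f \<omega>)" using that A by (intro integrable_mult_indicator)
        from integral_bounded_linear[OF bl this] show ?thesis
          unfolding set_lebesgue_integral_def linear_scale[OF bounded_linear.linear[OF bl]] .
      qed
      show "(\<integral>\<omega>\<in>A. \<pi> (h \<omega>) \<partial>m) = (\<integral>\<omega>\<in>A. \<pi> (h' \<omega>) \<partial>m)"
        unfolding *[OF h_int] *[OF h'_int] pd(3)[OF h A, symmetric] pd(3)[OF h' A, symmetric] ..
    qed
    have ae: "AE \<omega> in m. h' \<omega> = h \<omega>"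
      using part[OF bounded_linear_Re] part[OF bounded_linear_Im] by eventually_elim (simp add: complex_eq_iff)
    have "ft x = Re (\<integral>\<omega>. iexp (dot d \<omega> x) * h' \<omega> \<partial>m)" unfolding eq[symmetric] by simp
    also have "\<dots> = (\<integral>\<omega>. Re (iexp (dot d \<omega> x) * h' \<omega>) \<partial>m)" using i' by (rule integral_Re[symmetric])
    also have "\<dots> = (\<integral>\<omega>. Re (h \<omega> * iexp (dot d \<omega> x)) \<partial>m)"
    proof (rule integral_cong_AE)
      show "(\<lambda>\<omega>. Re (iexp (dot d \<omega> x) * h' \<omega>)) \<in> borel_measurable m"
        using borel_measurable_integrable[OF i'] by measurable
      have "AE \<omega> in m. iexp (dot d \<omega> x) * h' \<omega> = h \<omega> * iexp (dot d \<omega> x)"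
        using ae by eventually_elim (simp add: mult.commute)
      thus "AE \<omega> in m. Re (iexp (dot d \<omega> x) * h' \<omega>) = Re (h \<omega> * iexp (dot d \<omega> x))"
        by eventually_elim simp
      have "dot d \<omega> x = dot d x \<omega>" for \<omega> by (simp add: dot_def mult.commute)
      moreover have "(\<lambda>\<omega>. dot d x \<omega>) \<in> borel_measurable m"
        using measurable_cong_sets[OF sets_m refl] measurable_restrict_space1[OF dot_measurable] by blast
      ultimately have [measurable]: "(\<lambda>\<omega>. dot d \<omega> x) \<in> borel_measurable m" by simp
      note [measurable] = pd(1)[OF h]
      show "(\<lambda>\<omega>. Re (h \<omega> * iexp (dot d \<omega> x))) \<in> borel_measurable m" by measurable
    qed
    finally show ?thesis .
  qed
  show thesis
    by (rule that[OF fin sets_m pd(1)[OF h] pd(2)[OF h] ft]) (auto simp: fourier_moment_def m_def)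
qed

text \<open>This identifies the gradient at 0 from the second-order bound on the exponential, without
differentiating under the integral sign.\<close>

lemma has_real_derivative_if_quadratic_remainder:
  fixes f :: "real \<Rightarrow> real"
  assumes "\<And>t. \<bar>f t - f 0 - t * A\<bar> \<le> K * t\<^sup>2"
  shows "(f has_real_derivative A) (at 0)"
proof -
  have "((\<lambda>t. (f t - f 0) / t - A) \<longlongrightarrow> 0) (at 0)"
  proof (rule Lim_null_comparison)
    show "\<forall>\<^sub>F t in at 0. norm ((f t - f 0) / t - A) \<le> K * \<bar>t\<bar>"
    proof (intro eventually_at_topological[THEN iffD2] exI[of _ UNIV] conjI ballI impI)
      fix t :: real assume t: "t \<noteq> 0"
      have "norm ((f t - f 0) / t - A) = \<bar>f t - f 0 - t * A\<bar> / \<bar>t\<bar>"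
        using t by (simp add: diff_divide_distrib flip: abs_divide)
      also have "\<dots> \<le> K * t\<^sup>2 / \<bar>t\<bar>" using assms by (intro divide_right_mono) auto
      also have "\<dots> = K * \<bar>t\<bar>" using t by (simp add: power2_eq_square field_simps abs_mult_self_eq flip: abs_mult)
      finally show "norm ((f t - f 0) / t - A) \<le> K * \<bar>t\<bar>" .
    qed auto
    have "((\<lambda>t::real. K * \<bar>t\<bar>) \<longlongrightarrow> K * \<bar>0\<bar>) (at 0)" by (intro tendsto_intros)
    thus "((\<lambda>t::real. K * \<bar>t\<bar>) \<longlongrightarrow> 0) (at 0)" by simp
  qed
  hence "((\<lambda>t. (f t - f 0) / (t - 0)) \<longlongrightarrow> A) (at 0)" by (simp add: LIM_zero_iff)
  thus ?thesis by (simp add: has_field_derivative_iff)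
qed

lemma iexp_second_order: "cmod (iexp z - 1 - \<i> * z) \<le> z\<^sup>2 / 2"
proof -
  have "(\<Sum>k\<le>1. (\<i> * complex_of_real z) ^ k / fact k) = 1 + \<i> * z" by simp
  thus ?thesis using iexp_approx1[of z 1] by (simp add: diff_diff_eq numeral_2_eq_2)
qed

text \<open>For \<open>w = 0\<close> this is the zero vector.\<close>

definition unit_direction :: "nat \<Rightarrow> point \<Rightarrow> point" where
  "unit_direction d w i = w i / l1_norm d w"

lemma l1_norm_eq_0_iff: "l1_norm d w = 0 \<longleftrightarrow> (\<forall>i<d. w i = 0)"
  by (auto simp: l1_norm_def sum_nonneg_eq_0_iff)

lemma l1_norm_unit_direction: "l1_norm d (unit_direction d w) \<le> 1"
proof -
  have "l1_norm d (unit_direction d w) = l1_norm d w / l1_norm d w"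
    unfolding unit_direction_def l1_norm_def by (simp add: sum_divide_distrib[symmetric] sum_nonneg abs_of_nonneg)
  thus ?thesis by simp
qed

lemma dot_unit_direction: "l1_norm d w * dot d (unit_direction d w) x = dot d w x"
proof (cases "l1_norm d w = 0")
  case True
  thus ?thesis using l1_norm_eq_0_iff[of d w] by (simp add: dot_def)
next
  case False
  thus ?thesis by (simp add: dot_def unit_direction_def sum_distrib_left)
qed

lemma kink_eq_relu: "kink t (dot d v x) = relu (dot d (\<lambda>i. sgn t * v i) x + - min \<bar>t\<bar> 1)"
  by (simp add: kink_def dot_def sum_distrib_left mult.assoc)

lemma l1_norm_sgn: "l1_norm d (\<lambda>i. sgn (t::real) * v i) \<le> l1_norm d v"
  unfolding l1_norm_def by (intro sum_mono) (auto simp: abs_mult sgn_if)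

lemma kink_network:
  assumes "k \<ge> 1" "\<And>i. i < k \<Longrightarrow> l1_norm d (v i) \<le> 1 \<and> \<bar>c i\<bar> \<le> 2 * a / real k"
    and "\<bar>b0\<bar> \<le> a" "l1_norm d w0 \<le> a"
  shows "(\<lambda>x. (\<Sum>i<k. c i * kink (t i) (dot d (v i) x)) + dot d w0 x + b0) \<in> nn_relu d k a"
proof -
  define w where "w i = (if i = 0 then w0 else (\<lambda>j. sgn (t (i - 1)) * v (i - 1) j))" for i
  define b where "b i = (if i = 0 then b0 else - min \<bar>t (i - 1)\<bar> 1)" for i
  define \<beta> where "\<beta> i = c (i - 1)" for i
  have "(\<Sum>i=1..k. \<beta> i * relu (dot d (w i) x + b i)) = (\<Sum>i<k. c i * kink (t i) (dot d (v i) x))" for x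
    unfolding kink_eq_relu
    by (rule sum.reindex_bij_witness[of _ Suc "\<lambda>i. i - 1"]) (auto simp: w_def b_def \<beta>_def)
  moreover have "max (l1_norm d (w i)) \<bar>b i\<bar> \<le> 1 \<and> \<bar>\<beta> i\<bar> \<le> 2 * a / real k" if "i \<in> {1..k}" for i
  proof -
    have i: "i - 1 < k" "i \<noteq> 0" using that by auto
    have "l1_norm d (w i) \<le> 1"
      using order.trans[OF l1_norm_sgn[of d "t (i - 1)" "v (i - 1)"]] assms(2)[OF i(1)] i(2)
      by (simp add: w_def)
    thus ?thesis using i(2) assms(2)[OF i(1)] by (simp add: b_def \<beta>_def)
  qed
  ultimately show ?thesis
    unfolding nn_relu_def nn_class_def mem_Collect_eq
    by (intro exI[of _ \<beta>] exI[of _ w] exI[of _ b]) (use assms in \<open>auto simp: w_def b_def\<close>)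
qed

text \<open>The second moment controls the first one, so the exponential may be expanded to first order under the
integral.  The linear coefficients of this expansion are the partial derivatives at 0, because the remainder
along a coordinate axis is quadratic.\<close>

lemma barron_representation:
  assumes "fourier_rep d F ft" "fourier_moment d 2 F \<le> ennreal c" "c \<ge> 0"
    and "has_gradient_at d ft g (\<lambda>_. 0)" 
  obtains m h where "finite_measure m" "sets m = sets (borel_on (Rd d))" "h \<in> borel_measurable m"
    "\<And>\<omega>. \<omega> \<in> space m \<Longrightarrow> cmod (h \<omega>) = 1"
    "integrable m (\<lambda>\<omega>. (l1_norm d \<omega>)\<^sup>2)" "(\<integral>\<omega>. (l1_norm d \<omega>)\<^sup>2 \<partial>m) \<le> c"
    "\<And>x. x \<in> Rd d \<Longrightarrow> ft x - ft (\<lambda>_. 0) - dot d g x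
        = (\<integral>\<omega>. Re (h \<omega> * (iexp (dot d \<omega> x) - 1 - \<i> * dot d \<omega> x)) \<partial>m)"
proof -
  obtain m h where fin: "finite_measure m" and sets_m: "sets m = sets (borel_on (Rd d))"
    and h_meas [measurable]: "h \<in> borel_measurable m"
    and h1: "\<And>\<omega>. \<omega> \<in> space m \<Longrightarrow> cmod (h \<omega>) = 1"
    and ft: "\<And>x. x \<in> Rd d \<Longrightarrow> ft x = (\<integral>\<omega>. Re (h \<omega> * iexp (dot d \<omega> x)) \<partial>m)"
    and mom: "\<And>j. fourier_moment d j F = (\<integral>\<^sup>+\<omega>. ennreal (l1_norm d \<omega> ^ j) \<partial>m)"
    by (rule fourier_rep_density[OF assms(1)]) (rule that, assumption+)
  interpret finite_measure m by fact
  have coord [measurable]: "(\<lambda>\<omega>. \<omega> i) \<in> borel_measurable m" for i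
    using measurable_cong_sets[OF sets_m refl] measurable_restrict_space1[OF coordinate_measurable] by blast
  have [measurable]: "(\<lambda>\<omega>. l1_norm d \<omega>) \<in> borel_measurable m" "(\<lambda>\<omega>. dot d \<omega> x) \<in> borel_measurable m" for x
    unfolding l1_norm_def dot_def by measurable
  have nn: "(\<integral>\<^sup>+\<omega>. ennreal ((l1_norm d \<omega>)\<^sup>2) \<partial>m) \<le> ennreal c" using mom[of 2] assms(2) by simp
  have L2: "integrable m (\<lambda>\<omega>. (l1_norm d \<omega>)\<^sup>2)"
    using le_less_trans[OF nn] by (intro integrableI_nonneg) auto
  have "ennreal (\<integral>\<omega>. (l1_norm d \<omega>)\<^sup>2 \<partial>m) \<le> ennreal c"
    using nn nn_integral_eq_integral[OF L2] by simp
  hence Sc: "(\<integral>\<omega>. (l1_norm d \<omega>)\<^sup>2 \<partial>m) \<le> c" using assms(3) by simp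
  have coord_le: "\<bar>\<omega> i\<bar> \<le> l1_norm d \<omega>" if "i < d" for i \<omega>
    unfolding l1_norm_def using member_le_sum[of i "{..<d}" "\<lambda>i. \<bar>\<omega> i\<bar>"] that by auto
  have bint: "integrable m f" if "f \<in> borel_measurable m" "\<And>\<omega>. \<omega> \<in> space m \<Longrightarrow> \<bar>f \<omega>\<bar> \<le> K * (1 + (l1_norm d \<omega>)\<^sup>2)"
    for f :: "point \<Rightarrow> real" and K
  proof (rule Bochner_Integration.integrable_bound[OF _ that(1)])
    show "integrable m (\<lambda>\<omega>. K * (1 + (l1_norm d \<omega>)\<^sup>2))" using L2 by simp
    show "AE \<omega> in m. norm (f \<omega>) \<le> norm (K * (1 + (l1_norm d \<omega>)\<^sup>2))"
      using that(2) by (intro AE_I2) (smt (verit) real_norm_def)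
  qed
  have le_sq: "l1_norm d \<omega> \<le> 1 + (l1_norm d \<omega>)\<^sup>2" for \<omega>
    using zero_le_power2[of "l1_norm d \<omega> - 1"] l1_norm_nonneg[of d \<omega>]
    by (simp add: power2_eq_square algebra_simps)
  have Re_le: "\<bar>Re (h \<omega> * z)\<bar> \<le> cmod z" if "\<omega> \<in> space m" for \<omega> z
    using abs_Re_le_cmod[of "h \<omega> * z"] h1[OF that] by (simp add: norm_mult)
  have int_exp: "integrable m (\<lambda>\<omega>. Re (h \<omega> * iexp (dot d \<omega> x)))" for x
    by (rule integrable_bounded[OF fin _ Re_le[of _ "iexp (dot d _ x)", unfolded norm_exp_i_times]]) measurable
  have int_1: "integrable m (\<lambda>\<omega>. Re (h \<omega>))"
    by (rule integrable_bounded[OF fin, where c=1]) (use Re_le[of _ 1] in auto)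
  have int_c: "integrable m (\<lambda>\<omega>. Re (h \<omega> * (\<i> * \<omega> i)))" if "i < d" for i
  proof (rule bint[where K=1])
    fix \<omega> assume "\<omega> \<in> space m"
    from Re_le[OF this, of "\<i> * \<omega> i"] coord_le[OF that, of \<omega>] le_sq[of \<omega>]
    show "\<bar>Re (h \<omega> * (\<i> * \<omega> i))\<bar> \<le> 1 * (1 + (l1_norm d \<omega>)\<^sup>2)" by (simp add: norm_mult)
  qed measurable
  define A where "A i = (\<integral>\<omega>. Re (h \<omega> * (\<i> * \<omega> i)) \<partial>m)" for i
  have zero: "(\<lambda>_. 0) \<in> Rd d" by (simp add: topspace_Euclidean_space)
  have dot0: "dot d \<omega> (\<lambda>_. 0) = 0" for \<omega> by (simp add: dot_def)
  have ft0: "ft (\<lambda>_. 0) = (\<integral>\<omega>. Re (h \<omega>) \<partial>m)" using ft[OF zero] by (simp add: dot0)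
  have repr: "ft x - ft (\<lambda>_. 0) - (\<Sum>i<d. A i * x i)
      = (\<integral>\<omega>. Re (h \<omega> * (iexp (dot d \<omega> x) - 1 - \<i> * dot d \<omega> x)) \<partial>m)" if "x \<in> Rd d" for x
  proof -
    have i3: "integrable m (\<lambda>\<omega>. \<Sum>i<d. Re (h \<omega> * (\<i> * \<omega> i)) * x i)"
      using int_c by (intro Bochner_Integration.integrable_sum integrable_mult_left) auto
    have sum_eq: "(\<Sum>i<d. A i * x i) = (\<integral>\<omega>. (\<Sum>i<d. Re (h \<omega> * (\<i> * \<omega> i)) * x i) \<partial>m)"
      unfolding A_def using int_c by (subst Bochner_Integration.integral_sum) auto
    have "ft x - ft (\<lambda>_. 0) - (\<Sum>i<d. A i * x i)
       = (\<integral>\<omega>. Re (h \<omega> * iexp (dot d \<omega> x)) - Re (h \<omega>) - (\<Sum>i<d. Re (h \<omega> * (\<i> * \<omega> i)) * x i) \<partial>m)"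
      unfolding ft0 ft[OF that] sum_eq
        Bochner_Integration.integral_diff[OF Bochner_Integration.integrable_diff[OF int_exp int_1] i3]
        Bochner_Integration.integral_diff[OF int_exp int_1] ..
    also have "\<dots> = (\<integral>\<omega>. Re (h \<omega> * (iexp (dot d \<omega> x) - 1 - \<i> * dot d \<omega> x)) \<partial>m)"
    proof (rule Bochner_Integration.integral_cong)
      fix \<omega>
      have "(\<Sum>i<d. Re (h \<omega> * (\<i> * \<omega> i)) * x i) = Re (h \<omega> * (\<i> * dot d \<omega> x))"
        by (simp add: dot_def sum_distrib_left sum_negf[symmetric] algebra_simps)
      thus "Re (h \<omega> * iexp (dot d \<omega> x)) - Re (h \<omega>) - (\<Sum>i<d. Re (h \<omega> * (\<i> * \<omega> i)) * x i)
         = Re (h \<omega> * (iexp (dot d \<omega> x) - 1 - \<i> * dot d \<omega> x))"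
        by (simp only: right_diff_distrib minus_complex.sel mult_1_right)
    qed simp
    finally show ?thesis .
  qed
  have gA: "g i = A i" if i: "i < d" for i
  proof -
    define u where "u t = (\<lambda>_. 0)(i := t)" for t :: real
    have u: "u t \<in> Rd d" "dot d \<omega> (u t) = \<omega> i * t" "(\<Sum>j<d. A j * u t j) = A i * t" for t \<omega>
      using i by (auto simp: u_def topspace_Euclidean_space dot_def if_distrib[where f="\<lambda>x. _ * x"] cong: if_cong)
    have u0: "u 0 = (\<lambda>_. 0)" by (auto simp: u_def)
    have "\<bar>ft (u t) - ft (u 0) - t * A i\<bar> \<le> c / 2 * t\<^sup>2" for t
    proof -
      let ?f = "\<lambda>\<omega>. Re (h \<omega> * (iexp (\<omega> i * t) - 1 - \<i> * (\<omega> i * t)))"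
      have bd: "\<bar>?f \<omega>\<bar> \<le> (t\<^sup>2 / 2) * (l1_norm d \<omega>)\<^sup>2" if "\<omega> \<in> space m" for \<omega>
      proof -
        have "\<bar>?f \<omega>\<bar> \<le> (\<omega> i * t)\<^sup>2 / 2"
          using Re_le[OF that] iexp_second_order[of "\<omega> i * t"] by (rule order.trans)
        also have "\<dots> \<le> (t\<^sup>2 / 2) * (l1_norm d \<omega>)\<^sup>2"
          using coord_le[OF i, of \<omega>] by (simp add: power_mult_distrib mult.commute abs_le_square_iff[symmetric] mult_left_mono)
        finally show ?thesis .
      qed
      have fi: "integrable m ?f"
      proof (rule bint)
        show "\<bar>?f \<omega>\<bar> \<le> (t\<^sup>2 / 2) * (1 + (l1_norm d \<omega>)\<^sup>2)" if "\<omega> \<in> space m" for \<omega>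
          using bd[OF that] by (rule order.trans) (auto intro: mult_left_mono)
      qed measurable
      have "\<bar>\<integral>\<omega>. ?f \<omega> \<partial>m\<bar> \<le> (\<integral>\<omega>. \<bar>?f \<omega>\<bar> \<partial>m)" by (rule integral_abs_bound)
      also have "\<dots> \<le> (\<integral>\<omega>. (t\<^sup>2 / 2) * (l1_norm d \<omega>)\<^sup>2 \<partial>m)"
        using fi L2 bd by (intro integral_mono) auto
      also have "\<dots> = (t\<^sup>2 / 2) * (\<integral>\<omega>. (l1_norm d \<omega>)\<^sup>2 \<partial>m)" by simp
      also have "\<dots> \<le> (t\<^sup>2 / 2) * c" using Sc by (intro mult_left_mono) auto
      finally have "\<bar>\<integral>\<omega>. ?f \<omega> \<partial>m\<bar> \<le> c / 2 * t\<^sup>2" by (simp add: mult.commute)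
      moreover have "ft (u t) - ft (u 0) - t * A i = (\<integral>\<omega>. ?f \<omega> \<partial>m)"
        using repr[OF u(1), of t] unfolding u u0 by (simp only: mult.commute of_real_mult)
      ultimately show ?thesis by simp
    qed
    hence "((\<lambda>t. ft (u t)) has_real_derivative A i) (at 0)"
      by (rule has_real_derivative_if_quadratic_remainder)
    moreover have "((\<lambda>t. ft (u t)) has_real_derivative g i) (at 0)"
      using assms(4) i by (auto simp: has_gradient_at_def u_def)
    ultimately show ?thesis by (rule DERIV_unique[rotated])
  qed
  have "dot d g x = (\<Sum>i<d. A i * x i)" for x using gA by (auto simp: dot_def)
  thus thesis using that[OF fin sets_m h_meas h1 L2 Sc] repr by simp
qed

lemma cube_subset_Rd: "x \<in> cube d \<Longrightarrow> x \<in> Rd d"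
  by (simp add: cube_def)

text \<open>The second derivative of \<open>t \<mapsto> h exp (i L t)\<close> is \<open>- L\<^sup>2\<close> times the
function itself.\<close>

lemma phase_taylor:
  fixes h :: complex
  assumes "\<bar>s\<bar> \<le> 1"
  shows "Re (h * (iexp (L * s) - 1 - \<i> * complex_of_real (L * s)))
      = (\<integral>t. 2 * (- (L\<^sup>2 * Re (h * iexp (L * t)))) * kink t s \<partial>symmetric_uniform)"
proof -
  define p where "p t = Re h * cos (L * t) - Im h * sin (L * t)" for t
  have Re_p: "Re (h * iexp (L * t)) = p t" for t
    unfolding cis_conv_exp[symmetric] by (simp add: p_def)
  define p' where "p' t = - (L * (Re h * sin (L * t) + Im h * cos (L * t)))" for t
  have "(\<integral>t. 2 * (- (L\<^sup>2 * p t)) * kink t s \<partial>symmetric_uniform) = p s - p 0 - p' 0 * s"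
  proof (rule taylor_kink)
    show "(p has_real_derivative p' t) (at t)" for t
      unfolding p_def p'_def by (auto intro!: derivative_eq_intros simp: algebra_simps)
    show "(p' has_real_derivative - (L\<^sup>2 * p t)) (at t)" for t
      unfolding p_def p'_def by (auto intro!: derivative_eq_intros simp: algebra_simps power2_eq_square)
    show "continuous_on UNIV (\<lambda>t. - (L\<^sup>2 * p t))" unfolding p_def by (intro continuous_intros)
  qed fact
  moreover have "Re (h * (iexp (L * s) - 1 - \<i> * complex_of_real (L * s))) = p s - p 0 - p' 0 * s"
    unfolding cis_conv_exp[symmetric] by (simp add: p_def p'_def algebra_simps)
  ultimately show ?thesis by (simp only: Re_p)
qed

text \<open>The remainder of the first-order expansion is an average of kinks over frequencies, weighted by the
squared norm, and over uniform offsets.  After normalising the weight to a probability measure, the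
averaged functions are bounded by twice the second moment, and Maurey's argument applies.\<close>

theorem barron_approximation:
  assumes fr: "fourier_rep d F ft" and mom: "fourier_moment d 2 F \<le> ennreal c" and c: "c \<ge> 0"
    and grad: "has_gradient_at d ft g (\<lambda>_. 0)" and ft0: "\<bar>ft (\<lambda>_. 0)\<bar> \<le> c" and g: "l1_norm d g \<le> c"
    and \<nu>: "borel_prob_on (cube d) \<nu>" and k: "k \<ge> 1" and ca: "c \<le> a"
  shows "\<exists>q\<in>nn_relu d k a. (\<integral>x. (ft x - q x)\<^sup>2 \<partial>\<nu>) \<le> (2 * c)\<^sup>2 / real k"
proof -
  obtain m h where fin: "finite_measure m" and sets_m: "sets m = sets (borel_on (Rd d))"
    and h_meas [measurable]: "h \<in> borel_measurable m"
    and h1: "\<And>\<omega>. \<omega> \<in> space m \<Longrightarrow> cmod (h \<omega>) = 1"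
    and L2: "integrable m (\<lambda>\<omega>. (l1_norm d \<omega>)\<^sup>2)" and Sc: "(\<integral>\<omega>. (l1_norm d \<omega>)\<^sup>2 \<partial>m) \<le> c"
    and repr: "\<And>x. x \<in> Rd d \<Longrightarrow> ft x - ft (\<lambda>_. 0) - dot d g x
        = (\<integral>\<omega>. Re (h \<omega> * (iexp (dot d \<omega> x) - 1 - \<i> * dot d \<omega> x)) \<partial>m)"
    by (rule barron_representation[OF fr mom c grad]) (rule that, assumption+)
  interpret m: finite_measure m by fact
  interpret \<nu>: prob_space \<nu> by (rule borel_prob_onD[OF \<nu>])
  interpret U: prob_space symmetric_uniform by (rule prob_symmetric_uniform)
  have sp\<nu>: "space \<nu> = cube d" by (rule borel_prob_onD[OF \<nu>])
  have coord [measurable]: "(\<lambda>\<omega>. \<omega> i) \<in> borel_measurable m" for i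
    using measurable_cong_sets[OF sets_m refl] measurable_restrict_space1[OF coordinate_measurable] by blast
  have L_meas [measurable]: "(\<lambda>\<omega>. l1_norm d \<omega>) \<in> borel_measurable m"
    unfolding l1_norm_def by measurable
  define L where "L = l1_norm d"
  define \<alpha> where "\<alpha> = unit_direction d"
  define S where "S = (\<integral>\<omega>. (L \<omega>)\<^sup>2 \<partial>m)"
  have L_meas' [measurable]: "L \<in> borel_measurable m" unfolding L_def by measurable
  have S0: "S \<ge> 0" and Sc': "S \<le> c" using Sc by (auto simp: S_def L_def)
  have dot_L: "dot d \<omega> x = L \<omega> * dot d (\<alpha> \<omega>) x" for \<omega> x
    by (simp add: L_def \<alpha>_def dot_unit_direction)
  have s1: "\<bar>dot d (\<alpha> \<omega>) x\<bar> \<le> 1" if "x \<in> cube d" for \<omega> x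
    using dot_le_l1_norm[OF that] l1_norm_unit_direction unfolding \<alpha>_def by (rule order.trans)
  define \<rho> where "\<rho> \<omega> t = Re (h \<omega> * iexp (L \<omega> * t))" for \<omega> and t :: real
  have \<rho>1: "\<bar>\<rho> \<omega> t\<bar> \<le> 1" if "\<omega> \<in> space m" for \<omega> t
    using abs_Re_le_cmod[of "h \<omega> * iexp (L \<omega> * t)"] h1[OF that] unfolding norm_mult norm_exp_i_times \<rho>_def by simp
  have rem: "ft x - ft (\<lambda>_. 0) - dot d g x
     = (\<integral>\<omega>. (\<integral>t. 2 * (- ((L \<omega>)\<^sup>2 * \<rho> \<omega> t)) * kink t (dot d (\<alpha> \<omega>) x) \<partial>symmetric_uniform) \<partial>m)" if "x \<in> cube d" for x
    unfolding repr[OF cube_subset_Rd[OF that]] \<rho>_def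
      phase_taylor[OF s1[OF that], symmetric] dot_L[symmetric] ..
  show ?thesis
  \<comment> \<open>If the second moment vanishes there is nothing to normalise, and the function is affine on the cube.\<close>
  proof (cases "S = 0")
    case True
    hence "AE \<omega> in m. (L \<omega>)\<^sup>2 = 0"
      using integral_nonneg_eq_0_iff_AE[OF L2] by (simp add: S_def L_def)
    hence L_ae: "AE \<omega> in m. L \<omega> = 0" by simp
    have aff: "ft x = dot d g x + ft (\<lambda>_. 0)" if "x \<in> cube d" for x
    proof -
      have "(\<integral>\<omega>. (\<integral>t. 2 * (- ((L \<omega>)\<^sup>2 * \<rho> \<omega> t)) * kink t (dot d (\<alpha> \<omega>) x) \<partial>symmetric_uniform) \<partial>m) = 0"
        using L_ae by (intro integral_eq_zero_AE, eventually_elim) simp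
      thus ?thesis using rem[OF that] by simp
    qed
    define q where "q x = (\<Sum>i<k. 0 * kink 0 (dot d (\<lambda>_. 0) x)) + dot d g x + ft (\<lambda>_. 0)" for x
    have "q \<in> nn_relu d k a"
      unfolding q_def[abs_def]
      by (rule kink_network) (use k c ca ft0 g in \<open>auto simp: l1_norm_def\<close>)
    moreover have "(\<integral>x. (ft x - q x)\<^sup>2 \<partial>\<nu>) = (\<integral>x. 0 \<partial>\<nu>)"
      by (intro Bochner_Integration.integral_cong) (auto simp: sp\<nu> aff q_def)
    ultimately show ?thesis by (intro bexI[of _ q]) auto
  next
    case False
    hence S: "S > 0" using S0 by simp
    \<comment> \<open>The frequency distribution obtained by normalising the second-moment weight.\<close>
    define Q1 where "Q1 = density m (\<lambda>\<omega>. ennreal ((L \<omega>)\<^sup>2 / S))"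
    have "emeasure Q1 (space Q1) = (\<integral>\<^sup>+\<omega>. ennreal ((L \<omega>)\<^sup>2 / S) \<partial>m)"
      unfolding Q1_def by (subst emeasure_density) (auto intro!: nn_integral_cong)
    also have "\<dots> = ennreal (\<integral>\<omega>. (L \<omega>)\<^sup>2 / S \<partial>m)"
      using L2 S by (intro nn_integral_eq_integral) (auto simp: L_def)
    also have "(\<integral>\<omega>. (L \<omega>)\<^sup>2 / S \<partial>m) = 1" using S by (simp add: S_def)
    finally interpret Q1: prob_space Q1 by (intro prob_spaceI) simp
    interpret Q: pair_prob_space Q1 symmetric_uniform ..
    have sets_Q1 [measurable_cong]: "sets Q1 = sets m" and space_Q1: "space Q1 = space m" by (simp_all add: Q1_def)
    define a' where "a' = (\<lambda>\<theta> x. - (2 * S) * \<rho> (fst \<theta>) (snd \<theta>) * kink (snd \<theta>) (dot d (\<alpha> (fst \<theta>)) x))"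
    have coord\<nu> [measurable]: "(\<lambda>x. x j) \<in> borel_measurable \<nu>" for j
      by (intro borel_prob_onD(3)[OF \<nu>]) measurable
    have h_meas' [measurable]: "h \<in> borel_measurable Q1" "L \<in> borel_measurable Q1" "(\<lambda>\<omega>. \<omega> j) \<in> borel_measurable Q1" for j
      by (simp_all add: Q1_def)
    have a'_meas: "(\<lambda>(\<theta>, x). a' \<theta> x) \<in> borel_measurable ((Q1 \<Otimes>\<^sub>M symmetric_uniform) \<Otimes>\<^sub>M \<nu>)"
    proof -
      let ?P = "(Q1 \<Otimes>\<^sub>M symmetric_uniform) \<Otimes>\<^sub>M \<nu>"
      have f1: "(\<lambda>z. fst (fst z)) \<in> measurable ?P Q1" by measurable
      have [measurable]: "(\<lambda>z. h (fst (fst z))) \<in> borel_measurable ?P" "(\<lambda>z. L (fst (fst z))) \<in> borel_measurable ?P"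
        "(\<lambda>z. fst (fst z) j) \<in> borel_measurable ?P" "(\<lambda>z. snd z j) \<in> borel_measurable ?P" for j
        using measurable_compose[OF f1] h_meas' measurable_compose[OF measurable_snd coord\<nu>] by auto
      have "(\<lambda>z. dot d (\<alpha> (fst (fst z))) (snd z)) \<in> borel_measurable ?P"
        unfolding dot_def \<alpha>_def unit_direction_def L_def[symmetric] by measurable
      thus ?thesis unfolding a'_def \<rho>_def case_prod_unfold by measurable
    qed
    have a'_bound: "\<bar>a' \<theta> x\<bar> \<le> 2 * S" if "\<theta> \<in> space (Q1 \<Otimes>\<^sub>M symmetric_uniform)" "x \<in> space \<nu>" for \<theta> x
    proof -
      have "fst \<theta> \<in> space m" using that(1) by (auto simp: space_pair_measure space_Q1)
      hence "\<bar>\<rho> (fst \<theta>) (snd \<theta>)\<bar> * \<bar>kink (snd \<theta>) (dot d (\<alpha> (fst \<theta>)) x)\<bar> \<le> 1 * 1"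
        using kink_bounds[OF s1, of x] that(2) by (intro mult_mono \<rho>1) (auto simp: sp\<nu>)
      hence "(2 * S) * (\<bar>\<rho> (fst \<theta>) (snd \<theta>)\<bar> * \<bar>kink (snd \<theta>) (dot d (\<alpha> (fst \<theta>)) x)\<bar>) \<le> (2 * S) * 1"
        using S by (intro mult_left_mono) auto
      thus ?thesis using S by (simp add: a'_def abs_mult mult.assoc)
    qed
    define T where "T x = (\<integral>\<theta>. a' \<theta> x \<partial>(Q1 \<Otimes>\<^sub>M symmetric_uniform))" for x
    have T: "T x = ft x - ft (\<lambda>_. 0) - dot d g x" if x: "x \<in> cube d" for x
    proof -
      have [measurable]: "(\<lambda>\<theta>. a' \<theta> x) \<in> borel_measurable (Q1 \<Otimes>\<^sub>M symmetric_uniform)"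
        using measurable_compose[OF measurable_Pair2'[of x \<nu>] a'_meas] x by (simp add: sp\<nu>)
      have int: "integrable (Q1 \<Otimes>\<^sub>M symmetric_uniform) (\<lambda>\<theta>. a' \<theta> x)"
        by (rule integrable_bounded[OF Q.finite_measure_axioms]) (use a'_bound x in \<open>auto simp: sp\<nu>\<close>)
      have "T x = (\<integral>\<omega>. (\<integral>t. a' (\<omega>, t) x \<partial>symmetric_uniform) \<partial>Q1)"
        unfolding T_def using Q.integral_fst'[OF int] by simp
      also have "\<dots> = (\<integral>\<omega>. ((L \<omega>)\<^sup>2 / S) *\<^sub>R (\<integral>t. a' (\<omega>, t) x \<partial>symmetric_uniform) \<partial>m)"
        unfolding Q1_def
      proof (rule integral_density)
        have "(\<lambda>\<omega>. \<integral>t. a' (\<omega>, t) x \<partial>symmetric_uniform) \<in> borel_measurable Q1" by measurable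
        thus "(\<lambda>\<omega>. \<integral>t. a' (\<omega>, t) x \<partial>symmetric_uniform) \<in> borel_measurable m" by (simp add: Q1_def)
      qed (use S in auto)
      also have "\<dots> = (\<integral>\<omega>. (\<integral>t. 2 * (- ((L \<omega>)\<^sup>2 * \<rho> \<omega> t)) * kink t (dot d (\<alpha> \<omega>) x) \<partial>symmetric_uniform) \<partial>m)"
      proof (rule Bochner_Integration.integral_cong)
        fix \<omega>
        have "((L \<omega>)\<^sup>2 / S) *\<^sub>R (\<integral>t. a' (\<omega>, t) x \<partial>symmetric_uniform)
           = (\<integral>t. ((L \<omega>)\<^sup>2 / S) * a' (\<omega>, t) x \<partial>symmetric_uniform)" by simp
        also have "(\<lambda>t. ((L \<omega>)\<^sup>2 / S) * a' (\<omega>, t) x)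
           = (\<lambda>t. 2 * (- ((L \<omega>)\<^sup>2 * \<rho> \<omega> t)) * kink t (dot d (\<alpha> \<omega>) x))"
          using S by (simp add: a'_def fun_eq_iff field_simps)
        finally show "((L \<omega>)\<^sup>2 / S) *\<^sub>R (\<integral>t. a' (\<omega>, t) x \<partial>symmetric_uniform)
           = (\<integral>t. 2 * (- ((L \<omega>)\<^sup>2 * \<rho> \<omega> t)) * kink t (dot d (\<alpha> \<omega>) x) \<partial>symmetric_uniform)" .
      qed simp
      finally show ?thesis using rem[OF x] by simp
    qed
    obtain \<theta> where \<theta>: "\<forall>i<k. \<theta> i \<in> space (Q1 \<Otimes>\<^sub>M symmetric_uniform)"
      and err: "(\<integral>x. ((\<Sum>i<k. a' (\<theta> i) x) - real k * T x)\<^sup>2 \<partial>\<nu>) \<le> real k * (2 * S)\<^sup>2"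
      using maurey[OF Q.prob_space_axioms \<nu>.prob_space_axioms a'_meas a'_bound, of k] unfolding T_def by blast
    define co where "co i = - (2 * S) * \<rho> (fst (\<theta> i)) (snd (\<theta> i)) / real k" for i
    define q where "q x = (\<Sum>i<k. co i * kink (snd (\<theta> i)) (dot d (\<alpha> (fst (\<theta> i))) x)) + dot d g x + ft (\<lambda>_. 0)" for x
    have "q \<in> nn_relu d k a"
      unfolding q_def[abs_def]
    proof (rule kink_network)
      fix i assume i: "i < k"
      hence "fst (\<theta> i) \<in> space m" using \<theta> by (auto simp: space_pair_measure space_Q1)
      hence "(2 * S) * \<bar>\<rho> (fst (\<theta> i)) (snd (\<theta> i))\<bar> \<le> (2 * S) * 1" using S by (intro mult_left_mono \<rho>1) auto
      hence "(2 * S) * \<bar>\<rho> (fst (\<theta> i)) (snd (\<theta> i))\<bar> \<le> 2 * a" using Sc' ca by linarith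
      hence "\<bar>co i\<bar> \<le> 2 * a / real k"
        using S k by (simp add: co_def abs_mult divide_right_mono)
      thus "l1_norm d (\<alpha> (fst (\<theta> i))) \<le> 1 \<and> \<bar>co i\<bar> \<le> 2 * a / real k"
        by (simp add: \<alpha>_def l1_norm_unit_direction)
    qed (use k ft0 g ca in auto)
    moreover have "(\<integral>x. (ft x - q x)\<^sup>2 \<partial>\<nu>) \<le> (2 * c)\<^sup>2 / real k"
    proof -
      have "(\<integral>x. (ft x - q x)\<^sup>2 \<partial>\<nu>) = (\<integral>x. ((\<Sum>i<k. a' (\<theta> i) x) - real k * T x)\<^sup>2 / (real k)\<^sup>2 \<partial>\<nu>)"
      proof (rule Bochner_Integration.integral_cong)
        fix x assume "x \<in> space \<nu>"
        hence x: "x \<in> cube d" by (simp add: sp\<nu>)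
        have "(\<Sum>i<k. co i * kink (snd (\<theta> i)) (dot d (\<alpha> (fst (\<theta> i))) x)) = (\<Sum>i<k. a' (\<theta> i) x) / real k"
          unfolding sum_divide_distrib by (intro sum.cong) (simp_all add: co_def a'_def)
        hence "ft x - q x = - (((\<Sum>i<k. a' (\<theta> i) x) - real k * T x) / real k)"
          using k by (simp add: q_def T[OF x] field_simps)
        thus "(ft x - q x)\<^sup>2 = ((\<Sum>i<k. a' (\<theta> i) x) - real k * T x)\<^sup>2 / (real k)\<^sup>2"
          by (simp add: power_divide)
      qed simp
      also have "\<dots> \<le> (real k * (2 * S)\<^sup>2) / (real k)\<^sup>2"
        using err by (simp add: divide_right_mono)
      also have "\<dots> = (2 * S)\<^sup>2 / real k" using k by (simp add: power2_eq_square)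
      also have "\<dots> \<le> (2 * c)\<^sup>2 / real k" using S Sc' by (intro divide_right_mono power_mono) auto
      finally show ?thesis .
    qed
    ultimately show ?thesis by blast
  qed
qed

lemma set_linf_norm_cube:
  assumes "d \<ge> 1"
  shows "set_linf_norm d (cube d) \<ge> 1"
proof -
  let ?x = "\<lambda>i. if i < d then 1 else 0 :: real"
  have "1 = ennreal \<bar>?x 0\<bar>" using assms by simp
  also have "\<dots> \<le> linf_norm d ?x" unfolding linf_norm_def using assms by (intro SUP_upper) auto
  also have "\<dots> \<le> set_linf_norm d (cube d)"
    unfolding set_linf_norm_def by (intro SUP_upper) (auto simp: cube_def topspace_Euclidean_space)
  finally show ?thesis .
qed

text \<open>The infimum defining the coefficient need not be attained; allowing \<open>M + 1\<close> in place of
\<open>M\<close> provides a representation.\<close>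

theorem kb_approximation:
  assumes "d \<ge> 1" "kb_coeff d f (cube d) \<le> ennreal M" "M \<ge> 0"
    and \<nu>: "borel_prob_on (cube d) \<nu>" and k: "k \<ge> 1" and a: "M + 1 \<le> a"
  shows "\<exists>q\<in>nn_relu d k a. (\<integral>x. (f x - q x)\<^sup>2 \<partial>\<nu>) \<le> (2 * (M + 1))\<^sup>2 / real k"
proof -
  have "kb_coeff d f (cube d) < ennreal (M + 1)"
    using assms(2,3) by (rule_tac le_less_trans) (auto intro: ennreal_lessI)
  then obtain c ft F g where c: "ennreal c < ennreal (M + 1)" "0 \<le> c" and fr: "fourier_rep d F ft"
    and eq: "\<forall>x\<in>cube d. ft x = f x" and mom: "set_linf_norm d (cube d) * fourier_moment d 2 F \<le> ennreal c"
    and ft0: "\<bar>ft (\<lambda>_. 0)\<bar> \<le> c" and grad: "has_gradient_at d ft g (\<lambda>_. 0)" and g: "l1_norm d g \<le> c"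
    unfolding kb_coeff_def Inf_less_iff by blast
  have cM: "c \<le> M + 1" using c(1) by (subst (asm) ennreal_less_iff) (use c(2) in auto)
  have "fourier_moment d 2 F \<le> set_linf_norm d (cube d) * fourier_moment d 2 F"
    using mult_right_mono[OF set_linf_norm_cube[OF assms(1)], of "fourier_moment d 2 F"] by simp
  also have "\<dots> \<le> ennreal (M + 1)" using mom cM by (auto intro: order.trans ennreal_leI)
  finally have mom': "fourier_moment d 2 F \<le> ennreal (M + 1)" .
  obtain q where q: "q \<in> nn_relu d k a" "(\<integral>x. (ft x - q x)\<^sup>2 \<partial>\<nu>) \<le> (2 * (M + 1))\<^sup>2 / real k"
    using barron_approximation[OF fr mom' _ grad _ _ \<nu> k a] assms(3) ft0 g cM by fastforce
  have "(\<integral>x. (ft x - q x)\<^sup>2 \<partial>\<nu>) = (\<integral>x. (f x - q x)\<^sup>2 \<partial>\<nu>)"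
    using eq borel_prob_onD(2)[OF \<nu>] by (intro Bochner_Integration.integral_cong) auto
  thus ?thesis using q by auto
qed

section \<open>The error of the estimator\<close>

definition objective :: "point measure \<Rightarrow> point measure \<Rightarrow> (point \<Rightarrow> real) \<Rightarrow> real" where
  "objective \<mu> \<nu> g = (\<integral>x. g x \<partial>\<mu>) - (\<integral>x. g x \<partial>\<nu>) - 1/4 * (\<integral>x. (g x)\<^sup>2 \<partial>\<nu>)"

definition sample_objective :: "nat \<Rightarrow> (nat \<Rightarrow> 'a) \<Rightarrow> (nat \<Rightarrow> 'a) \<Rightarrow> ('a \<Rightarrow> real) \<Rightarrow> real" where
  "sample_objective n x y g = 1 / real n * (\<Sum>i<n. g (x i) - g (y i) - 1 / 4 * (g (y i))\<^sup>2)"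

lemma sample_objective_deviation:
  "sample_objective n x y g - objective \<mu> \<nu> g
   = sampling_error \<mu> n g x - sampling_error \<nu> n g y - 1/4 * sampling_error \<nu> n (\<lambda>z. g z * g z) y"
  by (simp add: sample_objective_def objective_def sampling_error_def sum_subtractf sum_distrib_left[symmetric]
      power2_eq_square diff_divide_distrib right_diff_distrib sum_divide_distrib[symmetric])

context activation begin

lemma objective_deviation:
  assumes \<mu>: "borel_prob_on (cube d) \<mu>" and \<nu>: "borel_prob_on (cube d) \<nu>"
    and x: "\<And>i. i < n \<Longrightarrow> x i \<in> cube d" and y: "\<And>i. i < n \<Longrightarrow> y i \<in> cube d"
    and Wx: "ridge_deviation_bound d \<mu> n x Wx" and Wy: "ridge_deviation_bound d \<nu> n y Wy"
    and g: "ridge_sum d \<phi> L' g" "L' \<le> L"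
  shows "\<bar>sample_objective n x y g - objective \<mu> \<nu> g\<bar> \<le> (2 * L + L\<^sup>2) * (Wx + Wy)"
proof -
  have L: "L' \<ge> 0" "L \<ge> 0" using ridge_sum_nonneg[OF g(1)] g(2) by auto
  obtain L1 where L1: "L1 \<le> 2" "ridge_sum d \<phi> L1 (\<lambda>_. 1)" using unit_ridge_sum by blast
  have L1': "L1 \<ge> 0" using ridge_sum_nonneg[OF L1(2)] .
  have W: "Wx \<ge> 0" "Wy \<ge> 0"
    using Wx Wy unfolding ridge_deviation_bound_def
    by (auto dest!: spec[of _ "\<lambda>_. 0"] intro: order.trans[OF abs_ge_zero])
  have lin: "\<bar>sampling_error \<mu>' n g z\<bar> \<le> 2 * L * W"
    if "borel_prob_on (cube d) \<mu>'" "\<And>i. i < n \<Longrightarrow> z i \<in> cube d" "ridge_deviation_bound d \<mu>' n z W" "W \<ge> 0" for \<mu>' z W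
  proof -
    have "\<bar>sampling_error \<mu>' n (\<lambda>x. g x * 1) z\<bar> \<le> L' * L1 * W"
      by (rule deviation_of_product_of_ridge_sums[OF that(1-3) g(1) L1(2)])
    also have "\<dots> \<le> L * 2 * W" using L L1 L1' g(2) that(4) by (intro mult_mono) auto
    finally show ?thesis by (simp add: mult.commute)
  qed
  have "\<bar>sampling_error \<nu> n (\<lambda>z. g z * g z) y\<bar> \<le> L' * L' * Wy"
    by (rule deviation_of_product_of_ridge_sums[OF \<nu> y Wy g(1) g(1)])
  also have "\<dots> \<le> L * L * Wy" using L g(2) W by (intro mult_mono) auto
  finally have q: "\<bar>sampling_error \<nu> n (\<lambda>z. g z * g z) y\<bar> \<le> L\<^sup>2 * Wy" by (simp add: power2_eq_square)
  have "\<bar>sample_objective n x y g - objective \<mu> \<nu> g\<bar> \<le> 2 * L * Wx + 2 * L * Wy + 1/4 * (L\<^sup>2 * Wy)"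
    unfolding sample_objective_deviation
    using lin[OF \<mu> x Wx W(1)] lin[OF \<nu> y Wy W(2)] q by linarith
  also have "\<dots> \<le> (2 * L + L\<^sup>2) * (Wx + Wy)"
    using W L zero_le_power2[of L] by (simp add: algebra_simps)
  finally show ?thesis .
qed

end

text \<open>The supremum of the sample objective exceeds chi-square by at most the deviation, because the
population objective never exceeds chi-square; evaluating it at one function \<open>g0\<close> bounds it from
below.\<close>

theorem estimator_error:
  assumes pair: "(\<mu>, \<nu>) \<in> chi2_pairs S" and f: "chi2_opt \<mu> \<nu> f"
    and G: "\<And>g. g \<in> G \<Longrightarrow> g \<in> borel_measurable borel" "\<And>g x. g \<in> G \<Longrightarrow> x \<in> S \<Longrightarrow> \<bar>g x\<bar> \<le> B"
    and dev: "\<And>g. g \<in> G \<Longrightarrow> \<bar>sample_objective n x y g - objective \<mu> \<nu> g\<bar> \<le> \<Delta>"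
    and g0: "g0 \<in> G"
  shows "\<bar>chi2_est G n x y - enn2real (chi2 \<mu> \<nu>)\<bar> \<le> \<Delta> + 1/4 * (\<integral>x. (f x - g0 x)\<^sup>2 \<partial>\<nu>)"
proof -
  have \<nu>: "borel_prob_on S \<nu>" using pair by (auto simp: chi2_pairs_def)
  have obj: "objective \<mu> \<nu> g = enn2real (chi2 \<mu> \<nu>) - 1/4 * (\<integral>x. (f x - g x)\<^sup>2 \<partial>\<nu>)" if "g \<in> G" for g
    unfolding objective_def using borel_prob_onD(3)[OF \<nu> G(1)[OF that]] G(2)[OF that]
    by (rule chi2_variational[OF pair f])
  have upper: "sample_objective n x y g \<le> enn2real (chi2 \<mu> \<nu>) + \<Delta>" if "g \<in> G" for g
  proof -
    have "(\<integral>x. (f x - g x)\<^sup>2 \<partial>\<nu>) \<ge> 0" by simp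
    thus ?thesis using dev[OF that] obj[OF that] by linarith
  qed
  have est: "chi2_est G n x y = (SUP g\<in>G. sample_objective n x y g)"
    by (simp add: chi2_est_def sample_objective_def)
  have "chi2_est G n x y \<le> enn2real (chi2 \<mu> \<nu>) + \<Delta>"
    unfolding est using g0 upper by (intro cSUP_least) auto
  moreover have "sample_objective n x y g0 \<le> chi2_est G n x y"
    unfolding est using upper by (intro cSUP_upper[OF g0]) (auto intro!: bdd_aboveI2)
  moreover have "sample_objective n x y g0 \<ge> objective \<mu> \<nu> g0 - \<Delta>" using dev[OF g0] by linarith
  moreover have "(\<integral>x. (f x - g0 x)\<^sup>2 \<partial>\<nu>) \<ge> 0" by simp
  ultimately show ?thesis using obj[OF g0] by linarith
qed

section \<open>Network classes as ridge sums\<close>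

lemma activation_relu: "activation relu"
proof
  show "\<exists>s \<kappa>. \<bar>s\<bar> \<le> 1 \<and> \<bar>\<kappa>\<bar> \<le> 2 \<and> \<kappa> * relu s = 1"
    by (intro exI[of _ 1]) (auto simp: relu_def)
qed (auto simp: relu_def)

lemma sigmoid_range: "0 < sigmoid_act z" "sigmoid_act z < 1"
proof -
  have "1 < 1 + exp (- z)" by simp
  thus "0 < sigmoid_act z" "sigmoid_act z < 1"
    unfolding sigmoid_act_def inverse_less_1_iff inverse_positive_iff_positive by linarith+
qed

lemma sigmoid_has_derivative:
  "(sigmoid_act has_real_derivative sigmoid_act z * (1 - sigmoid_act z)) (at z)"
proof -
  have pos: "0 < 1 + exp (- z)" by (intro add_pos_pos) auto
  show ?thesis unfolding sigmoid_act_def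
    by (rule derivative_eq_intros refl | use pos in \<open>simp; fail\<close>)+
       (use pos in \<open>simp add: field_simps power2_eq_square\<close>)
qed

lemma activation_sigmoid: "activation sigmoid_act"
proof
  fix u v :: real
  have "norm (sigmoid_act u - sigmoid_act v) \<le> 1 * norm (u - v)"
  proof (rule field_differentiable_bound[of UNIV])
    fix z
    show "(sigmoid_act has_field_derivative sigmoid_act z * (1 - sigmoid_act z)) (at z within UNIV)"
      using sigmoid_has_derivative by simp
    show "norm (sigmoid_act z * (1 - sigmoid_act z)) \<le> 1"
      using sigmoid_range[of z] by (simp add: abs_mult mult_le_one)
  qed auto
  thus "\<bar>sigmoid_act u - sigmoid_act v\<bar> \<le> \<bar>u - v\<bar>" by simp
next
  show "\<bar>sigmoid_act z\<bar> \<le> 2" for z using sigmoid_range[of z] by simp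
  show "\<exists>s \<kappa>. \<bar>s\<bar> \<le> 1 \<and> \<bar>\<kappa>\<bar> \<le> 2 \<and> \<kappa> * sigmoid_act s = 1"
    by (intro exI[of _ 0] exI[of _ 2]) (auto simp: sigmoid_act_def)
qed

lemma ridge_sum_scale:
  assumes "ridge_sum d \<phi> L g"
  shows "ridge_sum d \<phi> (\<bar>c\<bar> * L) (\<lambda>x. c * g x)"
  using assms
proof induction
  case zero
  thus ?case using ridge_sum.zero by simp
next
  case (add_ridge L g w b c')
  thus ?case using ridge_sum.add_ridge[OF add_ridge.IH add_ridge.hyps(2,3), of "c * c'"]
    by (simp add: abs_mult distrib_left mult.assoc)
qed

text \<open>The affine part is a ridge sum as well: \<open>z = relu z - relu (- z)\<close>, and
\<open>1 = relu 1\<close>.\<close>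

lemma nn_relu_ridge_sum:
  assumes "g \<in> nn_relu d k a" "k \<ge> 1"
  shows "\<exists>L\<le>5 * a. ridge_sum d relu L g"
proof -
  obtain \<beta> w b where g: "g = (\<lambda>x. (\<Sum>i=1..k. \<beta> i * relu (dot d (w i) x + b i)) + dot d (w 0) x + b 0)"
    and c: "\<forall>i\<in>{1..k}. max (l1_norm d (w i)) \<bar>b i\<bar> \<le> 1 \<and> \<bar>\<beta> i\<bar> \<le> 2 * a / real k"
    and b0: "\<bar>b 0\<bar> \<le> a" and w0: "l1_norm d (w 0) \<le> a"
    using assms(1) unfolding nn_relu_def nn_class_def by blast
  let ?v = "unit_direction d (w 0)" and ?n = "l1_norm d (w 0)"
  have 1: "ridge_sum d relu (\<Sum>i=1..k. \<bar>\<beta> i\<bar>) (\<lambda>x. \<Sum>i=1..k. \<beta> i * relu (dot d (w i) x + b i))"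
    using c by (intro ridge_sum_sum) auto
  have 2: "ridge_sum d relu \<bar>?n\<bar> (\<lambda>x. ?n * relu (dot d ?v x + 0))"
    by (intro ridge_sum_atom l1_norm_unit_direction) simp
  have "l1_norm d (\<lambda>i. - ?v i) \<le> 1" using l1_norm_unit_direction[of d "w 0"] by (simp add: l1_norm_def)
  hence 3: "ridge_sum d relu \<bar>- ?n\<bar> (\<lambda>x. (- ?n) * relu (dot d (\<lambda>i. - ?v i) x + 0))"
    by (intro ridge_sum_atom) auto
  have 4: "ridge_sum d relu \<bar>b 0\<bar> (\<lambda>x. b 0 * relu (dot d (\<lambda>_. 0) x + 1))"
    by (intro ridge_sum_atom) (auto simp: l1_norm_def)
  have "ridge_sum d relu ((\<Sum>i=1..k. \<bar>\<beta> i\<bar>) + \<bar>?n\<bar> + \<bar>- ?n\<bar> + \<bar>b 0\<bar>)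
     (\<lambda>x. (\<Sum>i=1..k. \<beta> i * relu (dot d (w i) x + b i)) + ?n * relu (dot d ?v x + 0)
        + (- ?n) * relu (dot d (\<lambda>i. - ?v i) x + 0) + b 0 * relu (dot d (\<lambda>_. 0) x + 1))"
    by (intro ridge_sum_plus 1 2 3 4)
  also have "(\<lambda>x. (\<Sum>i=1..k. \<beta> i * relu (dot d (w i) x + b i)) + ?n * relu (dot d ?v x + 0)
        + (- ?n) * relu (dot d (\<lambda>i. - ?v i) x + 0) + b 0 * relu (dot d (\<lambda>_. 0) x + 1)) = g"
  proof
    fix x
    have "?n * relu (dot d ?v x + 0) + (- ?n) * relu (dot d (\<lambda>i. - ?v i) x + 0) = ?n * dot d ?v x"
      by (auto simp: relu_def dot_def sum_negf max_def)
    moreover have "relu (dot d (\<lambda>_. 0) x + 1) = 1" by (simp add: dot_def relu_def)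
    ultimately show "(\<Sum>i=1..k. \<beta> i * relu (dot d (w i) x + b i)) + ?n * relu (dot d ?v x + 0)
        + (- ?n) * relu (dot d (\<lambda>i. - ?v i) x + 0) + b 0 * relu (dot d (\<lambda>_. 0) x + 1) = g x"
      by (simp only: g dot_unit_direction mult_1_right add.assoc)
  qed
  finally have rs: "ridge_sum d relu ((\<Sum>i=1..k. \<bar>\<beta> i\<bar>) + \<bar>?n\<bar> + \<bar>- ?n\<bar> + \<bar>b 0\<bar>) g" .
  have "(\<Sum>i=1..k. \<bar>\<beta> i\<bar>) \<le> (\<Sum>i=1..k. 2 * a / real k)" using c by (intro sum_mono) auto
  also have "\<dots> = 2 * a" using assms(2) by simp
  finally have "(\<Sum>i=1..k. \<bar>\<beta> i\<bar>) + \<bar>?n\<bar> + \<bar>- ?n\<bar> + \<bar>b 0\<bar> \<le> 5 * a"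
    using b0 w0 l1_norm_nonneg[of d "w 0"] by linarith
  thus ?thesis using rs by blast
qed

context activation begin

lemma nn_star_ridge_sum:
  assumes "g \<in> nn_star d k \<phi>"
  shows "\<exists>L\<le>real k + 2. ridge_sum d \<phi> L g"
proof -
  obtain \<beta> w b where g: "g = (\<lambda>x. (\<Sum>i=1..k. \<beta> i * \<phi> (dot d (w i) x + b i)) + dot d (w 0) x + b 0)"
    and c: "\<forall>i\<in>{1..k}. max (l1_norm d (w i)) \<bar>b i\<bar> \<le> 1 \<and> \<bar>\<beta> i\<bar> \<le> 1"
    and b0: "\<bar>b 0\<bar> \<le> 1" and w0: "l1_norm d (w 0) \<le> 0"
    using assms unfolding nn_star_def nn_class_def by blast
  have "l1_norm d (w 0) = 0" using w0 l1_norm_nonneg[of d "w 0"] by simp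
  hence dot0: "dot d (w 0) x = 0" for x by (simp add: l1_norm_eq_0_iff dot_def)
  obtain L1 where L1: "L1 \<le> 2" "ridge_sum d \<phi> L1 (\<lambda>_. 1)" using unit_ridge_sum by blast
  have "ridge_sum d \<phi> ((\<Sum>i=1..k. \<bar>\<beta> i\<bar>) + \<bar>b 0\<bar> * L1)
      (\<lambda>x. (\<Sum>i=1..k. \<beta> i * \<phi> (dot d (w i) x + b i)) + b 0 * 1)"
    using c by (intro ridge_sum_plus ridge_sum_sum ridge_sum_scale[OF L1(2)]) auto
  moreover have "(\<Sum>i=1..k. \<bar>\<beta> i\<bar>) \<le> (\<Sum>i=1..k. 1)" using c by (intro sum_mono) auto
  moreover have "\<bar>b 0\<bar> * L1 \<le> 1 * 2" using b0 L1 ridge_sum_nonneg[OF L1(2)] by (intro mult_mono) auto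
  ultimately show ?thesis by (intro exI[of _ "(\<Sum>i=1..k. \<bar>\<beta> i\<bar>) + \<bar>b 0\<bar> * L1"]) (auto simp: g dot0)
qed

end

text \<open>Functions computed, without an affine part, by all sufficiently large networks with coefficients
bounded by 1.\<close>

definition eventually_bias_free :: "nat \<Rightarrow> (real \<Rightarrow> real) \<Rightarrow> (point \<Rightarrow> real) \<Rightarrow> bool" where
  "eventually_bias_free d \<phi> g \<longleftrightarrow> (\<exists>K::nat. \<forall>k\<ge>K. \<exists>\<beta> w b.
     (\<forall>i\<in>{1..k}. l1_norm d (w i) \<le> 1 \<and> \<bar>b i\<bar> \<le> 1 \<and> \<bar>\<beta> i\<bar> \<le> 1) \<and>
     g = (\<lambda>x. \<Sum>i=1..k. \<beta> i * \<phi> (dot d (w i) x + b i)))"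

lemma eventually_bias_free_add:
  assumes "eventually_bias_free d \<phi> g" "l1_norm d v \<le> 1" "\<bar>a\<bar> \<le> 1" "\<bar>c\<bar> \<le> 1"
  shows "eventually_bias_free d \<phi> (\<lambda>x. g x + c * \<phi> (dot d v x + a))"
proof -
  obtain K :: nat where K: "\<forall>k\<ge>K. \<exists>\<beta> w b. (\<forall>i\<in>{1..k}. l1_norm d (w i) \<le> 1 \<and> \<bar>b i\<bar> \<le> 1 \<and> \<bar>\<beta> i\<bar> \<le> 1) \<and>
     g = (\<lambda>x. \<Sum>i=1..k. \<beta> i * \<phi> (dot d (w i) x + b i))"
    using assms(1) unfolding eventually_bias_free_def by (elim exE) (rule that)
  show ?thesis unfolding eventually_bias_free_def
  proof (intro exI[of _ "Suc K"] allI impI)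
    fix k assume "Suc K \<le> k"
    then obtain k' where k': "k = Suc k'" "K \<le> k'" by (cases k) auto
    obtain \<beta> w b where r: "\<forall>i\<in>{1..k'}. l1_norm d (w i) \<le> 1 \<and> \<bar>b i\<bar> \<le> 1 \<and> \<bar>\<beta> i\<bar> \<le> 1"
      and g: "g = (\<lambda>x. \<Sum>i=1..k'. \<beta> i * \<phi> (dot d (w i) x + b i))" using K[rule_format, OF k'(2)] by (elim exE conjE) (rule that)
    have "(\<Sum>i=1..k. (\<beta>(k := c)) i * \<phi> (dot d ((w(k := v)) i) x + (b(k := a)) i)) = g x + c * \<phi> (dot d v x + a)" for x
    proof -
      have "(\<Sum>i=1..k'. (\<beta>(k := c)) i * \<phi> (dot d ((w(k := v)) i) x + (b(k := a)) i)) = g x"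
        unfolding g by (intro sum.cong) (auto simp: k')
      thus ?thesis by (simp add: k'(1))
    qed
    moreover have "\<forall>i\<in>{1..k}. l1_norm d ((w(k := v)) i) \<le> 1 \<and> \<bar>(b(k := a)) i\<bar> \<le> 1 \<and> \<bar>(\<beta>(k := c)) i\<bar> \<le> 1"
      using r assms k' by auto
    ultimately show "\<exists>\<beta> w b. (\<forall>i\<in>{1..k}. l1_norm d (w i) \<le> 1 \<and> \<bar>b i\<bar> \<le> 1 \<and> \<bar>\<beta> i\<bar> \<le> 1) \<and>
       (\<lambda>x. g x + c * \<phi> (dot d v x + a)) = (\<lambda>x. \<Sum>i=1..k. \<beta> i * \<phi> (dot d (w i) x + b i))"
      by (intro exI[of _ "\<beta>(k := c)"] exI[of _ "w(k := v)"] exI[of _ "b(k := a)"]) auto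
  qed
qed

text \<open>A large coefficient is split into equal small ones carried by copies of the same neuron.\<close>

lemma ridge_sum_eventually_bias_free:
  assumes "ridge_sum d \<phi> L g"
  shows "eventually_bias_free d \<phi> g"
  using assms
proof induction
  case zero
  show ?case unfolding eventually_bias_free_def
    by (intro exI[of _ 0] allI impI exI[of _ "\<lambda>_. 0"] exI[of _ "\<lambda>_ _. 0"]) (auto simp: l1_norm_def)
next
  case (add_ridge L g w b c)
  define N where "N = Suc (nat \<lceil>\<bar>c\<bar>\<rceil>)"
  have "\<bar>c\<bar> \<le> real N"
    unfolding N_def of_nat_Suc using real_nat_ceiling_ge[of "\<bar>c\<bar>"] by linarith
  moreover have N0: "real N > 0" by (simp only: N_def of_nat_0_less_iff zero_less_Suc)
  ultimately have cN: "\<bar>c / real N\<bar> \<le> 1" by (simp add: divide_le_eq)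
  have "eventually_bias_free d \<phi> (\<lambda>x. g x + real j * (c / real N) * \<phi> (dot d w x + b))" for j
  proof (induction j)
    case (Suc j)
    from eventually_bias_free_add[OF this add_ridge.hyps(2,3) cN] show ?case
      by (simp add: algebra_simps add_divide_distrib)
  qed (use add_ridge.IH in simp)
  from this[of N] show ?case using N0 by simp
qed

lemma eventually_bias_free_nn_star:
  assumes "eventually_bias_free d \<phi> g"
  shows "\<exists>K. \<forall>k\<ge>K. g \<in> nn_star d k \<phi>"
proof -
  obtain K :: nat where K: "\<forall>k\<ge>K. \<exists>\<beta> w b. (\<forall>i\<in>{1..k}. l1_norm d (w i) \<le> 1 \<and> \<bar>b i\<bar> \<le> 1 \<and> \<bar>\<beta> i\<bar> \<le> 1) \<and>
     g = (\<lambda>x. \<Sum>i=1..k. \<beta> i * \<phi> (dot d (w i) x + b i))"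
    using assms unfolding eventually_bias_free_def by (elim exE) (rule that)
  have "g \<in> nn_star d k \<phi>" if kK: "k \<ge> K" for k
  proof -
    obtain \<beta> w b where r: "\<forall>i\<in>{1..k}. l1_norm d (w i) \<le> 1 \<and> \<bar>b i\<bar> \<le> 1 \<and> \<bar>\<beta> i\<bar> \<le> 1"
      and g: "g = (\<lambda>x. \<Sum>i=1..k. \<beta> i * \<phi> (dot d (w i) x + b i))" using K[rule_format, OF kK] by (elim exE conjE) (rule that)
    show ?thesis unfolding nn_star_def nn_class_def mem_Collect_eq
      by (intro exI[of _ \<beta>] exI[of _ "w(0 := \<lambda>_. 0)"] exI[of _ "b(0 := 0)"])
         (use r in \<open>auto simp: g l1_norm_def dot_def fun_eq_iff intro!: sum.cong\<close>)
  qed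
  thus ?thesis by blast
qed

section \<open>Closure of the ridge sums in the square norm\<close>

locale ridge_closure = activation + prob_space \<nu> for \<nu> :: "point measure" +
  fixes d :: nat
  assumes law: "borel_prob_on (cube d) \<nu>"
begin

lemma space_law: "space \<nu> = cube d" by (rule borel_prob_onD[OF law])

definition bounded_measurable :: "(point \<Rightarrow> real) \<Rightarrow> bool" where
  "bounded_measurable h \<longleftrightarrow> h \<in> borel_measurable \<nu> \<and> (\<exists>B. \<forall>x\<in>cube d. \<bar>h x\<bar> \<le> B)"

definition approximable :: "(point \<Rightarrow> real) \<Rightarrow> bool" where
  "approximable h \<longleftrightarrow> bounded_measurable h \<and>
     (\<forall>\<epsilon>>0. \<exists>L g. ridge_sum d \<phi> L g \<and> (\<integral>x. (h x - g x)\<^sup>2 \<partial>\<nu>) \<le> \<epsilon>)"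

lemma bounded_measurable_add_mult:
  assumes "bounded_measurable h" "bounded_measurable h'"
  shows "bounded_measurable (\<lambda>x. h x + c * h' x)"
proof -
  obtain B B' where B: "\<forall>x\<in>cube d. \<bar>h x\<bar> \<le> B" "\<forall>x\<in>cube d. \<bar>h' x\<bar> \<le> B'"
    using assms by (auto simp: bounded_measurable_def)
  have "\<bar>h x + c * h' x\<bar> \<le> B + \<bar>c\<bar> * B'" if "x \<in> cube d" for x
  proof -
    have "\<bar>c * h' x\<bar> \<le> \<bar>c\<bar> * B'" unfolding abs_mult using B that by (intro mult_left_mono) auto
    thus ?thesis using B(1) that abs_triangle_ineq[of "h x" "c * h' x"] by fastforce
  qed
  thus ?thesis using assms by (auto simp: bounded_measurable_def)
qed

lemma bounded_measurable_diff:
  "bounded_measurable h \<Longrightarrow> bounded_measurable h' \<Longrightarrow> bounded_measurable (\<lambda>x. h x - h' x)"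
  using bounded_measurable_add_mult[of h h' "-1"] by simp

lemma ridge_sum_bounded_measurable: "ridge_sum d \<phi> L g \<Longrightarrow> bounded_measurable g"
  using ridge_sum_bounded[of d L g] ridge_sum_measurable borel_prob_onD(3)[OF law]
  unfolding bounded_measurable_def by blast

lemma square_integrable:
  assumes "bounded_measurable h"
  shows "integrable \<nu> (\<lambda>x. (h x)\<^sup>2)"
proof -
  obtain B where B: "\<forall>x\<in>cube d. \<bar>h x\<bar> \<le> B" and [measurable]: "h \<in> borel_measurable \<nu>"
    using assms by (auto simp: bounded_measurable_def)
  show ?thesis
  proof (rule integrable_bounded[OF finite_measure_axioms])
    fix x assume "x \<in> space \<nu>"
    hence "\<bar>h x\<bar>\<^sup>2 \<le> B\<^sup>2" using B by (intro power_mono) (auto simp: space_law)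
    thus "\<bar>(h x)\<^sup>2\<bar> \<le> B\<^sup>2" by simp
  qed measurable
qed

lemma integral_square_add:
  assumes "bounded_measurable u" "bounded_measurable v"
  shows "(\<integral>x. (u x + v x)\<^sup>2 \<partial>\<nu>) \<le> 2 * (\<integral>x. (u x)\<^sup>2 \<partial>\<nu>) + 2 * (\<integral>x. (v x)\<^sup>2 \<partial>\<nu>)"
proof -
  have "(\<integral>x. (u x + v x)\<^sup>2 \<partial>\<nu>) \<le> (\<integral>x. 2 * (u x)\<^sup>2 + 2 * (v x)\<^sup>2 \<partial>\<nu>)"
  proof (rule integral_mono)
    show "integrable \<nu> (\<lambda>x. (u x + v x)\<^sup>2)"
      using square_integrable[OF bounded_measurable_add_mult[OF assms, of 1]] by simp
    show "(u x + v x)\<^sup>2 \<le> 2 * (u x)\<^sup>2 + 2 * (v x)\<^sup>2" for x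
      using zero_le_power2[of "u x - v x"] by (simp add: power2_eq_square algebra_simps)
  qed (use square_integrable assms in auto)
  thus ?thesis using square_integrable assms by simp
qed

lemma approximable_ridge_sum: "ridge_sum d \<phi> L g \<Longrightarrow> approximable g"
  unfolding approximable_def using ridge_sum_bounded_measurable by (auto intro!: exI[of _ g])

lemma approximable_limit:
  assumes "bounded_measurable h" "\<And>\<epsilon>. \<epsilon> > 0 \<Longrightarrow> \<exists>h'. approximable h' \<and> (\<integral>x. (h x - h' x)\<^sup>2 \<partial>\<nu>) \<le> \<epsilon>"
  shows "approximable h"
  unfolding approximable_def
proof (intro conjI allI impI)
  fix \<epsilon> :: real assume "\<epsilon> > 0"
  hence e: "\<epsilon> / 4 > 0" by simp
  obtain h' where h': "approximable h'" "(\<integral>x. (h x - h' x)\<^sup>2 \<partial>\<nu>) \<le> \<epsilon> / 4" using assms(2)[OF e] by blast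
  obtain L g where g: "ridge_sum d \<phi> L g" "(\<integral>x. (h' x - g x)\<^sup>2 \<partial>\<nu>) \<le> \<epsilon> / 4"
    using h'(1) e unfolding approximable_def by blast
  have "bounded_measurable h'" using h' by (simp add: approximable_def)
  from integral_square_add[OF bounded_measurable_diff[OF assms(1) this]
      bounded_measurable_diff[OF this ridge_sum_bounded_measurable[OF g(1)]]]
  have "(\<integral>x. (h x - g x)\<^sup>2 \<partial>\<nu>) \<le> \<epsilon>" using h'(2) g(2) by simp
  thus "\<exists>L g. ridge_sum d \<phi> L g \<and> (\<integral>x. (h x - g x)\<^sup>2 \<partial>\<nu>) \<le> \<epsilon>" using g(1) by blast
qed fact

lemma approximable_add_mult:
  assumes "approximable h" "approximable h'"
  shows "approximable (\<lambda>x. h x + c * h' x)"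
  unfolding approximable_def
proof (intro conjI allI impI)
  have bm: "bounded_measurable h" "bounded_measurable h'" using assms by (auto simp: approximable_def)
  thus "bounded_measurable (\<lambda>x. h x + c * h' x)" by (rule bounded_measurable_add_mult)
  fix \<epsilon> :: real assume "\<epsilon> > 0"
  hence e: "\<epsilon> / 4 > 0" "\<epsilon> / (4 * (c\<^sup>2 + 1)) > 0" by (auto intro!: divide_pos_pos add_nonneg_pos)
  obtain L g where g: "ridge_sum d \<phi> L g" "(\<integral>x. (h x - g x)\<^sup>2 \<partial>\<nu>) \<le> \<epsilon> / 4"
    using assms(1) e unfolding approximable_def by blast
  obtain L' g' where g': "ridge_sum d \<phi> L' g'" "(\<integral>x. (h' x - g' x)\<^sup>2 \<partial>\<nu>) \<le> \<epsilon> / (4 * (c\<^sup>2 + 1))"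
    using assms(2) e unfolding approximable_def by blast
  let ?u = "\<lambda>x. h x - g x" and ?v = "\<lambda>x. h' x - g' x"
  have bu: "bounded_measurable ?u" "bounded_measurable ?v"
    using bm ridge_sum_bounded_measurable g(1) g'(1) by (auto intro: bounded_measurable_diff)
  have bz: "bounded_measurable (\<lambda>x. c * ?v x)"
    using bounded_measurable_add_mult[OF ridge_sum_bounded_measurable[OF ridge_sum.zero] bu(2), of c] by simp
  have "(\<integral>x. (c * ?v x)\<^sup>2 \<partial>\<nu>) = c\<^sup>2 * (\<integral>x. (?v x)\<^sup>2 \<partial>\<nu>)" by (simp add: power_mult_distrib)
  also have "\<dots> \<le> (c\<^sup>2 + 1) * (\<epsilon> / (4 * (c\<^sup>2 + 1)))" using g'(2) by (intro mult_mono) auto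
  also have "\<dots> = \<epsilon> / 4"
  proof -
    have "c\<^sup>2 + 1 \<noteq> 0" using zero_le_power2[of c] by linarith
    moreover have "q * (\<epsilon> / (4 * q)) = \<epsilon> / 4" if "q \<noteq> 0" for q using that by simp
    ultimately show ?thesis by blast
  qed
  finally have "(\<integral>x. (c * ?v x)\<^sup>2 \<partial>\<nu>) \<le> \<epsilon> / 4" .
  with integral_square_add[OF bu(1) bz] g(2)
  have "(\<integral>x. (?u x + c * ?v x)\<^sup>2 \<partial>\<nu>) \<le> \<epsilon>" by linarith
  also have "(\<lambda>x. (?u x + c * ?v x)\<^sup>2) = (\<lambda>x. (h x + c * h' x - (g x + c * g' x))\<^sup>2)"
    by (simp add: algebra_simps)
  finally show "\<exists>L g. ridge_sum d \<phi> L g \<and> (\<integral>x. (h x + c * h' x - g x)\<^sup>2 \<partial>\<nu>) \<le> \<epsilon>"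
    using ridge_sum_plus[OF ridge_sum_scale[OF g'(1), of c] g(1)] by blast
qed

lemma approximable_mult: "approximable h \<Longrightarrow> approximable (\<lambda>x. c * h x)"
  using approximable_add_mult[OF approximable_ridge_sum[OF ridge_sum.zero]] by simp

lemma approximable_uniform_limit:
  assumes "h \<in> borel_measurable \<nu>"
    and lim: "\<And>\<epsilon>. \<epsilon> > 0 \<Longrightarrow> \<exists>h'. approximable h' \<and> (\<forall>x\<in>cube d. \<bar>h x - h' x\<bar> \<le> \<epsilon>)"
  shows "approximable h"
proof -
  obtain h1 where h1: "approximable h1" "\<forall>x\<in>cube d. \<bar>h x - h1 x\<bar> \<le> 1" using lim[of 1] by auto
  obtain B where B: "\<forall>x\<in>cube d. \<bar>h1 x\<bar> \<le> B" using h1(1) by (auto simp: approximable_def bounded_measurable_def)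
  have "\<bar>h x\<bar> \<le> B + 1" if "x \<in> cube d" for x
    using B[rule_format, OF that] h1(2)[rule_format, OF that] by linarith
  hence bm: "bounded_measurable h" using assms(1) by (auto simp: bounded_measurable_def)
  show ?thesis
  proof (rule approximable_limit[OF bm])
    fix \<epsilon> :: real assume \<epsilon>: "\<epsilon> > 0"
    then obtain h' where h': "approximable h'" "\<forall>x\<in>cube d. \<bar>h x - h' x\<bar> \<le> sqrt \<epsilon>"
      using lim[of "sqrt \<epsilon>"] by auto
    have "bounded_measurable (\<lambda>x. h x - h' x)"
      using bm h'(1) by (auto simp: approximable_def intro: bounded_measurable_diff)
    hence "(\<integral>x. (h x - h' x)\<^sup>2 \<partial>\<nu>) \<le> \<epsilon>"
    proof (intro integral_le_const square_integrable AE_I2)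
      fix x assume "x \<in> space \<nu>"
      hence "\<bar>h x - h' x\<bar>\<^sup>2 \<le> (sqrt \<epsilon>)\<^sup>2" using h'(2) by (intro power_mono) (auto simp: space_law)
      thus "(h x - h' x)\<^sup>2 \<le> \<epsilon>" using \<epsilon> by simp
    qed
    thus "\<exists>h'. approximable h' \<and> (\<integral>x. (h x - h' x)\<^sup>2 \<partial>\<nu>) \<le> \<epsilon>" using h'(1) by blast
  qed
qed

lemma approximable_nn_star:
  assumes "approximable h" "\<epsilon> > 0"
  shows "\<exists>K. \<exists>g. (\<forall>k\<ge>K. g \<in> nn_star d k \<phi>) \<and> (\<integral>x. (h x - g x)\<^sup>2 \<partial>\<nu>) \<le> \<epsilon>"
proof -
  obtain L g where "ridge_sum d \<phi> L g" "(\<integral>x. (h x - g x)\<^sup>2 \<partial>\<nu>) \<le> \<epsilon>"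
    using assms unfolding approximable_def by blast
  thus ?thesis using eventually_bias_free_nn_star[OF ridge_sum_eventually_bias_free] by blast
qed

end

section \<open>Density of ridge sums in the continuous functions\<close>

text \<open>Because of \<open>\<sigma>' = \<sigma> (1 - \<sigma>)\<close>, every derivative of the sigmoid
is a polynomial in the sigmoid.\<close>

fun sigmoid_poly :: "nat \<Rightarrow> real poly" where
  "sigmoid_poly 0 = [:0, 1:]"
| "sigmoid_poly (Suc m) = pderiv (sigmoid_poly m) * [:0, 1, -1:]"

definition sigmoid_deriv :: "nat \<Rightarrow> real \<Rightarrow> real" where
  "sigmoid_deriv m z = poly (sigmoid_poly m) (sigmoid_act z)"

lemma sigmoid_deriv_0: "sigmoid_deriv 0 = sigmoid_act"
  by (simp add: sigmoid_deriv_def fun_eq_iff)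

lemma sigmoid_deriv_has_derivative:
  "(sigmoid_deriv m has_real_derivative sigmoid_deriv (Suc m) z) (at z)"
proof -
  have "((\<lambda>z. poly (sigmoid_poly m) (sigmoid_act z)) has_real_derivative
      poly (pderiv (sigmoid_poly m)) (sigmoid_act z) * (sigmoid_act z * (1 - sigmoid_act z))) (at z)"
    by (rule DERIV_chain2[OF poly_DERIV sigmoid_has_derivative])
  thus ?thesis
    by (simp add: sigmoid_deriv_def[abs_def] algebra_simps)
qed

lemma sigmoid_deriv_bounded: "\<exists>B\<ge>0. \<forall>z. \<bar>sigmoid_deriv m z\<bar> \<le> B"
proof -
  have "compact (poly (sigmoid_poly m) ` {0..1})"
    by (intro compact_continuous_image continuous_intros compact_Icc)
  then obtain B where B: "\<forall>y\<in>poly (sigmoid_poly m) ` {0..1}. norm y \<le> B"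
    using compact_imp_bounded bounded_iff by blast
  have "\<bar>sigmoid_deriv m z\<bar> \<le> B" for z
    using B sigmoid_range[of z] by (auto simp: sigmoid_deriv_def)
  thus ?thesis by (meson abs_ge_zero order.trans)
qed

lemma degree_sigmoid_poly: "degree (sigmoid_poly m) = Suc m"
proof (induction m)
  case (Suc m)
  have nz: "pderiv (sigmoid_poly m) \<noteq> 0" using Suc by (simp add: pderiv_eq_0_iff)
  have "degree (sigmoid_poly (Suc m)) = degree (pderiv (sigmoid_poly m)) + degree [:0, 1, -1::real:]"
    unfolding sigmoid_poly.simps using nz by (intro degree_mult_eq) auto
  thus ?case using Suc by (simp add: degree_pderiv)
qed simp

lemma inj_sigmoid: "inj sigmoid_act"
  by (rule injI) (simp add: sigmoid_act_def)

text \<open>A nonzero polynomial cannot vanish on the infinitely many values of the sigmoid over an interval.\<close>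

lemma sigmoid_deriv_nonzero: "\<exists>b. \<bar>b\<bar> < 1 \<and> sigmoid_deriv m b \<noteq> 0"
proof (rule ccontr)
  assume "\<not> ?thesis"
  hence "sigmoid_act ` {-1<..<1} \<subseteq> {y. poly (sigmoid_poly m) y = 0}"
    by (auto simp: sigmoid_deriv_def abs_less_iff)
  moreover have "finite {y. poly (sigmoid_poly m) y = 0}"
    using degree_sigmoid_poly[of m] by (intro poly_roots_finite) auto
  ultimately have "finite (sigmoid_act ` {-1<..<1})" by (rule finite_subset)
  hence "finite {-1<..<1::real}" by (rule finite_imageD[OF _ inj_on_subset[OF inj_sigmoid subset_UNIV]])
  thus False using infinite_Ioo[of "-1::real" 1] by simp
qed

lemma sigmoid_deriv_taylor:
  assumes B: "\<forall>z. \<bar>sigmoid_deriv (Suc (Suc m)) z\<bar> \<le> B"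
  shows "\<bar>sigmoid_deriv m (z + u) - sigmoid_deriv m z - u * sigmoid_deriv (Suc m) z\<bar> \<le> B * u\<^sup>2"
proof -
  let ?q = "sigmoid_deriv m" and ?q' = "sigmoid_deriv (Suc m)"
  have lip: "\<bar>?q' x - ?q' y\<bar> \<le> B * \<bar>x - y\<bar>" for x y
    using field_differentiable_bound[of UNIV ?q' "sigmoid_deriv (Suc (Suc m))" B x y]
      sigmoid_deriv_has_derivative[of "Suc m"] B by simp
  have "norm ((?q (z + u) - u * ?q' z) - (?q (z + 0) - 0 * ?q' z)) \<le> (B * \<bar>u\<bar>) * norm (u - 0)"
  proof (rule field_differentiable_bound[of "{v. \<bar>v\<bar> \<le> \<bar>u\<bar>}" "\<lambda>v. ?q (z + v) - v * ?q' z" "\<lambda>v. ?q' (z + v) - ?q' z"])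
    have "{v. \<bar>v\<bar> \<le> \<bar>u\<bar>} = {- \<bar>u\<bar>..\<bar>u\<bar>}" by auto
    thus "convex {v. \<bar>v\<bar> \<le> \<bar>u\<bar>}" by simp
    fix v assume v: "v \<in> {v. \<bar>v\<bar> \<le> \<bar>u\<bar>}"
    have "((\<lambda>v. ?q (z + v)) has_real_derivative ?q' (z + v)) (at v)"
      using sigmoid_deriv_has_derivative[of m "z + v"] by (simp add: DERIV_shift add.commute)
    from DERIV_diff[OF this DERIV_cmult_right[OF DERIV_ident, of "?q' z" v]]
    show "((\<lambda>v. ?q (z + v) - v * ?q' z) has_field_derivative ?q' (z + v) - ?q' z) (at v within {v. \<bar>v\<bar> \<le> \<bar>u\<bar>})"
      by (rule DERIV_subset[THEN DERIV_cong, OF _ subset_UNIV]) simp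
    have "B \<ge> 0" using B by (meson abs_ge_zero order.trans)
    thus "norm (?q' (z + v) - ?q' z) \<le> B * \<bar>u\<bar>"
      unfolding real_norm_def using v by (intro order.trans[OF lip] mult_left_mono) auto
  qed auto
  thus ?thesis by (simp add: power2_eq_square abs_mult[symmetric] mult.assoc algebra_simps)
qed

inductive coordinate_polynomial :: "nat \<Rightarrow> (point \<Rightarrow> real) \<Rightarrow> bool" for d where
  const: "coordinate_polynomial d (\<lambda>_. c)"
| coordinate: "i < d \<Longrightarrow> coordinate_polynomial d p \<Longrightarrow> coordinate_polynomial d (\<lambda>x. x i * p x)"
| add: "coordinate_polynomial d p \<Longrightarrow> coordinate_polynomial d q \<Longrightarrow> coordinate_polynomial d (\<lambda>x. p x + q x)"

lemma coordinate_polynomial_scale: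
  "coordinate_polynomial d q \<Longrightarrow> coordinate_polynomial d (\<lambda>x. c * q x)"
proof (induction rule: coordinate_polynomial.induct)
  case (const c')
  show ?case using coordinate_polynomial.const[of d "c * c'"] by simp
next
  case (coordinate i p)
  thus ?case using coordinate_polynomial.coordinate[of i d "\<lambda>x. c * p x"] by (simp add: mult.left_commute)
next
  case (add p q)
  thus ?case using coordinate_polynomial.add[of d "\<lambda>x. c * p x" "\<lambda>x. c * q x"] by (simp add: distrib_left)
qed

lemma coordinate_polynomial_mult:
  assumes "coordinate_polynomial d p" "coordinate_polynomial d q"
  shows "coordinate_polynomial d (\<lambda>x. p x * q x)"
  using assms(1)
proof induction
  case (const c)
  show ?case using coordinate_polynomial_scale[OF assms(2)] .
next
  case (coordinate i p)
  thus ?case using coordinate_polynomial.coordinate[of i d "\<lambda>x. p x * q x"] by (simp add: mult.assoc)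
next
  case (add p p')
  thus ?case using coordinate_polynomial.add[of d "\<lambda>x. p x * q x" "\<lambda>x. p' x * q x"] by (simp add: distrib_right)
qed

lemma coordinate_polynomial_continuous:
  "coordinate_polynomial d p \<Longrightarrow> continuous_on A p"
  by (induction rule: coordinate_polynomial.induct)
     (auto intro!: continuous_intros continuous_on_product_coordinates intro: continuous_on_subset)

lemma compact_cube: "compact (cube d)"
proof -
  have "cube d = PiE UNIV (\<lambda>i. if i < d then {0..1} else {0})"
    by (auto simp: cube_def topspace_Euclidean_space PiE_iff split: if_splits)
  moreover have "compactin (powertop_real UNIV) (PiE UNIV (\<lambda>i::nat. if i < d then {0..1} else {0}))"
    unfolding compactin_PiE by auto
  ultimately show ?thesis by (simp add: euclidean_product_topology)
qed

lemma polynomials_dense_on_cube: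
  assumes "continuous_on (cube d) f" "\<epsilon> > 0"
  shows "\<exists>p. coordinate_polynomial d p \<and> (\<forall>x\<in>cube d. \<bar>f x - p x\<bar> < \<epsilon>)"
proof (rule Stone_Weierstrass_HOL[OF compact_cube _ _ _ _ _ assms])
  fix x y assume xy: "x \<in> cube d \<and> y \<in> cube d \<and> x \<noteq> y"
  then obtain i where i: "x i \<noteq> y i" by (auto simp: fun_eq_iff)
  hence "i < d" using xy by (auto simp: cube_def topspace_Euclidean_space not_less)
  thus "\<exists>p. coordinate_polynomial d p \<and> p x \<noteq> p y"
    using coordinate_polynomial.coordinate[OF _ coordinate_polynomial.const[of d 1]] i
    by (intro exI[of _ "\<lambda>x. x i * 1"]) auto
qed (auto intro: coordinate_polynomial.intros coordinate_polynomial_mult coordinate_polynomial_continuous)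

locale sigmoid_closure = ridge_closure sigmoid_act \<nu> d for \<nu> d
begin

lemma coordinate_le: "i < d \<Longrightarrow> x \<in> cube d \<Longrightarrow> \<bar>x i\<bar> \<le> 1"
  by (auto simp: cube_def abs_le_iff intro: order.trans)

lemma monomial_bound: "set is \<subseteq> {..<d} \<Longrightarrow> x \<in> cube d \<Longrightarrow> \<bar>prod_list (map x is)\<bar> \<le> 1"
proof (induction "is")
  case (Cons i "is")
  thus ?case using coordinate_le[of i x] by (auto simp: abs_mult intro!: mult_le_one)
qed simp

lemma dot_fun_upd: "i < d \<Longrightarrow> dot d (w(i := w i + t)) x = dot d w x + t * x i"
  by (simp add: dot_def sum.remove[of "{..<d}" i] algebra_simps)

lemma l1_norm_fun_upd: "l1_norm d (w(i := w i + t)) \<le> l1_norm d w + \<bar>t\<bar>"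
proof (cases "i < d")
  case True
  thus ?thesis by (simp add: l1_norm_def sum.remove[of "{..<d}" i])
next
  case False
  hence "l1_norm d (w(i := w i + t)) = l1_norm d w" unfolding l1_norm_def by (intro sum.cong) auto
  thus ?thesis by simp
qed

lemma law_measurable:
  "f \<in> borel_measurable borel \<Longrightarrow> f \<in> borel_measurable \<nu>"
  by (rule borel_prob_onD(3)[OF law])

lemma sigmoid_deriv_measurable: "sigmoid_deriv m \<in> borel_measurable borel"
  by (intro borel_measurable_continuous_onI DERIV_continuous_on[where D="sigmoid_deriv (Suc m)"])
     (use sigmoid_deriv_has_derivative DERIV_subset in blast)

lemma monomial_measurable: "(\<lambda>x. prod_list (map x is)) \<in> borel_measurable (borel :: point measure)"
  by (induction "is") auto

text \<open>Differentiating \<open>\<sigma> (w \<bullet> x + b)\<close> with respect to the coordinate \<open>i\<close>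
of \<open>w\<close> multiplies by \<open>x i\<close> and differentiates the activation once more.  The difference
quotients are combinations of approximable functions and converge uniformly on the cube.  The strict
inequality for the norm of \<open>w\<close> leaves room for the increments.\<close>

lemma approximable_monomial_ridge:
  assumes "set is \<subseteq> {..<d}" "l1_norm d w < 1" "\<bar>b\<bar> < 1"
  shows "approximable (\<lambda>x. prod_list (map x is) * sigmoid_deriv (length is) (dot d w x + b))"
  using assms
proof (induction "is" arbitrary: w b)
  case Nil
  have "ridge_sum d sigmoid_act \<bar>1\<bar> (\<lambda>x. 1 * sigmoid_act (dot d w x + b))"
    using Nil by (intro ridge_sum_atom) auto
  thus ?case using approximable_ridge_sum by (simp add: sigmoid_deriv_0)
next
  case (Cons i "is")
  let ?m = "length is" and ?\<pi> = "\<lambda>x. prod_list (map x is)"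
  have i: "i < d" "set is \<subseteq> {..<d}" using Cons.prems by auto
  obtain B where B: "B \<ge> 0" "\<forall>z. \<bar>sigmoid_deriv (Suc (Suc ?m)) z\<bar> \<le> B" using sigmoid_deriv_bounded by blast
  show ?case
  proof (rule approximable_uniform_limit)
    have "(\<lambda>x. prod_list (map x (i # is)) * sigmoid_deriv (length (i # is)) (dot d w x + b)) \<in> borel_measurable borel"
      by (intro borel_measurable_times monomial_measurable
          measurable_compose[OF _ sigmoid_deriv_measurable]) measurable
    thus "(\<lambda>x. prod_list (map x (i # is)) * sigmoid_deriv (length (i # is)) (dot d w x + b)) \<in> borel_measurable \<nu>"
      by (rule law_measurable)
    fix \<epsilon> :: real assume \<epsilon>: "\<epsilon> > 0"
    \<comment> \<open>The step keeps the weight admissible and makes the Taylor error \<open>B t\<close> at most \<open>\<epsilon>\<close>.\<close>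
    define t where "t = min ((1 - l1_norm d w) / 2) (\<epsilon> / (B + 1))"
    have "t > 0" using \<epsilon> B(1) Cons.prems(2) by (simp add: t_def)
    moreover have "t \<le> (1 - l1_norm d w) / 2" "t \<le> \<epsilon> / (B + 1)"
      unfolding t_def by (rule min.cobounded1, rule min.cobounded2)
    ultimately have t: "t > 0" "t \<le> \<epsilon> / (B + 1)" "l1_norm d w + \<bar>t\<bar> < 1"
      using Cons.prems(2) by auto
    let ?w = "w(i := w i + t)"
    have w': "l1_norm d ?w < 1" using l1_norm_fun_upd[of w i t] t(3) by linarith
    define h' where "h' x = (1 / t) * (?\<pi> x * sigmoid_deriv ?m (dot d ?w x + b)
        + (-1) * (?\<pi> x * sigmoid_deriv ?m (dot d w x + b)))" for x
    have "approximable h'"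
      unfolding h'_def[abs_def] using Cons.IH[OF i(2)] w' Cons.prems
      by (intro approximable_mult approximable_add_mult) auto
    moreover have "\<bar>prod_list (map x (i # is)) * sigmoid_deriv (length (i # is)) (dot d w x + b) - h' x\<bar> \<le> \<epsilon>"
      if x: "x \<in> cube d" for x
    proof -
      define z where "z = dot d w x + b"
      have shift: "dot d ?w x + b = z + t * x i" by (simp add: dot_fun_upd[OF i(1)] z_def)
      define R where "R = sigmoid_deriv ?m (z + t * x i) - sigmoid_deriv ?m z - (t * x i) * sigmoid_deriv (Suc ?m) z"
      have "\<bar>R\<bar> \<le> B * (t * x i)\<^sup>2" unfolding R_def by (rule sigmoid_deriv_taylor[OF B(2)])
      also have "\<dots> \<le> B * t\<^sup>2"
        using B(1) coordinate_le[OF i(1) x]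
        by (auto simp: power_mult_distrib abs_square_le_1 intro!: mult_left_mono mult_left_le)
      finally have R: "\<bar>R\<bar> \<le> B * t\<^sup>2" .
      have "prod_list (map x (i # is)) * sigmoid_deriv (length (i # is)) (dot d w x + b) - h' x = - (?\<pi> x * (R / t))"
        unfolding h'_def shift z_def[symmetric] R_def using t(1) by (simp add: field_simps)
      also have "\<bar>\<dots>\<bar> = \<bar>?\<pi> x\<bar> * (\<bar>R\<bar> / t)" using t(1) by (simp add: abs_mult)
      also have "\<dots> \<le> 1 * (B * t\<^sup>2 / t)"
        using monomial_bound[OF i(2) x] R t(1) by (intro mult_mono divide_right_mono) auto
      also have "\<dots> = B * t" using t(1) by (simp add: power2_eq_square)
      also have "\<dots> \<le> (B + 1) * (\<epsilon> / (B + 1))" using B(1) t by (intro mult_mono) auto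
      also have "\<dots> = \<epsilon>" using B(1) by simp
      finally show ?thesis .
    qed
    ultimately show "\<exists>h'. approximable h' \<and> (\<forall>x\<in>cube d. \<bar>prod_list (map x (i # is)) * sigmoid_deriv (length (i # is)) (dot d w x + b) - h' x\<bar> \<le> \<epsilon>)"
      by blast
  qed
qed

text \<open>At weight 0 the derivative of the activation is a constant factor, which can be divided out for a
suitable bias.\<close>

lemma approximable_monomial:
  assumes "set is \<subseteq> {..<d}"
  shows "approximable (\<lambda>x. prod_list (map x is))"
proof -
  obtain b where b: "\<bar>b\<bar> < 1" "sigmoid_deriv (length is) b \<noteq> 0" using sigmoid_deriv_nonzero by blast
  have "approximable (\<lambda>x. prod_list (map x is) * sigmoid_deriv (length is) (dot d (\<lambda>_. 0) x + b))"
    using assms b by (intro approximable_monomial_ridge) (auto simp: l1_norm_def)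
  from approximable_mult[OF this, of "1 / sigmoid_deriv (length is) b"] b(2)
  show ?thesis by (simp add: dot_def)
qed

lemma approximable_polynomial:
  assumes "coordinate_polynomial d p"
  shows "approximable p"
proof -
  have "approximable (\<lambda>x. prod_list (map x is) * p x)" if "set is \<subseteq> {..<d}" for "is"
    using assms that
  proof (induction arbitrary: "is")
    case (const c)
    from approximable_mult[OF approximable_monomial[OF const], of c] show ?case by (simp add: mult.commute)
  next
    case (coordinate i p)
    from coordinate.IH[of "is @ [i]"] coordinate show ?case by (simp add: mult.assoc)
  next
    case (add p q)
    from approximable_add_mult[OF add.IH, of "is" "is" 1] add.prems show ?case by (simp add: distrib_left)
  qed
  from this[of "[]"] show ?thesis by simp
qed

theorem approximable_continuous_sigmoid:
  assumes "continuous_on (cube d) f" "f \<in> borel_measurable \<nu>"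
  shows "approximable f"
proof (rule approximable_uniform_limit[OF assms(2)])
  fix \<epsilon> :: real assume "\<epsilon> > 0"
  from polynomials_dense_on_cube[OF assms(1) this]
  show "\<exists>h'. approximable h' \<and> (\<forall>x\<in>cube d. \<bar>f x - h' x\<bar> \<le> \<epsilon>)"
    using approximable_polynomial less_imp_le by blast
qed

end

locale relu_closure = ridge_closure relu \<nu> d for \<nu> d
begin

text \<open>By Taylor's formula a smooth ridge function is an affine function plus an average of kinks in the same
direction, to which Maurey's argument applies.\<close>

lemma approximable_smooth_ridge:
  fixes p p' r :: "real \<Rightarrow> real"
  assumes p: "\<And>t. (p has_real_derivative p' t) (at t)" and p': "\<And>t. (p' has_real_derivative r t) (at t)"
    and r: "continuous_on UNIV r" "\<And>t. \<bar>r t\<bar> \<le> B" and w: "l1_norm d w \<le> 1"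
  shows "approximable (\<lambda>x. p (dot d w x))"
proof -
  have [measurable]: "r \<in> borel_measurable borel" using r(1) by (rule borel_measurable_continuous_onI)
  define a where "a t x = 2 * r t * kink t (dot d w x)" for t x
  define T where "T x = (\<integral>t. a t x \<partial>symmetric_uniform)" for x
  have s: "\<bar>dot d w x\<bar> \<le> 1" if "x \<in> cube d" for x using dot_le_l1_norm[OF that, of w] w by linarith
  have dot\<nu> [measurable]: "(\<lambda>x. dot d w x) \<in> borel_measurable \<nu>" by (intro borel_prob_onD(3)[OF law]) measurable
  have T: "T x = p (dot d w x) - p 0 - p' 0 * dot d w x" if "x \<in> cube d" for x
    unfolding T_def a_def by (rule taylor_kink[OF p p' r(1) s[OF that]])
  have a_meas: "(\<lambda>(t, x). a t x) \<in> borel_measurable (symmetric_uniform \<Otimes>\<^sub>M \<nu>)"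
    unfolding a_def case_prod_unfold by measurable
  have a_bound: "\<bar>a t x\<bar> \<le> 2 * B" if "x \<in> space \<nu>" for t x
  proof -
    have "\<bar>r t\<bar> * \<bar>kink t (dot d w x)\<bar> \<le> B * 1"
      using kink_bounds[OF s, of x t] that r(2)[of t] by (intro mult_mono) (auto simp: space_law intro: order.trans[OF abs_ge_zero])
    thus ?thesis by (simp add: a_def abs_mult)
  qed
  define T' where "T' x = p (dot d w x) - p 0 - p' 0 * dot d w x" for x
  have pm: "p \<in> borel_measurable borel"
    by (intro borel_measurable_continuous_onI DERIV_continuous_on[where D=p']) (use p DERIV_subset in blast)
  have [measurable]: "(\<lambda>x. p (dot d w x)) \<in> borel_measurable \<nu>" by (rule measurable_compose[OF dot\<nu> pm])
  have T'_meas: "T' \<in> borel_measurable \<nu>" unfolding T'_def by measurable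
  have "approximable T'"
  proof (rule approximable_limit)
    have "\<bar>T' x\<bar> \<le> 2 * B" if "x \<in> cube d" for x
    proof -
      interpret U: prob_space symmetric_uniform by (rule prob_symmetric_uniform)
      have [measurable]: "(\<lambda>t. a t x) \<in> borel_measurable symmetric_uniform"
        using measurable_compose[OF measurable_Pair2'[of x \<nu>] a_meas] that by (simp add: space_law)
      have i: "integrable symmetric_uniform (\<lambda>t. a t x)"
        by (rule integrable_bounded[OF U.finite_measure_axioms _ a_bound]) (use that in \<open>auto simp: space_law\<close>)
      have "\<bar>\<integral>t. a t x \<partial>symmetric_uniform\<bar> \<le> (\<integral>t. \<bar>a t x\<bar> \<partial>symmetric_uniform)" by (rule integral_abs_bound)
      also have "\<dots> \<le> 2 * B" using i a_bound that by (intro U.integral_le_const AE_I2) (auto simp: space_law)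
      finally show ?thesis using T[OF that] by (simp add: T_def T'_def)
    qed
    thus "bounded_measurable T'" using T'_meas by (auto simp: bounded_measurable_def)
    fix \<epsilon> :: real assume \<epsilon>: "\<epsilon> > 0"
    obtain k :: nat where k: "(2 * B)\<^sup>2 / \<epsilon> < real k" "k > 0"
      using reals_Archimedean2[of "max 1 ((2 * B)\<^sup>2 / \<epsilon>)"] by (auto simp: max_less_iff_conj)
    obtain t where t: "(\<integral>x. ((\<Sum>i<k. a (t i) x) - real k * T x)\<^sup>2 \<partial>\<nu>) \<le> real k * (2 * B)\<^sup>2"
      using maurey[OF prob_symmetric_uniform prob_space_axioms a_meas a_bound, of k] unfolding T_def by blast
    define g where "g x = (\<Sum>i<k. (2 * r (t i) / real k) * relu (dot d (\<lambda>j. sgn (t i) * w j) x + - min \<bar>t i\<bar> 1))" for x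
    have "ridge_sum d relu (\<Sum>i<k. \<bar>2 * r (t i) / real k\<bar>) g"
      unfolding g_def[abs_def] using order.trans[OF l1_norm_sgn w] by (intro ridge_sum_sum) auto
    moreover have "(\<integral>x. (T' x - g x)\<^sup>2 \<partial>\<nu>) = (\<integral>x. ((\<Sum>i<k. a (t i) x) - real k * T x)\<^sup>2 / (real k)\<^sup>2 \<partial>\<nu>)"
    proof (rule Bochner_Integration.integral_cong)
      fix x assume "x \<in> space \<nu>"
      hence x: "x \<in> cube d" by (simp add: space_law)
      have "g x = (\<Sum>i<k. a (t i) x) / real k"
        unfolding g_def a_def kink_eq_relu sum_divide_distrib by (intro sum.cong) simp_all
      hence "T' x - g x = - (((\<Sum>i<k. a (t i) x) - real k * T x) / real k)"
        using k(2) T[OF x, folded T'_def] by (simp add: diff_divide_distrib)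
      thus "(T' x - g x)\<^sup>2 = ((\<Sum>i<k. a (t i) x) - real k * T x)\<^sup>2 / (real k)\<^sup>2"
        by (simp add: power_divide)
    qed simp
    moreover have "\<dots> \<le> (real k * (2 * B)\<^sup>2) / (real k)\<^sup>2" using t by (simp add: divide_right_mono)
    moreover have "(real k * (2 * B)\<^sup>2) / (real k)\<^sup>2 \<le> \<epsilon>"
      using k \<epsilon> by (simp add: power2_eq_square field_simps)
    ultimately show "\<exists>h'. approximable h' \<and> (\<integral>x. (T' x - h' x)\<^sup>2 \<partial>\<nu>) \<le> \<epsilon>"
      using approximable_ridge_sum by (intro exI[of _ g]) auto
  qed
  moreover have "approximable (\<lambda>x. dot d w x)"
  proof -
    have "ridge_sum d relu \<bar>1\<bar> (\<lambda>x. 1 * relu (dot d w x + 0))" using w by (intro ridge_sum_atom) auto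
    moreover have "ridge_sum d relu \<bar>-1\<bar> (\<lambda>x. (-1) * relu (dot d (\<lambda>i. - w i) x + 0))"
      using w by (intro ridge_sum_atom) (auto simp: l1_norm_def)
    moreover have "1 * relu (dot d w x + 0) + (-1) * relu (dot d (\<lambda>i. - w i) x + 0) = dot d w x" for x
      by (auto simp: relu_def dot_def sum_negf max_def)
    ultimately show ?thesis using approximable_ridge_sum[OF ridge_sum_plus] by fastforce
  qed
  moreover have "approximable (\<lambda>_. 1)" using unit_ridge_sum approximable_ridge_sum by blast
  ultimately have "approximable (\<lambda>x. (T' x + p' 0 * dot d w x) + p 0 * 1)"
    by (intro approximable_add_mult) auto
  thus ?thesis by (simp add: T'_def)
qed

text \<open>Sigmoidal ridge functions are smooth, so whatever sigmoidal ridge sums approximate is approximated by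
rectified linear ones too.\<close>

theorem approximable_continuous_relu:
  assumes f: "continuous_on (cube d) f" "f \<in> borel_measurable \<nu>"
  shows "approximable f"
proof -
  interpret sig: sigmoid_closure \<nu> d
    by (intro sigmoid_closure.intro ridge_closure.intro activation_sigmoid prob_space_axioms ridge_closure_axioms.intro law)
  have ridge: "approximable (\<lambda>x. sigmoid_act (dot d w x + b))" if "l1_norm d w \<le> 1" for w b
  proof -
    obtain B where B: "\<forall>z. \<bar>sigmoid_deriv 2 z\<bar> \<le> B" using sigmoid_deriv_bounded by blast
    have D: "((\<lambda>t. sigmoid_deriv m (t + b)) has_real_derivative sigmoid_deriv (Suc m) (t + b)) (at t)" for m t
      using sigmoid_deriv_has_derivative[of m "t + b"] by (simp add: DERIV_shift)
    have "approximable (\<lambda>x. (\<lambda>t. sigmoid_deriv 0 (t + b)) (dot d w x))"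
    proof (rule approximable_smooth_ridge[OF D D _ _ that])
      show "continuous_on UNIV (\<lambda>t. sigmoid_deriv (Suc (Suc 0)) (t + b))"
        by (rule DERIV_continuous_on) (use D DERIV_subset in blast)
      show "\<bar>sigmoid_deriv (Suc (Suc 0)) (t + b)\<bar> \<le> B" for t using B by (simp add: numeral_2_eq_2)
    qed
    thus ?thesis by (simp add: sigmoid_deriv_0)
  qed
  have sum: "approximable g" if "ridge_sum d sigmoid_act L g" for L g
    using that
  proof induction
    case zero show ?case by (rule approximable_ridge_sum[OF ridge_sum.zero])
  next
    case (add_ridge L g w b c)
    show ?case by (rule approximable_add_mult[OF add_ridge.IH ridge[OF add_ridge.hyps(2)]])
  qed
  have "sig.approximable f" by (rule sig.approximable_continuous_sigmoid[OF f])
  thus ?thesis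
    unfolding sig.approximable_def using sum by (intro approximable_limit) blast+
qed

end

section \<open>The risk bound\<close>

lemma (in prob_space) indep_vars_reindex:
  assumes "inj_on f K" "indep_vars M' X (f ` K)"
  shows "indep_vars (\<lambda>i. M' (f i)) (\<lambda>i. X (f i)) K"
proof -
  let ?F = "\<lambda>i. {X i -` A \<inter> space M |A. A \<in> sets (M' i)}"
  have rv: "\<forall>i\<in>f ` K. random_variable (M' i) (X i)" and ind: "indep_sets ?F (f ` K)"
    using assms(2) by (auto simp: indep_vars_def2)
  have "indep_sets (\<lambda>i. ?F (f i)) K"
    unfolding indep_sets_def
  proof (intro conjI ballI allI impI)
    fix i assume "i \<in> K"
    thus "?F (f i) \<subseteq> events" using ind by (auto simp: indep_sets_def)
  next
    fix J A assume J: "J \<subseteq> K" "J \<noteq> {}" "finite J" and A: "A \<in> (\<Pi> j\<in>J. ?F (f j))"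
    have inj: "inj_on f J" using assms(1) J(1) by (rule inj_on_subset)
    define A' where "A' = (\<lambda>j. A (inv_into J f j))"
    have A'f: "A' (f j) = A j" if "j \<in> J" for j using that inj by (simp add: A'_def)
    have "A' \<in> (\<Pi> j\<in>f ` J. ?F j)" 
    proof (rule Pi_I)
      fix i assume "i \<in> f ` J"
      then obtain j where j: "j \<in> J" "i = f j" by blast
      show "A' i \<in> ?F i" unfolding j(2) A'f[OF j(1)] using A j(1) by (rule Pi_mem)
    qed
    hence "prob (\<Inter>j\<in>f ` J. A' j) = (\<Prod>j\<in>f ` J. prob (A' j))"
      using conjunct2[OF ind[unfolded indep_sets_def], rule_format, of "f ` J" A'] J
      by (simp add: image_mono)
    thus "prob (\<Inter>j\<in>J. A j) = (\<Prod>j\<in>J. prob (A j))"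
      using A'f by (simp add: prod.reindex[OF inj])
  qed
  thus ?thesis using rv by (simp add: indep_vars_def2)
qed

lemma iid_sample_PiM:
  assumes "prob_space \<mu>" "n > 0"
  shows "iid_sample (\<Pi>\<^sub>M i\<in>{..<n}. \<mu>) \<mu> (\<lambda>i x. x i) n"
proof -
  interpret P: prob_space "\<Pi>\<^sub>M i\<in>{..<n}. \<mu>" by (intro prob_space_PiM assms)
  have comp: "distr (\<Pi>\<^sub>M i\<in>{..<n}. \<mu>) \<mu> (\<lambda>x. x i) = \<mu>" if "i < n" for i
    using distr_PiM_component[of "{..<n}" "\<lambda>_. \<mu>" i] assms that by simp
  have "distr (\<Pi>\<^sub>M i\<in>{..<n}. \<mu>) (\<Pi>\<^sub>M i\<in>{..<n}. \<mu>) (\<lambda>x. \<lambda>i\<in>{..<n}. x i)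
     = distr (\<Pi>\<^sub>M i\<in>{..<n}. \<mu>) (\<Pi>\<^sub>M i\<in>{..<n}. \<mu>) (\<lambda>x. x)"
    by (intro distr_cong) (auto simp: space_PiM PiE_def extensional_restrict)
  also have "\<dots> = (\<Pi>\<^sub>M i\<in>{..<n}. \<mu>)" by (simp add: distr_id2)
  also have "\<dots> = (\<Pi>\<^sub>M i\<in>{..<n}. distr (\<Pi>\<^sub>M i\<in>{..<n}. \<mu>) \<mu> (\<lambda>x. x i))"
    by (intro PiM_cong) (auto simp: comp)
  finally have "P.indep_vars (\<lambda>_. \<mu>) (\<lambda>i x. x i) {..<n}"
    using assms(2) by (subst P.indep_vars_iff_distr_eq_PiM') auto
  thus ?thesis by unfold_locales (use comp assms in auto)
qed

lemma iid_samples_iid_sample: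
  assumes "iid_samples P \<mu> \<nu> X Y" "n > 0"
  shows "iid_sample P \<mu> X n" "iid_sample P \<nu> Y n"
proof -
  interpret prob_space P using assms by (simp add: iid_samples_def)
  have ind: "indep_vars (case_sum (\<lambda>_. \<mu>) (\<lambda>_. \<nu>)) (case_sum X Y) (UNIV :: (nat + nat) set)"
    using assms by (simp add: iid_samples_def)
  have "indep_vars (\<lambda>_. \<mu>) X {..<n}"
    using indep_vars_reindex[OF _ indep_vars_subset[OF ind], of Inl "{..<n}"] by simp
  moreover have "indep_vars (\<lambda>_. \<nu>) Y {..<n}"
    using indep_vars_reindex[OF _ indep_vars_subset[OF ind], of Inr "{..<n}"] by simp
  ultimately show "iid_sample P \<mu> X n" "iid_sample P \<nu> Y n"
    using assms by (auto simp: iid_sample_def iid_sample_axioms_def iid_samples_def)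
qed

lemma (in pair_prob_space) nn_integral_pair_marginals:
  "f \<in> borel_measurable M1 \<Longrightarrow> (\<integral>\<^sup>+z. f (fst z) \<partial>(M1 \<Otimes>\<^sub>M M2)) = (\<integral>\<^sup>+x. f x \<partial>M1)"
  "g \<in> borel_measurable M2 \<Longrightarrow> (\<integral>\<^sup>+z. g (snd z) \<partial>(M1 \<Otimes>\<^sub>M M2)) = (\<integral>\<^sup>+y. g y \<partial>M2)"
  by (subst M2.nn_integral_fst[symmetric]; simp add: M1.emeasure_space_1 M2.emeasure_space_1)+

lemma powr_three_halves: "x \<ge> 0 \<Longrightarrow> x powr (3 / 2) = x * sqrt x" for x :: real
proof -
  assume "x \<ge> 0"
  have "x powr (3 / 2) = x powr (1 + 1 / 2)" by simp
  also have "\<dots> = x powr 1 * x powr (1 / 2)" by (rule powr_add)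
  finally show ?thesis using \<open>x \<ge> 0\<close> by (simp add: powr_half_sqrt)
qed

lemma powr_minus_half: "x \<ge> 0 \<Longrightarrow> x powr (- 1 / 2) = 1 / sqrt x" for x :: real
  using powr_minus[of x "1 / 2"] by (simp add: powr_half_sqrt inverse_eq_divide)

lemma (in activation) expected_ridge_deviation:
  assumes "iid_sample P \<mu> X n" "borel_prob_on (cube d) \<mu>" "d \<ge> 1"
  shows "\<exists>W. integrable P W \<and> (\<integral>\<omega>. W \<omega> \<partial>P) \<le> 288 * (d powr (3 / 2) * n powr (- 1 / 2)) \<and>
     (\<forall>\<omega>\<in>space P. 0 \<le> W \<omega> \<and> ridge_deviation_bound d \<mu> n (\<lambda>i. X i \<omega>) (W \<omega>))"
proof -
  interpret lipschitz_family P \<mu> X n "ridge_product d \<phi>" "2 * d + 2" 2 4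
    by (rule lipschitz_family_ridge_product[OF assms(1,2)])
  obtain W where W: "integrable P W" "expectation W \<le> (3 * 4 + 12 * 2) * (real (2 * d + 2) * sqrt (real (2 * d + 2))) / sqrt n"
    "\<forall>\<omega>\<in>space P. \<forall>p. (\<forall>i<2 * d + 2. \<bar>p i\<bar> \<le> 1) \<longrightarrow> \<bar>dev p \<omega>\<bar> \<le> W \<omega>"
    using uniform_deviation by blast
  have D: "real (2 * d + 2) \<le> 4 * d" using assms(3) by simp
  have "sqrt (real (2 * d + 2)) \<le> sqrt (4 * d)" using D by (rule real_sqrt_le_mono)
  also have "\<dots> = 2 * sqrt d" by (simp add: real_sqrt_mult)
  finally have "real (2 * d + 2) * sqrt (real (2 * d + 2)) \<le> (4 * d) * (2 * sqrt d)"
    using D by (intro mult_mono) auto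
  hence "(3 * 4 + 12 * 2) * (real (2 * d + 2) * sqrt (real (2 * d + 2))) / sqrt n
      \<le> (3 * 4 + 12 * 2) * ((4 * d) * (2 * sqrt d)) / sqrt n"
    by (intro divide_right_mono mult_left_mono) auto
  also have "\<dots> = 288 * (d powr (3 / 2) * n powr (- 1 / 2))"
    unfolding powr_three_halves[OF of_nat_0_le_iff] powr_minus_half[OF of_nat_0_le_iff] by simp
  finally have "expectation W \<le> 288 * (d powr (3 / 2) * n powr (- 1 / 2))" using W(2) by linarith
  moreover have "0 \<le> W \<omega>" if "\<omega> \<in> space P" for \<omega>
    using W(3)[rule_format, OF that, of "\<lambda>_. 0"] by (auto intro: order.trans[OF abs_ge_zero])
  ultimately show ?thesis using W(1,3) unfolding ridge_deviation_bound_def by blast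
qed

lemma zero_in_nn_relu: "k \<ge> 1 \<Longrightarrow> a \<ge> 0 \<Longrightarrow> (\<lambda>_. 0) \<in> nn_relu d k a"
  using kink_network[of k d "\<lambda>_ _. 0" "\<lambda>_. 0" a 0 "\<lambda>_. 0" "\<lambda>_. 0"]
  by (simp add: l1_norm_def dot_def)

lemma nn_relu_bounded:
  assumes "g \<in> nn_relu d k a" "k \<ge> 1" "x \<in> cube d"
  shows "\<bar>g x\<bar> \<le> 10 * a"
  using nn_relu_ridge_sum[OF assms(1,2)] activation.ridge_sum_bounded[OF activation_relu _ assms(3)]
  by fastforce

lemma nn_relu_measurable: "g \<in> nn_relu d k a \<Longrightarrow> k \<ge> 1 \<Longrightarrow> g \<in> borel_measurable borel"
  using nn_relu_ridge_sum activation.ridge_sum_measurable[OF activation_relu] by blast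

lemma chi2_est_nn_relu_bounds:
  assumes "k \<ge> 1" "a \<ge> 0" "n \<ge> 1"
    and x: "\<And>i. i < n \<Longrightarrow> x i \<in> cube d" and y: "\<And>i. i < n \<Longrightarrow> y i \<in> cube d"
  shows "0 \<le> chi2_est (nn_relu d k a) n x y" "chi2_est (nn_relu d k a) n x y \<le> 20 * a"
proof -
  have est: "chi2_est (nn_relu d k a) n x y = (SUP g\<in>nn_relu d k a. sample_objective n x y g)"
    by (simp add: chi2_est_def sample_objective_def)
  have upper: "sample_objective n x y g \<le> 20 * a" if g: "g \<in> nn_relu d k a" for g
  proof -
    have "g (x i) - g (y i) - 1 / 4 * (g (y i))\<^sup>2 \<le> 20 * a" if "i < n" for i
      using nn_relu_bounded[OF g assms(1) x[OF that]] nn_relu_bounded[OF g assms(1) y[OF that]]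
        zero_le_power2[of "g (y i)"] by linarith
    hence "(\<Sum>i<n. g (x i) - g (y i) - 1 / 4 * (g (y i))\<^sup>2) \<le> (\<Sum>i<n. 20 * a)"
      by (intro sum_mono) auto
    thus ?thesis using assms(3) by (simp add: sample_objective_def field_simps)
  qed
  note z = zero_in_nn_relu[OF assms(1,2)]
  show "chi2_est (nn_relu d k a) n x y \<le> 20 * a"
    unfolding est using z upper by (intro cSUP_least) auto
  have "sample_objective n x y (\<lambda>_. 0) \<le> chi2_est (nn_relu d k a) n x y"
    unfolding est using upper by (intro cSUP_upper[OF z]) (auto intro!: bdd_aboveI2)
  thus "0 \<le> chi2_est (nn_relu d k a) n x y" by (simp add: sample_objective_def)
qed

lemma prob_space_sample_law:
  assumes "prob_space \<mu>" "prob_space \<nu>"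
  shows "pair_prob_space (\<Pi>\<^sub>M i\<in>{..<n}. \<mu>) (\<Pi>\<^sub>M i\<in>{..<n}. \<nu>)"
  using prob_space_PiM[of "{..<n}" "\<lambda>_. \<mu>"] prob_space_PiM[of "{..<n}" "\<lambda>_. \<nu>"] assms
  by (simp add: pair_prob_space_def pair_sigma_finite_def prob_space_imp_sigma_finite)

lemma sample_law_points:
  assumes "borel_prob_on S \<mu>" "borel_prob_on S \<nu>" "z \<in> space (sample_law n \<mu> \<nu>)" "i < n"
  shows "fst z i \<in> S" "snd z i \<in> S"
  using assms borel_prob_onD(2)
  by (auto simp: sample_law_def space_pair_measure space_PiM PiE_iff)

text \<open>Here the class is rich enough for the Barron approximation, and its networks are ridge sums of
weight at most \<open>5 a\<close>.\<close>

theorem risk_bound_large_network: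
  assumes d: "d \<ge> 1" and k: "k \<ge> 1" and n: "n \<ge> 1" and M: "M \<ge> 0" and a: "M + 1 \<le> a"
    and pair: "(\<mu>, \<nu>) \<in> chi2_pairs_bd d M (cube d)"
  shows "(\<integral>\<^sup>+z. ennreal \<bar>chi2_est (nn_relu d k a) n (fst z) (snd z) - enn2real (chi2 \<mu> \<nu>)\<bar> \<partial>sample_law n \<mu> \<nu>)
     \<le> ennreal (20160 * (d powr (3 / 2) * a\<^sup>2 * n powr (- 1 / 2)) + (M + 1)\<^sup>2 / k)"
proof -
  interpret relu: activation relu by (rule activation_relu)
  obtain f where chi: "(\<mu>, \<nu>) \<in> chi2_pairs (cube d)" and f: "chi2_opt \<mu> \<nu> f"
    and kb: "kb_coeff d f (cube d) \<le> ennreal M"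
    using pair by (auto simp: chi2_pairs_bd_def)
  have \<mu>: "borel_prob_on (cube d) \<mu>" and \<nu>: "borel_prob_on (cube d) \<nu>" using chi by (auto simp: chi2_pairs_def)
  have p\<mu>: "prob_space \<mu>" and p\<nu>: "prob_space \<nu>" using \<mu> \<nu> borel_prob_onD(1) by blast+
  let ?Px = "\<Pi>\<^sub>M i\<in>{..<n}. \<mu>" and ?Py = "\<Pi>\<^sub>M i\<in>{..<n}. \<nu>"
  interpret P: pair_prob_space ?Px ?Py by (rule prob_space_sample_law[OF p\<mu> p\<nu>])
  have n0: "n > 0" using n by simp
  define r where "r = 288 * (d powr (3 / 2) * n powr (- 1 / 2))"
  have r0: "r \<ge> 0" by (simp add: r_def)
  obtain Wx where Wx: "integrable ?Px Wx" "(\<integral>x. Wx x \<partial>?Px) \<le> r"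
    "\<forall>x\<in>space ?Px. 0 \<le> Wx x \<and> relu.ridge_deviation_bound d \<mu> n (\<lambda>i. x i) (Wx x)"
    using relu.expected_ridge_deviation[OF iid_sample_PiM[OF p\<mu> n0] \<mu> d] unfolding r_def by blast
  obtain Wy where Wy: "integrable ?Py Wy" "(\<integral>x. Wy x \<partial>?Py) \<le> r"
    "\<forall>x\<in>space ?Py. 0 \<le> Wy x \<and> relu.ridge_deviation_bound d \<nu> n (\<lambda>i. x i) (Wy x)"
    using relu.expected_ridge_deviation[OF iid_sample_PiM[OF p\<nu> n0] \<nu> d] unfolding r_def by blast
  note [measurable] = borel_measurable_integrable[OF Wx(1)] borel_measurable_integrable[OF Wy(1)]
  obtain q where q: "q \<in> nn_relu d k a" "(\<integral>x. (f x - q x)\<^sup>2 \<partial>\<nu>) \<le> (2 * (M + 1))\<^sup>2 / real k"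
    using kb_approximation[OF d kb M \<nu> k a] by blast
  have a1: "a \<ge> 1" using a M by simp
  define e where "e = (M + 1)\<^sup>2 / k"
  have e: "e \<ge> 0" by (simp add: e_def)
  have point: "\<bar>chi2_est (nn_relu d k a) n (fst z) (snd z) - enn2real (chi2 \<mu> \<nu>)\<bar>
      \<le> 35 * a\<^sup>2 * Wx (fst z) + (35 * a\<^sup>2 * Wy (snd z) + e)" if z: "z \<in> space (sample_law n \<mu> \<nu>)" for z
  proof -
    have zs: "fst z \<in> space ?Px" "snd z \<in> space ?Py" using z by (auto simp: sample_law_def space_pair_measure)
    have "\<bar>chi2_est (nn_relu d k a) n (fst z) (snd z) - enn2real (chi2 \<mu> \<nu>)\<bar>
       \<le> (2 * (5 * a) + (5 * a)\<^sup>2) * (Wx (fst z) + Wy (snd z)) + 1/4 * (\<integral>x. (f x - q x)\<^sup>2 \<partial>\<nu>)"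
    proof (rule estimator_error[OF chi f _ _ _ q(1)])
      fix g assume g: "g \<in> nn_relu d k a"
      show "g \<in> borel_measurable borel" by (rule nn_relu_measurable[OF g k])
      show "\<bar>g x\<bar> \<le> 10 * a" if "x \<in> cube d" for x by (rule nn_relu_bounded[OF g k that])
      obtain L where L: "L \<le> 5 * a" "ridge_sum d relu L g" using nn_relu_ridge_sum[OF g k] by blast
      show "\<bar>sample_objective n (fst z) (snd z) g - objective \<mu> \<nu> g\<bar>
         \<le> (2 * (5 * a) + (5 * a)\<^sup>2) * (Wx (fst z) + Wy (snd z))"
        using sample_law_points[OF \<mu> \<nu> z] Wx(3) Wy(3) zs L
        by (intro relu.objective_deviation[OF \<mu> \<nu>, where L'=L]) auto
    qed
    also have "\<dots> \<le> (35 * a\<^sup>2) * (Wx (fst z) + Wy (snd z)) + 1/4 * ((2 * (M + 1))\<^sup>2 / real k)"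
    proof (intro add_mono mult_right_mono mult_left_mono q(2))
      show "2 * (5 * a) + (5 * a)\<^sup>2 \<le> 35 * a\<^sup>2"
        using mult_right_mono[OF a1, of a] a1 by (simp add: power2_eq_square)
      show "0 \<le> Wx (fst z) + Wy (snd z)" using Wx(3) Wy(3) zs by (intro add_nonneg_nonneg) auto
    qed auto
    also have "1/4 * ((2 * (M + 1))\<^sup>2 / real k) = e"
      unfolding e_def power_mult_distrib by simp
    finally show ?thesis by (simp add: distrib_left)
  qed
  have pos: "0 \<le> Wx (fst z)" "0 \<le> Wy (snd z)" if "z \<in> space (sample_law n \<mu> \<nu>)" for z
    using that Wx(3) Wy(3) by (auto simp: sample_law_def space_pair_measure)
  have "(\<integral>\<^sup>+z. ennreal \<bar>chi2_est (nn_relu d k a) n (fst z) (snd z) - enn2real (chi2 \<mu> \<nu>)\<bar> \<partial>sample_law n \<mu> \<nu>)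
     \<le> (\<integral>\<^sup>+z. ennreal (35 * a\<^sup>2 * Wx (fst z)) + (ennreal (35 * a\<^sup>2 * Wy (snd z)) + ennreal e) \<partial>sample_law n \<mu> \<nu>)"
  proof (rule nn_integral_mono)
    fix z assume z: "z \<in> space (sample_law n \<mu> \<nu>)"
    have "ennreal (35 * a\<^sup>2 * Wx (fst z)) + (ennreal (35 * a\<^sup>2 * Wy (snd z)) + ennreal e)
       = ennreal (35 * a\<^sup>2 * Wx (fst z) + (35 * a\<^sup>2 * Wy (snd z) + e))"
      using pos[OF z] e by simp
    thus "ennreal \<bar>chi2_est (nn_relu d k a) n (fst z) (snd z) - enn2real (chi2 \<mu> \<nu>)\<bar>
       \<le> ennreal (35 * a\<^sup>2 * Wx (fst z)) + (ennreal (35 * a\<^sup>2 * Wy (snd z)) + ennreal e)"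
      using point[OF z] by (simp add: ennreal_leI)
  qed
  also have "\<dots> = (\<integral>\<^sup>+x. ennreal (35 * a\<^sup>2 * Wx x) \<partial>?Px) + ((\<integral>\<^sup>+y. ennreal (35 * a\<^sup>2 * Wy y) \<partial>?Py) + ennreal e)"
    unfolding sample_law_def
    by (simp add: nn_integral_add P.nn_integral_pair_marginals(1)[of "\<lambda>x. ennreal (35 * a\<^sup>2 * Wx x)"]
        P.nn_integral_pair_marginals(2)[of "\<lambda>x. ennreal (35 * a\<^sup>2 * Wy x)"] P.emeasure_space_1)
  also have "(\<integral>\<^sup>+x. ennreal (35 * a\<^sup>2 * Wx x) \<partial>?Px) = ennreal (35 * a\<^sup>2 * (\<integral>x. Wx x \<partial>?Px))"
    using Wx by (subst nn_integral_eq_integral) (auto intro!: AE_I2)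
  also have "(\<integral>\<^sup>+x. ennreal (35 * a\<^sup>2 * Wy x) \<partial>?Py) = ennreal (35 * a\<^sup>2 * (\<integral>x. Wy x \<partial>?Py))"
    using Wy by (subst nn_integral_eq_integral) (auto intro!: AE_I2)
  also have "ennreal (35 * a\<^sup>2 * (\<integral>x. Wx x \<partial>?Px)) + (ennreal (35 * a\<^sup>2 * (\<integral>x. Wy x \<partial>?Py)) + ennreal e)
     \<le> ennreal (35 * a\<^sup>2 * r) + (ennreal (35 * a\<^sup>2 * r) + ennreal e)"
    using Wx(2) Wy(2) by (intro add_mono ennreal_leI mult_left_mono order.refl) auto
  also have "\<dots> = ennreal (35 * a\<^sup>2 * r + (35 * a\<^sup>2 * r + e))"
    using e r0 by (simp add: ennreal_plus[symmetric] del: ennreal_plus)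
  also have "35 * a\<^sup>2 * r + (35 * a\<^sup>2 * r + e) = 20160 * (d powr (3 / 2) * a\<^sup>2 * n powr (- 1 / 2)) + (M + 1)\<^sup>2 / k"
    by (simp add: r_def e_def)
  finally show ?thesis .
qed

text \<open>If \<open>ln k < M + 1\<close> the class may be too small to approximate \<open>f\<close>.  Then both
the estimator and chi-square are bounded in terms of \<open>M\<close>, and \<open>k^(-1/2)\<close> is at least
\<open>exp (- (M + 1) / 2)\<close>, so a large constant suffices.\<close>

theorem risk_bound:
  assumes M: "M \<ge> (0::real)"
  shows "\<exists>C::real. \<forall>(d::nat) (k::nat) (n::nat). d \<ge> 1 \<longrightarrow> k \<ge> 1 \<longrightarrow> n \<ge> 1 \<longrightarrow>
           (SUP (\<mu>, \<nu>) \<in> chi2_pairs_bd d M (cube d).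
              \<integral>\<^sup>+ (x, y). ennreal \<bar>chi2_est (nn_relu d k (ln (real k))) n x y - enn2real (chi2 \<mu> \<nu>)\<bar>
                \<partial>sample_law n \<mu> \<nu>)
           \<le> ennreal (C * (real d * real k powr (- 1 / 2)
                + real d powr (3 / 2) * (ln (real k))\<^sup>2 * real n powr (- 1 / 2)))"
proof (intro exI allI impI)
  define E where "E = 21 * (M + 1) * exp ((M + 1) / 2)"
  define C where "C = 20160 + (M + 1)\<^sup>2 + E"
  fix d k n :: nat assume d: "d \<ge> 1" and k: "k \<ge> 1" and n: "n \<ge> 1"
  define a where "a = ln (real k)"
  have a0: "a \<ge> 0" using k by (simp add: a_def)
  have E0: "E \<ge> 0" using M by (simp add: E_def)
  define u where "u = real d * real k powr (- 1 / 2)"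
  define v where "v = real d powr (3 / 2) * a\<^sup>2 * real n powr (- 1 / 2)"
  have v0: "v \<ge> 0" by (simp add: v_def)
  have u0: "u \<ge> real k powr (- 1 / 2)" unfolding u_def using d by (simp add: mult_le_cancel_right1)
  have u1: "u \<ge> 0" by (simp add: u_def)
  have "(\<integral>\<^sup>+z. ennreal \<bar>chi2_est (nn_relu d k a) n (fst z) (snd z) - enn2real (chi2 \<mu> \<nu>)\<bar> \<partial>sample_law n \<mu> \<nu>)
      \<le> ennreal (C * (u + v))" if pair: "(\<mu>, \<nu>) \<in> chi2_pairs_bd d M (cube d)" for \<mu> \<nu>
  proof (cases "M + 1 \<le> a")
    case True
    have "sqrt (real k) \<le> real k" using k by (intro real_le_lsqrt) (auto intro: self_le_power)
    hence "1 / real k \<le> 1 / sqrt (real k)" using k by (intro divide_left_mono) auto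
    hence "1 / real k \<le> u"
      using u0 unfolding powr_minus_half[OF of_nat_0_le_iff] by (rule order.trans)
    hence "(M + 1)\<^sup>2 * (1 / real k) \<le> (M + 1)\<^sup>2 * u" by (intro mult_left_mono) auto
    hence "20160 * v + (M + 1)\<^sup>2 / k \<le> 20160 * v + (M + 1)\<^sup>2 * u" by simp
    also have "\<dots> \<le> C * v + C * u"
      using u1 v0 E0 by (intro add_mono mult_right_mono) (auto simp: C_def)
    finally have "20160 * v + (M + 1)\<^sup>2 / k \<le> C * (u + v)" by (simp add: algebra_simps)
    thus ?thesis
      using risk_bound_large_network[OF d k n M True pair] unfolding v_def
      by (meson ennreal_leI order.trans)
  next
    case False
    have chi: "(\<mu>, \<nu>) \<in> chi2_pairs (cube d)" and cM: "chi2 \<mu> \<nu> \<le> ennreal M"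
      using pair by (auto simp: chi2_pairs_bd_def)
    have \<mu>: "borel_prob_on (cube d) \<mu>" and \<nu>: "borel_prob_on (cube d) \<nu>" using chi by (auto simp: chi2_pairs_def)
    interpret P: pair_prob_space "\<Pi>\<^sub>M i\<in>{..<n}. \<mu>" "\<Pi>\<^sub>M i\<in>{..<n}. \<nu>"
      by (rule prob_space_sample_law) (use \<mu> \<nu> borel_prob_onD(1) in blast)+
    have cM': "0 \<le> enn2real (chi2 \<mu> \<nu>)" "enn2real (chi2 \<mu> \<nu>) \<le> M"
      using cM M by (auto intro: enn2real_leI)
    have "\<bar>chi2_est (nn_relu d k a) n (fst z) (snd z) - enn2real (chi2 \<mu> \<nu>)\<bar> \<le> 21 * (M + 1)"
      if z: "z \<in> space (sample_law n \<mu> \<nu>)" for z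
    proof -
      have "0 \<le> chi2_est (nn_relu d k a) n (fst z) (snd z)" "chi2_est (nn_relu d k a) n (fst z) (snd z) \<le> 20 * a"
        using chi2_est_nn_relu_bounds[OF k a0 n] sample_law_points[OF \<mu> \<nu> z] by auto
      moreover have "\<bar>s - t\<bar> \<le> 21 * (M + 1)" if "0 \<le> s" "s \<le> 20 * a" "0 \<le> t" "t \<le> M" for s t :: real
        unfolding distrib_left using that False M by linarith
      ultimately show ?thesis using cM' by blast
    qed
    moreover have "21 * (M + 1) \<le> C * (u + v)"
    proof -
      have "exp (- ((M + 1) / 2)) \<le> exp (- (a / 2))" using False by simp
      also have "\<dots> = real k powr (- 1 / 2)" using k by (simp add: powr_def a_def)
      also have "\<dots> \<le> u" by (rule u0)
      finally have "E * exp (- ((M + 1) / 2)) \<le> E * u" using E0 by (intro mult_left_mono) auto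
      moreover have "E * exp (- ((M + 1) / 2)) = 21 * (M + 1)"
        unfolding E_def mult.assoc exp_add[symmetric] by simp
      moreover have "E * u \<le> C * (u + v)" using E0 u1 v0 by (intro mult_mono) (auto simp: C_def)
      ultimately show ?thesis by simp
    qed
    ultimately have "(\<integral>\<^sup>+z. ennreal \<bar>chi2_est (nn_relu d k a) n (fst z) (snd z) - enn2real (chi2 \<mu> \<nu>)\<bar> \<partial>sample_law n \<mu> \<nu>)
       \<le> (\<integral>\<^sup>+z. ennreal (C * (u + v)) \<partial>sample_law n \<mu> \<nu>)"
      by (intro nn_integral_mono ennreal_leI) (auto intro: order.trans)
    also have "\<dots> = ennreal (C * (u + v))" by (simp add: sample_law_def P.emeasure_space_1)
    finally show ?thesis .
  qed
  thus "(SUP (\<mu>, \<nu>) \<in> chi2_pairs_bd d M (cube d).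
              \<integral>\<^sup>+ (x, y). ennreal \<bar>chi2_est (nn_relu d k (ln (real k))) n x y - enn2real (chi2 \<mu> \<nu>)\<bar>
                \<partial>sample_law n \<mu> \<nu>)
           \<le> ennreal (C * (real d * real k powr (- 1 / 2)
                + real d powr (3 / 2) * (ln (real k))\<^sup>2 * real n powr (- 1 / 2)))"
    unfolding a_def u_def v_def by (intro SUP_least) (auto simp: case_prod_unfold)
qed

section \<open>Strong consistency\<close>

text \<open>The exponent is \<open>- n^(1/10) / 32\<close>, which beats the polynomial size of the grid.\<close>

lemma net_tail_summable:
  "summable (\<lambda>n::nat. (2 * real n + 1) ^ D * (2 * exp (- (real n * (real n powr (- 9 / 20))\<^sup>2 / 32))))"
proof (rule summable_comparison_test_bigo)
  show "summable (\<lambda>n::nat. norm (real n powr (-2)))" by (simp add: summable_real_powr_iff)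
  show "(\<lambda>n::nat. (2 * real n + 1) ^ D * (2 * exp (- (real n * (real n powr (- 9 / 20))\<^sup>2 / 32))))
      \<in> O(\<lambda>n. real n powr (-2))"
    by real_asymp
qed

text \<open>The exponent \<open>9/20\<close> lies below \<open>1/2\<close>, as the tail bound requires, and above
\<open>2/5\<close>, the growth exponent of the squared number of neurons.\<close>

lemma (in activation) ridge_deviation_eventually:
  assumes P: "prob_space P" and iid: "\<And>n. n > 0 \<Longrightarrow> iid_sample P \<mu> X n" and \<mu>: "borel_prob_on (cube d) \<mu>"
  shows "AE \<omega> in P. \<forall>\<^sub>F n in sequentially.
     ridge_deviation_bound d \<mu> n (\<lambda>i. X i \<omega>) (real n powr (- 9 / 20) + 2 * (2 * real (2 * d + 2) / real n))"
proof -
  interpret prob_space P by fact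
  define Z where "Z n \<omega> = Max ((\<lambda>q. \<bar>sampling_error \<mu> n (ridge_product d \<phi> q) (\<lambda>i. X i \<omega>)\<bar>) ` grid (2 * d + 2) n)" for n \<omega>
  define A where "A n = (if n = 0 then {} else {\<omega> \<in> space P. Z n \<omega> \<ge> real n powr (- 9 / 20)})" for n
  have main: "A n \<in> sets P \<and> prob (A n) \<le> (2 * real n + 1) ^ (2 * d + 2) * (2 * exp (- (real n * (real n powr (- 9 / 20))\<^sup>2 / 32)))
     \<and> (\<forall>\<omega>\<in>space P - A n. ridge_deviation_bound d \<mu> n (\<lambda>i. X i \<omega>) (real n powr (- 9 / 20) + 2 * (2 * real (2 * d + 2) / real n)))"
    if n: "n > 0" for n
  proof -
    interpret F: lipschitz_family P \<mu> X n "ridge_product d \<phi>" "2 * d + 2" 2 4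
      by (rule lipschitz_family_ridge_product[OF iid[OF n] \<mu>])
    have Zn: "Z n = F.net_max n" by (intro ext) (simp only: Z_def F.net_max_def)
    have An: "A n = {\<omega> \<in> space P. F.net_max n \<omega> \<ge> real n powr (- 9 / 20)}" using n by (simp add: A_def Zn)
    have dev: "ridge_deviation_bound d \<mu> n (\<lambda>i. X i \<omega>) (real n powr (- 9 / 20) + 2 * (2 * real (2 * d + 2) / real n))"
      if "\<omega> \<in> space P - A n" for \<omega>
      unfolding ridge_deviation_bound_def
    proof (intro allI impI)
      fix p assume "\<forall>i<2 * d + 2. \<bar>p i\<bar> \<le> (1::real)"
      hence "\<bar>F.dev p \<omega>\<bar> \<le> F.net_max n \<omega> + 2 * (2 * real (2 * d + 2) / real n)"
        using that n by (intro F.dev_le_net_max) auto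
      moreover have "F.net_max n \<omega> < real n powr (- 9 / 20)" using that by (auto simp: An)
      ultimately show "\<bar>F.dev p \<omega>\<bar> \<le> real n powr (- 9 / 20) + 2 * (2 * real (2 * d + 2) / real n)" by linarith
    qed
    have sets: "A n \<in> sets P"
      unfolding An by (rule F.prob_net_max(2)) (use n in auto)
    have pr: "prob (A n) \<le> (2 * real n + 1) ^ (2 * d + 2) * (2 * exp (- (real n * (real n powr (- 9 / 20))\<^sup>2 / (2 * 4\<^sup>2))))"
      unfolding An by (rule F.prob_net_max(1)) (use n in auto)
    have e: "(2 * 4\<^sup>2 :: real) = 32" by simp
    show ?thesis by (intro conjI ballI dev sets pr[unfolded e])
  qed
  have "AE \<omega> in P. \<forall>\<^sub>F n in sequentially. \<omega> \<in> space P - A n"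
  proof (rule borel_cantelli_AE1)
    show "A n \<in> sets P" for n
    proof (cases "n = 0")
      case False
      thus ?thesis by (intro main[THEN conjunct1]) simp
    qed (simp add: A_def)
    show "emeasure P (A n) < \<infinity>" for n by (simp add: less_top[symmetric])
    show "summable (\<lambda>n. prob (A n))"
    proof (rule summable_comparison_test[OF _ net_tail_summable[of "2 * d + 2"]])
      show "\<exists>N. \<forall>n\<ge>N. norm (prob (A n)) \<le> (2 * real n + 1) ^ (2 * d + 2) * (2 * exp (- (real n * (real n powr (- 9 / 20))\<^sup>2 / 32)))"
        unfolding real_norm_def abs_of_nonneg[OF measure_nonneg]
        by (intro exI[of _ 1] allI impI main[THEN conjunct2, THEN conjunct1]) simp
    qed
  qed
  thus ?thesis
  proof eventually_elim
    case (elim \<omega>)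
    show ?case using elim eventually_gt_at_top[of 0] by eventually_elim (rule main[THEN conjunct2, THEN conjunct2, rule_format])
  qed
qed

lemma deviation_rate_vanishes:
  fixes k :: "nat \<Rightarrow> nat"
  assumes "0 < \<rho>" "\<rho> < 1" "(\<lambda>n. real (k n)) \<in> O(\<lambda>n. real n powr ((1 - \<rho>) / 5))"
  shows "(\<lambda>n. (2 * (real (k n) + 2) + (real (k n) + 2)\<^sup>2) *
     (2 * (real n powr (- 9 / 20) + 2 * (2 * real (2 * d + 2) / real n)))) \<longlonglongrightarrow> 0"
proof -
  obtain c where c: "c > 0" "\<forall>\<^sub>F n in sequentially. norm (real (k n)) \<le> c * norm (real n powr ((1 - \<rho>) / 5))"
    using assms(3) by (rule landau_o.bigE)
  define D where "D = real (2 * d + 2)"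
  have D: "D > 0" by (simp add: D_def)
  have lim: "(\<lambda>n::nat. (2 * (c * real n powr (1 / 5) + 2) + (c * real n powr (1 / 5) + 2)\<^sup>2) *
     (2 * (real n powr (- 9 / 20) + 2 * (2 * D / real n)))) \<longlonglongrightarrow> 0"
    using c(1) D by real_asymp
  have le: "\<forall>\<^sub>F n in sequentially. (2 * (real (k n) + 2) + (real (k n) + 2)\<^sup>2) *
     (2 * (real n powr (- 9 / 20) + 2 * (2 * D / real n)))
     \<le> (2 * (c * real n powr (1 / 5) + 2) + (c * real n powr (1 / 5) + 2)\<^sup>2) *
     (2 * (real n powr (- 9 / 20) + 2 * (2 * D / real n)))"
    using c(2) eventually_gt_at_top[of 0]
  proof eventually_elim
    case (elim n)
    have "real n powr ((1 - \<rho>) / 5) \<le> real n powr (1 / 5)" using assms elim by (intro powr_mono) auto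
    hence "real (k n) \<le> c * real n powr (1 / 5)"
      using elim(1) c(1) by simp (meson less_imp_le mult_left_mono order.trans)
    thus ?case using D by (intro mult_right_mono add_mono mult_left_mono power_mono) auto
  qed
  have nonneg: "\<forall>\<^sub>F n in sequentially. 0 \<le> (2 * (real (k n) + 2) + (real (k n) + 2)\<^sup>2) *
     (2 * (real n powr (- 9 / 20) + 2 * (2 * D / real n)))"
    using D by (intro always_eventually allI mult_nonneg_nonneg add_nonneg_nonneg) auto
  show ?thesis
    unfolding D_def[symmetric] by (rule tendsto_sandwich[OF nonneg le tendsto_const lim])
qed

theorem strong_consistency:
  fixes k :: "nat \<Rightarrow> nat"
  assumes pair: "(\<mu>, \<nu>) \<in> chi2_pairs (cube d)" and f: "chi2_opt \<mu> \<nu> f" and cont: "continuous_on (cube d) f"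
    and \<phi>: "\<phi> \<in> {sigmoid_act, relu}" and \<rho>: "0 < \<rho>" "\<rho> < 1"
    and k: "filterlim k at_top sequentially" "(\<lambda>n. real (k n)) \<in> O(\<lambda>n. real n powr ((1 - \<rho>) / 5))"
    and iid: "iid_samples P \<mu> \<nu> X Y"
  shows "AE \<omega> in P. (\<lambda>n. chi2_est (nn_star d (k n) \<phi>) n (\<lambda>i. X i \<omega>) (\<lambda>i. Y i \<omega>))
           \<longlonglongrightarrow> enn2real (chi2 \<mu> \<nu>)"
proof -
  interpret activation \<phi> using \<phi> activation_sigmoid activation_relu by blast
  have \<mu>: "borel_prob_on (cube d) \<mu>" and \<nu>: "borel_prob_on (cube d) \<nu>" using pair by (auto simp: chi2_pairs_def)
  have P: "prob_space P" using iid by (simp add: iid_samples_def)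
  interpret \<nu>: prob_space \<nu> by (rule borel_prob_onD(1)[OF \<nu>])
  interpret R: ridge_closure \<phi> \<nu> d by unfold_locales (rule \<nu>)
  have fm: "f \<in> borel_measurable \<nu>" using f by (simp add: chi2_opt_def)
  have approx: "R.approximable f"
  proof (cases "\<phi> = sigmoid_act")
    case True
    interpret S: sigmoid_closure \<nu> d using R.ridge_closure_axioms True by (simp add: sigmoid_closure_def)
    show ?thesis using S.approximable_continuous_sigmoid[OF cont fm] True by simp
  next
    case False
    hence r: "\<phi> = relu" using \<phi> by simp
    interpret S: relu_closure \<nu> d using R.ridge_closure_axioms r by (simp add: relu_closure_def)
    show ?thesis using S.approximable_continuous_relu[OF cont fm] r by simp
  qed
  define w where "w n = real n powr (- 9 / 20) + 2 * (2 * real (2 * d + 2) / real n)" for n :: nat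
  define \<Delta> where "\<Delta> n = (2 * (real (k n) + 2) + (real (k n) + 2)\<^sup>2) * (2 * w n)" for n
  have \<Delta>0: "\<Delta> \<longlonglongrightarrow> 0" using deviation_rate_vanishes[OF \<rho> k(2)] by (simp add: \<Delta>_def[abs_def] w_def)
  have "AE \<omega> in P. \<forall>\<^sub>F n in sequentially. ridge_deviation_bound d \<mu> n (\<lambda>i. X i \<omega>) (w n)"
    "AE \<omega> in P. \<forall>\<^sub>F n in sequentially. ridge_deviation_bound d \<nu> n (\<lambda>i. Y i \<omega>) (w n)"
    unfolding w_def using iid_samples_iid_sample[OF iid]
    by (intro ridge_deviation_eventually P \<mu> \<nu>; blast)+
  thus ?thesis using AE_space
  proof eventually_elim
    case (elim \<omega>)
    have in_cube: "X i \<omega> \<in> cube d" "Y i \<omega> \<in> cube d" for i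
      using iid_sample.X_in_space[OF iid_samples_iid_sample(1)[OF iid, of "Suc i"] elim(3), of i]
        iid_sample.X_in_space[OF iid_samples_iid_sample(2)[OF iid, of "Suc i"] elim(3), of i]
        borel_prob_onD(2)[OF \<mu>] borel_prob_onD(2)[OF \<nu>] by auto
    show ?case
    proof (rule tendstoI)
      fix \<epsilon> :: real assume \<epsilon>: "\<epsilon> > 0"
      obtain K g where g: "\<forall>k\<ge>K. g \<in> nn_star d k \<phi>" "(\<integral>x. (f x - g x)\<^sup>2 \<partial>\<nu>) \<le> \<epsilon>"
        using R.approximable_nn_star[OF approx \<epsilon>] by blast
      have "\<forall>\<^sub>F n in sequentially. k n \<ge> K" using k(1) by (simp add: filterlim_at_top)
      moreover have "\<forall>\<^sub>F n in sequentially. \<Delta> n < \<epsilon> / 2" using \<Delta>0 \<epsilon> by (intro order_tendstoD) auto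
      ultimately show "\<forall>\<^sub>F n in sequentially. dist (chi2_est (nn_star d (k n) \<phi>) n (\<lambda>i. X i \<omega>) (\<lambda>i. Y i \<omega>)) (enn2real (chi2 \<mu> \<nu>)) < \<epsilon>"
        using elim(1,2)
      proof eventually_elim
        case (elim n)
        have "\<bar>chi2_est (nn_star d (k n) \<phi>) n (\<lambda>i. X i \<omega>) (\<lambda>i. Y i \<omega>) - enn2real (chi2 \<mu> \<nu>)\<bar>
           \<le> \<Delta> n + 1/4 * (\<integral>x. (f x - g x)\<^sup>2 \<partial>\<nu>)"
        proof (rule estimator_error[OF pair f])
          show "g \<in> nn_star d (k n) \<phi>" using g elim by blast
          fix h assume "h \<in> nn_star d (k n) \<phi>"
          then obtain L where L: "L \<le> real (k n) + 2" "ridge_sum d \<phi> L h" using nn_star_ridge_sum by blast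
          show "h \<in> borel_measurable borel" by (rule ridge_sum_measurable[OF L(2)])
          show "\<bar>h x\<bar> \<le> 2 * (real (k n) + 2)" if "x \<in> cube d" for x
            by (rule order.trans[OF ridge_sum_bounded[OF L(2) that]]) (use L(1) in simp)
          show "\<bar>sample_objective n (\<lambda>i. X i \<omega>) (\<lambda>i. Y i \<omega>) h - objective \<mu> \<nu> h\<bar> \<le> \<Delta> n"
            using objective_deviation[OF \<mu> \<nu> in_cube elim(3,4) L(2,1)] by (simp add: \<Delta>_def)
        qed
        thus ?case using g(2) elim(2) \<epsilon> by (simp add: dist_real_def)
      qed
    qed
  qed
qed

theorem theorem22:
  shows
    "(\<forall>(d::nat) \<mu> \<nu> f \<phi> (\<rho>::real) (k :: nat \<Rightarrow> nat) (P :: 'w measure) X Y.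
        d \<ge> 1 \<longrightarrow>
        (\<mu>, \<nu>) \<in> chi2_pairs (cube d) \<longrightarrow>
        chi2_opt \<mu> \<nu> f \<longrightarrow> continuous_on (cube d) f \<longrightarrow>
        \<phi> \<in> {sigmoid_act, relu} \<longrightarrow>
        0 < \<rho> \<longrightarrow> \<rho> < 1 \<longrightarrow>
        filterlim k at_top sequentially \<longrightarrow>
        (\<lambda>n. real (k n)) \<in> O(\<lambda>n. real n powr ((1 - \<rho>) / 5)) \<longrightarrow>
        iid_samples P \<mu> \<nu> X Y \<longrightarrow>
        (AE \<omega> in P. (\<lambda>n. chi2_est (nn_star d (k n) \<phi>) n (\<lambda>i. X i \<omega>) (\<lambda>i. Y i \<omega>))
           \<longlonglongrightarrow> enn2real (chi2 \<mu> \<nu>)))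
     \<and>
     (\<forall>M::real. M \<ge> 0 \<longrightarrow>
        (\<exists>C::real. \<forall>(d::nat) (k::nat) (n::nat). d \<ge> 1 \<longrightarrow> k \<ge> 1 \<longrightarrow> n \<ge> 1 \<longrightarrow>
           (SUP (\<mu>, \<nu>) \<in> chi2_pairs_bd d M (cube d).
              \<integral>\<^sup>+ (x, y). ennreal \<bar>chi2_est (nn_relu d k (ln (real k))) n x y - enn2real (chi2 \<mu> \<nu>)\<bar>
                \<partial>sample_law n \<mu> \<nu>)
           \<le> ennreal (C * (real d * real k powr (- 1 / 2)
                + real d powr (3 / 2) * (ln (real k))\<^sup>2 * real n powr (- 1 / 2)))))"
  using strong_consistency risk_bound by blast

end
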